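(* Let $0<\alpha\leq\beta\leq 1$, let $X,\{X_{k,l},\ k,l\geq 0\}$ be i.i.d. real-valued random variables, and let $\mu\in\mathbb{R}$. Then $$\sum_{m=1}^{\infty}\sum_{n=1}^{\infty} P\Big(\Big|\sum_{k=0}^{m}\sum_{l=0}^{n} A_{m-k}^{\alpha-1}A_{n-l}^{\beta-1} X_{k,l}-\mu A_m^{\alpha}A_n^{\beta}\Big|>A_m^{\alpha}A_n^{\beta}\,\varepsilon\Big)<\infty\quad\text{for every }\varepsilon>0$$ if and only if $E\,X=\mu$ and the following moment condition (according to the values of $\alpha,\beta$) holds: $$\begin{cases} E|X|^{1/\alpha}<\infty,&\text{for } 0<\alpha<\frac12,\ \alpha<\beta\leq 1,\\ E|X|^{1/\alpha}\log^+|X|<\infty,&\text{for } 0<\alpha=\beta<\frac12,\\ E|X|^2(\log^+|X|)^3<\infty,&\text{for } \alpha=\beta=\frac12,\\ E|X|^2(\log^+|X|)^2<\infty,&\text{for } \alpha=\frac12<\beta\leq 1,\\ E|X|^2\log^+|X|<\infty,&\text{for } \frac12<\alpha\leq\beta\leq 1. \end{cases}$$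
   Context: For $\gamma>-1$ the Cesàro numbers are $A_0^{\gamma}=1$ and $A_n^{\gamma}=\frac{(\gamma+1)(\gamma+2)\cdots(\gamma+n)}{n!}$ for $n=1,2,\dots$. In particular $A_n^0=1$ for all $n\ge 0$. Here $\log^+x=\max\{\log x,1\}$ (with value $1$ at $x=0$). *)

theory Defs
  imports "HOL-Probability.Probability"
begin

definition cesaro :: "real \<Rightarrow> nat \<Rightarrow> real" where
  "cesaro \<gamma> n = (\<Prod>i=1..n. \<gamma> + real i) / fact n"

text \<open>The lower cut-off is the value 1 of the logarithm, not the value 0;
  \<^term>\<open>ln (0::real) = 0\<close> gives the intended value 1 at 0.\<close>

definition log_plus :: "real \<Rightarrow> real" where
  "log_plus x = max (ln x) 1"

definition cesaro_sum ::
  "real \<Rightarrow> real \<Rightarrow> (nat \<Rightarrow> nat \<Rightarrow> 'a \<Rightarrow> real) \<Rightarrow> nat \<Rightarrow> nat \<Rightarrow> 'a \<Rightarrow> real" where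
  "cesaro_sum \<alpha> \<beta> Y m n \<omega> =
     (\<Sum>k=0..m. \<Sum>l=0..n. cesaro (\<alpha> - 1) (m - k) * cesaro (\<beta> - 1) (n - l) * Y k l \<omega>)"

end

theory Submission
  imports Defs
begin

text \<open>Write the event as \<open>\<bar>\<Sum> w\<^sub>i Y\<^sub>i - \<mu>\<bar> > \<epsilon>\<close>, where the weights \<open>w\<^sub>i\<close> are positive, have sum 1, and are
  at most \<open>1 / (A\<^sub>m\<^sup>\<alpha> A\<^sub>n\<^sup>\<beta>)\<close>. Such a sum is large essentially only if one summand is.
  In one direction, truncation and an exponential moment bound the probability by
  \<open>2 \<Sum> P(\<bar>w\<^sub>i Y\<^sub>i\<bar> > \<delta>)\<close> plus a high power of the variance of the sum, which is summable over
  \<open>(m, n)\<close>. In the other direction, if the probability is small, then the events that exactly one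
  summand is large while the others behave show that it dominates \<open>\<Sum> P(\<bar>w\<^sub>i Y\<^sub>i\<bar> > 3\<epsilon>) / 4\<close>.
  So everything depends on the convergence of \<open>\<Sum> P(w\<^sub>i \<bar>X\<bar> > t)\<close> over all \<open>(m, n)\<close> and all \<open>i\<close>.
  By Fubini this is the expected number of quadruples with
  \<open>m\<^sup>\<alpha> k\<^bsup>1-\<alpha>\<^esup> n\<^sup>\<beta> l\<^bsup>1-\<beta>\<^esup> < C \<bar>X\<bar>\<close>, \<open>k \<le> m\<close>, \<open>l \<le> n\<close>, and the number of those below the level \<open>x\<close> is of order
  \<open>x\<^sup>p (log\<^sup>+ x)\<^sup>e\<close> with \<open>p = max (1/\<alpha>) 2\<close>, where \<open>e\<close> counts the critical sums that
  contribute a logarithm.\<close>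

section \<open>Growth of the Cesaro numbers\<close>

text \<open>Chebyshev's inequality is too weak here: the variance of the normalised sum is only
  bounded by a multiple of \<open>m powr (-\<alpha>) * n powr (-\<beta>)\<close>, which is not
  summable. Hence the inequality whose variance term can be raised to any power \<open>r\<close>; it
  is used with \<open>\<alpha> * r \<ge> 2\<close>. Its price is one jump term per summand, and that
  term has to be counted sharply, logarithms included. In the count the two orders play different
  parts. Pairs of the smaller order \<alpha> are counted below a level and fix the power
  \<open>p\<close>; a pair of order \<beta> and weight \<open>w\<close> rescales the level to
  \<open>x / w\<close> and contributes a factor \<open>w powr (-p)\<close>. So logarithms arise in
  two places: in the count itself when \<open>\<alpha> = 1/2\<close>, and in the sum of
  \<open>w powr (-p)\<close>. The lower bound keeps only \<open>w \<le> sqrt x\<close>, where the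
  logarithm of \<open>x / w\<close> is still comparable with that of \<open>x\<close>. In the
  converse nothing is known about the mean. The jump inequality allows any centre, so the moment
  condition is obtained first; the direct half, applied with the true mean, then forces it to be
  \<mu>.\<close>

lemma cesaro_Suc: "cesaro \<gamma> (Suc n) = cesaro \<gamma> n * (\<gamma> + real n + 1) / (real n + 1)"
  by (simp add: cesaro_def field_simps)

lemma cesaro_0 [simp]: "cesaro \<gamma> 0 = 1"
  by (simp add: cesaro_def)

lemma cesaro_pos: "\<gamma> > -1 \<Longrightarrow> cesaro \<gamma> n > 0"
  by (auto simp: cesaro_def intro!: prod_pos divide_pos_pos)

lemma cesaro_le_1:
  assumes "-1 < \<gamma>" "\<gamma> \<le> 0"
  shows "cesaro \<gamma> n \<le> 1"
proof (induction n)
  case (Suc n)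
  have "cesaro \<gamma> n * ((\<gamma> + real n + 1) / (real n + 1)) \<le> 1 * 1"
    using assms by (intro mult_mono Suc) (auto simp: field_simps)
  then show ?case by (simp add: cesaro_Suc)
qed simp

text \<open>From \<open>n\<close> to \<open>n + 1\<close> the numbers of order \<alpha> grow by the
  factor \<open>1 + \<alpha> / (n + 1)\<close>. The number of order \<open>\<alpha> - 1\<close> is
  exactly this increment, so its partial sums telescope.\<close>

lemma cesaro_diff_one_Suc: "cesaro (\<alpha> - 1) (Suc n) = \<alpha> / (real n + 1) * cesaro \<alpha> n"
proof (induction n)
  case 0
  then show ?case by (simp add: cesaro_Suc)
next
  case (Suc n)
  have "cesaro (\<alpha> - 1) (Suc (Suc n)) = cesaro (\<alpha> - 1) (Suc n) * (\<alpha> + real n + 1) / (real n + 2)"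
    by (subst cesaro_Suc) (simp add: algebra_simps)
  also have "\<dots> = \<alpha> / (real (Suc n) + 1) * cesaro \<alpha> (Suc n)"
    unfolding Suc by (simp add: cesaro_Suc field_simps)
  finally show ?case .
qed

lemma sum_cesaro: "(\<Sum>k\<le>n. cesaro (\<alpha> - 1) k) = cesaro \<alpha> n"
proof (induction n)
  case (Suc n)
  have "(\<Sum>k\<le>Suc n. cesaro (\<alpha> - 1) k) = cesaro \<alpha> n + \<alpha> / (real n + 1) * cesaro \<alpha> n"
    by (simp add: Suc cesaro_diff_one_Suc)
  also have "\<dots> = cesaro \<alpha> (Suc n)"
    by (simp add: cesaro_Suc field_simps)
  finally show ?case .
qed simp

text \<open>A convergent sequence is bounded, and so is its reciprocal once the limit is nonzero.
  This gives constants valid for every index and not only eventually.\<close>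

lemma bounded_between_if_tendsto_pos:
  fixes f :: "nat \<Rightarrow> real"
  assumes pos: "\<And>n. f n > 0" and lim: "f \<longlonglongrightarrow> L" and "L > 0"
  obtains c C where "c > 0" "C > 0" "\<And>n. c \<le> f n" "\<And>n. f n \<le> C"
proof -
  obtain C where C: "C > 0" "\<And>n. norm (f n) \<le> C"
    using convergent_imp_Bseq[of f] lim unfolding convergent_def Bseq_def by blast
  have "(\<lambda>n. inverse (f n)) \<longlonglongrightarrow> inverse L"
    using lim \<open>L > 0\<close> by (intro tendsto_inverse) auto
  then obtain D where D: "D > 0" "\<And>n. norm (inverse (f n)) \<le> D"
    using convergent_imp_Bseq[of "\<lambda>n. inverse (f n)"] unfolding convergent_def Bseq_def by blast
  show thesis
  proof
    show "inverse D > 0" "C > 0" using C D by auto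
    show "f n \<le> C" for n using C(2)[of n] by simp
    show "inverse D \<le> f n" for n
      using D(2)[of n] D(1) pos[of n] by (simp add: field_simps)
  qed
qed

text \<open>After division by \<open>(n + 1) powr \<gamma>\<close> the numbers converge to
  \<open>1 / Gamma (\<gamma> + 1)\<close>, by Euler's limit formula. The shift by 1 keeps the bounds
  meaningful at \<open>n = 0\<close>.\<close>

lemma cesaro_bounds:
  assumes "\<gamma> > -1"
  obtains c C where "c > 0" "C > 0"
    "\<And>n. c * (real n + 1) powr \<gamma> \<le> cesaro \<gamma> n" "\<And>n. cesaro \<gamma> n \<le> C * (real n + 1) powr \<gamma>"
proof -
  define f where "f = (\<lambda>n. cesaro \<gamma> n / (real n + 1) powr \<gamma>)"
  have pos: "f n > 0" for n
    using cesaro_pos[OF assms] by (simp add: f_def)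
  have G: "Gamma (\<gamma> + 1) > 0"
    using assms by (intro Gamma_real_pos) auto
  \<comment> \<open>At \<open>n = 0\<close> the right-hand side is 0 because of the factor
    \<open>0 powr \<gamma>\<close>, while \<open>f 0 = 1\<close>; the limit does not notice
    this.\<close>
  have eq: "f n = (real n / (real n + 1)) powr \<gamma> * inverse (Gamma_series' (\<gamma> + 1) n)" if "n \<ge> 1" for n
  proof -
    have "cesaro \<gamma> n = pochhammer (\<gamma> + 1) n / fact n"
      unfolding cesaro_def pochhammer_prod
      by (rule arg_cong[where f = "\<lambda>x. x / _"], rule prod.reindex_bij_witness[of _ Suc "\<lambda>i. i - 1"]) auto
    moreover have "exp ((\<gamma> + 1) * ln (real n)) = real n powr \<gamma> * real n"
      using that by (simp add: powr_def exp_add algebra_simps)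
    moreover have "(fact n :: real) = real n * fact (n - 1)"
      using that by (simp add: fact_reduce)
    ultimately show ?thesis
      using that by (simp add: f_def Gamma_series'_def powr_divide field_simps)
  qed
  have "(\<lambda>n. (real n / (real n + 1)) powr \<gamma> * inverse (Gamma_series' (\<gamma> + 1) n))
      \<longlonglongrightarrow> 1 powr \<gamma> * inverse (Gamma (\<gamma> + 1))"
  proof (intro tendsto_mult tendsto_powr tendsto_inverse Gamma_series'_LIMSEQ tendsto_const)
    show "(\<lambda>n. real n / (real n + 1)) \<longlonglongrightarrow> 1"
      using LIMSEQ_n_over_Suc_n by (simp add: add_ac)
  qed (use G in auto)
  then have "f \<longlonglongrightarrow> 1 powr \<gamma> * inverse (Gamma (\<gamma> + 1))"
    by (rule Lim_transform_eventually)
       (use eq in \<open>auto intro!: eventually_sequentiallyI[of 1]\<close>)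
  moreover have "1 powr \<gamma> * inverse (Gamma (\<gamma> + 1)) > 0"
    using G by simp
  ultimately obtain c C where cC: "c > 0" "C > 0" "\<And>n. c \<le> f n" "\<And>n. f n \<le> C"
    using bounded_between_if_tendsto_pos[of f] pos by blast
  have "c * (real n + 1) powr \<gamma> \<le> cesaro \<gamma> n" "cesaro \<gamma> n \<le> C * (real n + 1) powr \<gamma>" for n
  proof -
    have "(real n + 1) powr \<gamma> > 0" by simp
    then show "c * (real n + 1) powr \<gamma> \<le> cesaro \<gamma> n" "cesaro \<gamma> n \<le> C * (real n + 1) powr \<gamma>"
      using cC(3,4)[of n] by (simp_all only: f_def pos_le_divide_eq pos_divide_le_eq)
  qed
  then show thesis using that cC(1,2) by blast
qed

section \<open>Two inequalities for sums of independent variables\<close>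

lemma exp_le_quadratic:
  fixes y s :: real
  assumes "\<bar>y\<bar> \<le> s"
  shows "exp y \<le> 1 + y + y\<^sup>2 * exp s / 2"
proof -
  obtain t where t: "\<bar>t\<bar> \<le> \<bar>y\<bar>" "exp y = (\<Sum>m<2. y ^ m / fact m) + exp t / fact 2 * y ^ 2"
    using Maclaurin_exp_le[of y 2] by blast
  have "exp t / fact 2 * y ^ 2 \<le> exp s / 2 * y ^ 2"
    using t(1) assms by (intro mult_right_mono) auto
  then show ?thesis
    using t(2) by (simp add: numeral_2_eq_2 algebra_simps)
qed

text \<open>A bound of Fuk-Nagaev type. Every variable is cut off at \<delta> and Markov's
  inequality is applied to the exponential of the truncated sum; the first term on the right pays
  for the truncation. The level grows with the free parameter \<open>r\<close>, and in return the
  variance ratio gets the power \<open>r\<close>.\<close>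

lemma (in prob_space) prob_sum_gt_le:
  fixes Z :: "'i \<Rightarrow> 'a \<Rightarrow> real" and r :: nat and V \<delta> :: real
  assumes fin: "finite I" and indep: "indep_vars (\<lambda>_. borel) Z I"
    and int: "\<And>i. i \<in> I \<Longrightarrow> integrable M (Z i)"
    and sq: "\<And>i. i \<in> I \<Longrightarrow> integrable M (\<lambda>\<omega>. (Z i \<omega>)\<^sup>2)"
    and mean: "\<And>i. i \<in> I \<Longrightarrow> expectation (Z i) = 0"
    and var: "(\<Sum>i\<in>I. expectation (\<lambda>\<omega>. (Z i \<omega>)\<^sup>2)) \<le> V"
    and V: "0 < V" and \<delta>: "0 < \<delta>"
  shows "prob {\<omega> \<in> space M. (\<Sum>i\<in>I. Z i \<omega>) > 2 * real r * \<delta>}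
    \<le> (\<Sum>i\<in>I. prob {\<omega> \<in> space M. \<bar>Z i \<omega>\<bar> > \<delta>}) + exp 2 * (V / \<delta>\<^sup>2) ^ r"
proof (cases "V \<le> \<delta>\<^sup>2")
  \<comment> \<open>The choice of \<open>s\<close> below needs \<open>V \<le> \<delta>^2\<close>;
    otherwise the last term alone is at least 1.\<close>
  case False
  then have "V / \<delta>\<^sup>2 \<ge> 1" using \<delta> by simp
  then have "exp 2 * (V / \<delta>\<^sup>2) ^ r \<ge> 1 * (1::real)"
    by (intro mult_mono one_le_power) auto
  moreover have "prob {\<omega> \<in> space M. (\<Sum>i\<in>I. Z i \<omega>) > 2 * real r * \<delta>} \<le> 1" by (rule prob_le_1)
  moreover have "(\<Sum>i\<in>I. prob {\<omega> \<in> space M. \<bar>Z i \<omega>\<bar> > \<delta>}) \<ge> 0" by (intro sum_nonneg) simp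
  ultimately show ?thesis by linarith
next
  case True
  have [measurable]: "Z i \<in> borel_measurable M" if "i \<in> I" for i
    using indep that by (auto simp: indep_vars_def)
  \<comment> \<open>This value turns \<open>V * (2 * exp (2 * s) / \<delta>^2)\<close> into the
    constant 2, whence the factor \<open>exp 2\<close>. Passing the level
    \<open>2 * r * \<delta>\<close> costs \<open>exp (- (2 * r * s))\<close>, which is the power
    \<open>r\<close> of \<open>V / \<delta>^2\<close>.\<close>
  define s where "s = ln (\<delta>\<^sup>2 / V) / 2"
  have s0: "s \<ge> 0" and es: "exp (2 * s) = \<delta>\<^sup>2 / V"
    using True V \<delta> by (auto simp: s_def)
  define t where "t = s / \<delta>"
  have t0: "t \<ge> 0" and ts: "t * \<delta> = s" using s0 \<delta> by (auto simp: t_def)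
  define trunc where "trunc = (\<lambda>z::real. if \<bar>z\<bar> \<le> \<delta> then z else 0)"
  have [measurable]: "trunc \<in> borel_measurable borel"
    unfolding trunc_def by measurable
  define F where "F = (\<lambda>i \<omega>. exp (t * trunc (Z i \<omega>)))"
  have trunc_abs: "\<bar>t * trunc z\<bar> \<le> s" for z
    using ts t0 s0 by (auto simp: trunc_def abs_mult abs_le_iff mult_left_mono[of "\<bar>z\<bar>" \<delta> t, unfolded ts])
  \<comment> \<open>The linear term contains \<open>z\<close> and not its truncation, so the zero
    mean removes it without recentring. The error \<open>trunc z - z \<le> z^2 / \<delta>\<close>
    goes into the quadratic term.\<close>
  have pointwise: "exp (t * trunc z) \<le> 1 + t * z + z\<^sup>2 * (2 * exp (2 * s) / \<delta>\<^sup>2)" for z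
  proof -
    have a: "exp (t * trunc z) \<le> 1 + t * trunc z + (t * trunc z)\<^sup>2 * exp s / 2"
      by (rule exp_le_quadratic[OF trunc_abs])
    have b: "t * trunc z \<le> t * (z + z\<^sup>2 / \<delta>)"
    proof (intro mult_left_mono t0)
      show "trunc z \<le> z + z\<^sup>2 / \<delta>"
      proof (cases "\<bar>z\<bar> \<le> \<delta>")
        case False
        then have "\<bar>z\<bar> * \<delta> \<le> \<bar>z\<bar> * \<bar>z\<bar>" by (intro mult_left_mono) auto
        then have "\<bar>z\<bar> \<le> z\<^sup>2 / \<delta>" using \<delta> by (simp add: field_simps power2_eq_square abs_mult_self_eq)
        then show ?thesis using False by (auto simp: trunc_def)
      qed (use \<delta> in \<open>auto simp: trunc_def\<close>)
    qed
    have c: "(t * trunc z)\<^sup>2 * exp s / 2 \<le> (t * z)\<^sup>2 * exp s / 2"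
      by (auto simp: trunc_def)
    have d: "1 + t * (z + z\<^sup>2 / \<delta>) + (t * z)\<^sup>2 * exp s / 2
        = 1 + t * z + z\<^sup>2 * ((s + s\<^sup>2 * exp s / 2) / \<delta>\<^sup>2)"
      using \<delta> by (simp add: t_def field_simps power2_eq_square)
    have e: "s + s\<^sup>2 * exp s / 2 \<le> 2 * exp (2 * s)"
    proof -
      have a: "1 + s + s\<^sup>2 / 2 \<le> exp s"
        using s0 by (rule exp_lower_Taylor_quadratic)
      have e: "exp (2 * s) = exp s * exp s" by (simp flip: exp_add)
      have "exp s \<ge> 1" using s0 by simp
      then have "exp s \<le> exp (2 * s)" using s0 by simp
      moreover have "s\<^sup>2 / 2 * exp s \<le> exp s * exp s"
        using a s0 by (intro mult_right_mono) auto
      moreover have "s \<le> exp s" using exp_ge_add_one_self[of s] by linarith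
      ultimately show ?thesis using e by linarith
    qed
    have "z\<^sup>2 * ((s + s\<^sup>2 * exp s / 2) / \<delta>\<^sup>2) \<le> z\<^sup>2 * (2 * exp (2 * s) / \<delta>\<^sup>2)"
      by (intro mult_left_mono divide_right_mono e) auto
    with a b c d show ?thesis by linarith
  qed
  have Fint: "integrable M (F i)" if "i \<in> I" for i
  proof (rule integrable_const_bound[where B = "exp s"])
    show "AE \<omega> in M. norm (F i \<omega>) \<le> exp s"
      using trunc_abs by (auto simp: F_def abs_le_iff)
    show "F i \<in> borel_measurable M" unfolding F_def using that by measurable
  qed
  have Fle: "expectation (F i) \<le> exp (expectation (\<lambda>\<omega>. (Z i \<omega>)\<^sup>2) * (2 * exp (2 * s) / \<delta>\<^sup>2))"
    if i: "i \<in> I" for i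
  proof -
    have "expectation (F i) \<le> expectation (\<lambda>\<omega>. 1 + t * Z i \<omega> + (Z i \<omega>)\<^sup>2 * (2 * exp (2 * s) / \<delta>\<^sup>2))"
      using Fint[OF i] int[OF i] sq[OF i] pointwise
      by (intro integral_mono) (auto simp: F_def)
    also have "\<dots> = 1 + expectation (\<lambda>\<omega>. (Z i \<omega>)\<^sup>2) * (2 * exp (2 * s) / \<delta>\<^sup>2)"
      using int[OF i] sq[OF i] mean[OF i] by (simp add: prob_space)
    also have "\<dots> \<le> exp (expectation (\<lambda>\<omega>. (Z i \<omega>)\<^sup>2) * (2 * exp (2 * s) / \<delta>\<^sup>2))"
      by (rule exp_ge_add_one_self)
    finally show ?thesis .
  qed
  have Findep: "indep_vars (\<lambda>_. borel) F I"
    unfolding F_def by (rule indep_vars_compose2[OF indep]) measurable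
  let ?E = "\<lambda>\<omega>. \<Prod>i\<in>I. F i \<omega>"
  have Eint: "integrable M ?E"
    using Fint by (intro indep_vars_integrable fin Findep) auto
  have "expectation ?E = (\<Prod>i\<in>I. expectation (F i))"
    using Fint by (intro indep_vars_lebesgue_integral fin Findep) auto
  also have "\<dots> \<le> (\<Prod>i\<in>I. exp (expectation (\<lambda>\<omega>. (Z i \<omega>)\<^sup>2) * (2 * exp (2 * s) / \<delta>\<^sup>2)))"
    using Fle by (intro prod_mono) (auto simp: F_def)
  also have "\<dots> = exp ((\<Sum>i\<in>I. expectation (\<lambda>\<omega>. (Z i \<omega>)\<^sup>2)) * (2 * exp (2 * s) / \<delta>\<^sup>2))"
    by (simp only: exp_sum[OF fin] sum_distrib_right)
  also have "\<dots> \<le> exp (V * (2 * exp (2 * s) / \<delta>\<^sup>2))"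
    unfolding exp_le_cancel_iff by (intro mult_right_mono var) auto
  also have "V * (2 * exp (2 * s) / \<delta>\<^sup>2) = 2"
    using V \<delta> by (simp add: es)
  finally have E_le: "expectation ?E \<le> exp 2" .
  have E_eq: "?E \<omega> = exp (t * (\<Sum>i\<in>I. trunc (Z i \<omega>)))" for \<omega>
    by (simp add: F_def exp_sum fin sum_distrib_left)
  have "prob {\<omega> \<in> space M. ?E \<omega> \<ge> exp (2 * real r * s)} \<le> expectation ?E / exp (2 * real r * s)"
    by (intro integral_Markov_inequality_measure[where A = "{}"] Eint)
       (auto simp: F_def intro!: prod_nonneg)
  also have "\<dots> \<le> exp 2 / exp (2 * real r * s)"
    by (intro divide_right_mono E_le) auto
  also have "exp 2 / exp (2 * real r * s) = exp 2 / exp (2 * s) ^ r"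
    by (simp flip: exp_of_nat_mult add: mult_ac)
  also have "\<dots> = exp 2 * (V / \<delta>\<^sup>2) ^ r"
    unfolding es by (simp add: power_divide)
  finally have A: "prob {\<omega> \<in> space M. ?E \<omega> \<ge> exp (2 * real r * s)} \<le> exp 2 * (V / \<delta>\<^sup>2) ^ r" .
  have "prob {\<omega> \<in> space M. (\<Sum>i\<in>I. Z i \<omega>) > 2 * real r * \<delta>}
      \<le> prob ((\<Union>i\<in>I. {\<omega> \<in> space M. \<bar>Z i \<omega>\<bar> > \<delta>}) \<union> {\<omega> \<in> space M. ?E \<omega> \<ge> exp (2 * real r * s)})"
  proof (intro finite_measure_mono subsetI)
    fix \<omega> assume \<omega>: "\<omega> \<in> {\<omega> \<in> space M. (\<Sum>i\<in>I. Z i \<omega>) > 2 * real r * \<delta>}"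
    show "\<omega> \<in> (\<Union>i\<in>I. {\<omega> \<in> space M. \<bar>Z i \<omega>\<bar> > \<delta>}) \<union> {\<omega> \<in> space M. ?E \<omega> \<ge> exp (2 * real r * s)}"
    proof (cases "\<exists>i\<in>I. \<bar>Z i \<omega>\<bar> > \<delta>")
      case False
      then have "(\<Sum>i\<in>I. trunc (Z i \<omega>)) = (\<Sum>i\<in>I. Z i \<omega>)"
        by (intro sum.cong) (auto simp: trunc_def not_less)
      then have "t * (\<Sum>i\<in>I. trunc (Z i \<omega>)) \<ge> t * (2 * real r * \<delta>)"
        using \<omega> by (intro mult_left_mono t0) auto
      moreover have "t * (2 * real r * \<delta>) = 2 * real r * s"
        by (simp flip: ts)
      ultimately have "?E \<omega> \<ge> exp (2 * real r * s)"
        unfolding E_eq by simp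
      then show ?thesis using \<omega> by auto
    qed (use \<omega> in auto)
  next
    show "(\<Union>i\<in>I. {\<omega> \<in> space M. \<bar>Z i \<omega>\<bar> > \<delta>}) \<union> {\<omega> \<in> space M. ?E \<omega> \<ge> exp (2 * real r * s)} \<in> events"
      using Eint fin by (intro sets.Un sets.finite_UN) (auto dest: borel_measurable_integrable)
  qed
  also have "\<dots> \<le> prob (\<Union>i\<in>I. {\<omega> \<in> space M. \<bar>Z i \<omega>\<bar> > \<delta>}) + prob {\<omega> \<in> space M. ?E \<omega> \<ge> exp (2 * real r * s)}"
    using Eint fin by (intro measure_Un_le sets.finite_UN) (auto dest: borel_measurable_integrable)
  also have "prob (\<Union>i\<in>I. {\<omega> \<in> space M. \<bar>Z i \<omega>\<bar> > \<delta>}) \<le> (\<Sum>i\<in>I. prob {\<omega> \<in> space M. \<bar>Z i \<omega>\<bar> > \<delta>})"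
    using fin by (intro finite_measure_subadditive_finite) auto
  finally show ?thesis using A by simp
qed

lemma (in prob_space) prob_abs_sum_gt_le:
  fixes Z :: "'i \<Rightarrow> 'a \<Rightarrow> real" and r :: nat and V \<delta> :: real
  assumes fin: "finite I" and indep: "indep_vars (\<lambda>_. borel) Z I"
    and int: "\<And>i. i \<in> I \<Longrightarrow> integrable M (Z i)"
    and sq: "\<And>i. i \<in> I \<Longrightarrow> integrable M (\<lambda>\<omega>. (Z i \<omega>)\<^sup>2)"
    and mean: "\<And>i. i \<in> I \<Longrightarrow> expectation (Z i) = 0"
    and var: "(\<Sum>i\<in>I. expectation (\<lambda>\<omega>. (Z i \<omega>)\<^sup>2)) \<le> V"
    and V: "0 < V" and \<delta>: "0 < \<delta>"
  shows "prob {\<omega> \<in> space M. \<bar>\<Sum>i\<in>I. Z i \<omega>\<bar> > 2 * real r * \<delta>}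
    \<le> 2 * (\<Sum>i\<in>I. prob {\<omega> \<in> space M. \<bar>Z i \<omega>\<bar> > \<delta>}) + 2 * exp 2 * (V / \<delta>\<^sup>2) ^ r"
proof -
  have [measurable]: "Z i \<in> borel_measurable M" if "i \<in> I" for i
    using indep that by (auto simp: indep_vars_def)
  have neg: "indep_vars (\<lambda>_. borel) (\<lambda>i \<omega>. - Z i \<omega>) I"
    by (rule indep_vars_compose2[OF indep]) measurable
  have "prob {\<omega> \<in> space M. \<bar>\<Sum>i\<in>I. Z i \<omega>\<bar> > 2 * real r * \<delta>}
    \<le> prob ({\<omega> \<in> space M. (\<Sum>i\<in>I. Z i \<omega>) > 2 * real r * \<delta>} \<union> {\<omega> \<in> space M. (\<Sum>i\<in>I. - Z i \<omega>) > 2 * real r * \<delta>})"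
    by (intro finite_measure_mono) (auto simp: sum_negf abs_if split: if_splits)
  also have "\<dots> \<le> prob {\<omega> \<in> space M. (\<Sum>i\<in>I. Z i \<omega>) > 2 * real r * \<delta>} + prob {\<omega> \<in> space M. (\<Sum>i\<in>I. - Z i \<omega>) > 2 * real r * \<delta>}"
    by (intro measure_Un_le) auto
  finally show ?thesis
    using prob_sum_gt_le[OF fin indep int sq mean var V \<delta>, of r]
      prob_sum_gt_le[OF fin neg, of V \<delta> r] int sq mean var V \<delta>
    by simp
qed

text \<open>The events that exactly one of the variables with index in \<open>J\<close> is large while the sum
  of all the others stays near \<open>c\<close> are disjoint, and each forces the full sum away from \<open>c\<close>.\<close>

lemma (in prob_space) sum_prob_large_le_aux:
  fixes Z :: "'i \<Rightarrow> 'a \<Rightarrow> real" and c \<epsilon> :: real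
  assumes fin: "finite I" and indep: "indep_vars (\<lambda>_. borel) Z I"
    and p: "prob {\<omega> \<in> space M. \<bar>(\<Sum>i\<in>I. Z i \<omega>) - c\<bar> > \<epsilon>} \<le> 1 / 16"
    and small: "\<And>i. i \<in> I \<Longrightarrow> prob {\<omega> \<in> space M. \<bar>Z i \<omega>\<bar> > \<epsilon>} \<le> 1 / 8"
    and J: "J \<subseteq> I" and half: "(\<Sum>i\<in>J. prob {\<omega> \<in> space M. \<bar>Z i \<omega>\<bar> > 3 * \<epsilon>}) \<le> 1 / 2"
  shows "(\<Sum>i\<in>J. prob {\<omega> \<in> space M. \<bar>Z i \<omega>\<bar> > 3 * \<epsilon>})
    \<le> 4 * prob {\<omega> \<in> space M. \<bar>(\<Sum>i\<in>I. Z i \<omega>) - c\<bar> > \<epsilon>}"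
proof -
  have mZ[measurable]: "Z i \<in> borel_measurable M" if "i \<in> I" for i
    using indep that by (auto simp: indep_vars_def)
  have finJ: "finite J" using J fin by (rule finite_subset)
  have mJ[measurable]: "Z i \<in> borel_measurable M" if "i \<in> J" for i
    using J that by auto
  define A where "A = (\<lambda>i. {\<omega> \<in> space M. \<bar>Z i \<omega>\<bar> > 3 * \<epsilon>})"
  define Q where "Q = (\<lambda>i \<omega>. (\<forall>j\<in>J - {i}. \<bar>Z j \<omega>\<bar> \<le> 3 * \<epsilon>) \<and> \<bar>(\<Sum>j\<in>I - {i}. Z j \<omega>) - c\<bar> \<le> 2 * \<epsilon>)"
  define B where "B = (\<lambda>i. {\<omega> \<in> space M. \<bar>Z i \<omega>\<bar> > 3 * \<epsilon> \<and> Q i \<omega>})"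
  have A_meas: "A i \<in> events" if "i \<in> I" for i
    using that unfolding A_def by measurable
  have Q_meas: "{\<omega> \<in> space M. Q i \<omega>} \<in> events" for i
    unfolding Q_def by measurable (use finJ fin J in auto)
  have B_meas: "B i \<in> events" if "i \<in> I" for i
  proof -
    have "B i = A i \<inter> {\<omega> \<in> space M. Q i \<omega>}" by (auto simp: A_def B_def)
    then show ?thesis using A_meas[OF that] Q_meas by simp
  qed
  let ?S = "{\<omega> \<in> space M. \<bar>(\<Sum>i\<in>I. Z i \<omega>) - c\<bar> > \<epsilon>}"
  have S_meas: "?S \<in> events" by measurable
  have split_sum: "(\<Sum>j\<in>I. Z j \<omega>) = Z i \<omega> + (\<Sum>j\<in>I - {i}. Z j \<omega>)" if "i \<in> I" for i \<omega>
    using fin that by (rule sum.remove)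
  have B_prob: "prob (B i) = prob (A i) * prob {\<omega> \<in> space M. Q i \<omega>}" if i: "i \<in> J" for i
  proof -
    have iI: "i \<in> I" using i J by auto
    \<comment> \<open>\<open>Q i\<close> involves only coordinates other than \<open>i\<close>. As a
      0-1 valued function of the restricted tuple it becomes a random variable independent of
      \<open>Z i\<close>.\<close>
    define g where "g = (\<lambda>f :: 'i \<Rightarrow> real. if (\<forall>j\<in>J - {i}. \<bar>f j\<bar> \<le> 3 * \<epsilon>) \<and> \<bar>(\<Sum>j\<in>I - {i}. f j) - c\<bar> \<le> 2 * \<epsilon> then 1 else 0 :: real)"
    have gm: "g \<in> borel_measurable (PiM (I - {i}) (\<lambda>_. borel))"
    proof -
      have [measurable]: "(\<lambda>f. f j) \<in> borel_measurable (PiM (I - {i}) (\<lambda>_. borel :: real measure))" if "j \<in> I - {i}" for j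
        using that by measurable
      have [measurable]: "(\<lambda>f. f j) \<in> borel_measurable (PiM (I - {i}) (\<lambda>_. borel :: real measure))" if "j \<in> J - {i}" for j
        using that J by (auto intro!: measurable_component_singleton)
      have [measurable]: "(\<lambda>f. \<Sum>j\<in>I - {i}. f j) \<in> borel_measurable (PiM (I - {i}) (\<lambda>_. borel :: real measure))"
        by (intro borel_measurable_sum) auto
      have [measurable]: "Measurable.pred (PiM (I - {i}) (\<lambda>_. borel)) (\<lambda>f. \<forall>j\<in>J - {i}. \<bar>f j\<bar> \<le> 3 * \<epsilon>)"
        using finJ by (intro pred_intros_finite) auto
      show ?thesis unfolding g_def by measurable
    qed
    have "indep_var borel ((\<lambda>f. f i) \<circ> (\<lambda>\<omega>. restrict (\<lambda>j. Z j \<omega>) {i}))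
        borel (g \<circ> (\<lambda>\<omega>. restrict (\<lambda>j. Z j \<omega>) (I - {i})))"
      using iI fin gm by (intro indep_var_compose[OF indep_var_restrict[OF indep]]) auto
    also have "(\<lambda>f. f i) \<circ> (\<lambda>\<omega>. restrict (\<lambda>j. Z j \<omega>) {i}) = Z i" by auto
    also have "g \<circ> (\<lambda>\<omega>. restrict (\<lambda>j. Z j \<omega>) (I - {i})) = (\<lambda>\<omega>. if Q i \<omega> then 1 else 0 :: real)"
    proof
      fix \<omega>
      have "(\<Sum>j\<in>I - {i}. (\<lambda>j\<in>I - {i}. Z j \<omega>) j) = (\<Sum>j\<in>I - {i}. Z j \<omega>)"
        by (intro sum.cong) auto
      moreover have "(\<forall>j\<in>J - {i}. \<bar>(\<lambda>j\<in>I - {i}. Z j \<omega>) j\<bar> \<le> 3 * \<epsilon>) \<longleftrightarrow> (\<forall>j\<in>J - {i}. \<bar>Z j \<omega>\<bar> \<le> 3 * \<epsilon>)"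
        using J by auto
      ultimately show "(g \<circ> (\<lambda>\<omega>. restrict (\<lambda>j. Z j \<omega>) (I - {i}))) \<omega> = (if Q i \<omega> then 1 else 0)"
        unfolding g_def Q_def comp_def by (simp only:)
    qed
    finally have "indep_var borel (Z i) borel (\<lambda>\<omega>. if Q i \<omega> then 1 else 0 :: real)" .
    from indep_varD[OF this, of "{z. \<bar>z\<bar> > 3 * \<epsilon>}" "{1}"]
    have "prob ((\<lambda>x. (Z i x, if Q i x then 1 else 0 :: real)) -` ({z. \<bar>z\<bar> > 3 * \<epsilon>} \<times> {1}) \<inter> space M)
        = prob (Z i -` {z. \<bar>z\<bar> > 3 * \<epsilon>} \<inter> space M) * prob ((\<lambda>\<omega>. if Q i \<omega> then 1 else 0 :: real) -` {1} \<inter> space M)"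
      by simp
    moreover have "(\<lambda>x. (Z i x, if Q i x then 1 else 0 :: real)) -` ({z. \<bar>z\<bar> > 3 * \<epsilon>} \<times> {1}) \<inter> space M = B i"
      "Z i -` {z. \<bar>z\<bar> > 3 * \<epsilon>} \<inter> space M = A i" "(\<lambda>\<omega>. if Q i \<omega> then 1 else 0 :: real) -` {1} \<inter> space M = {\<omega> \<in> space M. Q i \<omega>}"
      by (auto simp: A_def B_def split: if_splits)
    ultimately show ?thesis by simp
  qed
  \<comment> \<open>If \<open>Q i\<close> fails, then a variable in \<open>J\<close> exceeds
    \<open>3 * \<epsilon>\<close>, or the full sum deviates, or \<open>Z i\<close> exceeds
    \<epsilon>. Together this has probability at most 1/2 + 1/16 + 1/8 = 11/16.\<close>
  have Q_prob: "prob {\<omega> \<in> space M. Q i \<omega>} \<ge> 1 / 4" if i: "i \<in> J" for i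
  proof -
    have iI: "i \<in> I" using i J by auto
    have "space M - {\<omega> \<in> space M. Q i \<omega>} \<subseteq> (\<Union>j\<in>J. A j) \<union> (?S \<union> {\<omega> \<in> space M. \<bar>Z i \<omega>\<bar> > \<epsilon>})"
    proof
      fix \<omega> assume \<omega>: "\<omega> \<in> space M - {\<omega> \<in> space M. Q i \<omega>}"
      show "\<omega> \<in> (\<Union>j\<in>J. A j) \<union> (?S \<union> {\<omega> \<in> space M. \<bar>Z i \<omega>\<bar> > \<epsilon>})"
      proof (cases "\<exists>j\<in>J. \<bar>Z j \<omega>\<bar> > 3 * \<epsilon>")
        case False
        then have "\<bar>(\<Sum>j\<in>I - {i}. Z j \<omega>) - c\<bar> > 2 * \<epsilon>"
          using \<omega> by (auto simp: Q_def not_le)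
        then have "\<bar>(\<Sum>i\<in>I. Z i \<omega>) - c\<bar> > \<epsilon> \<or> \<bar>Z i \<omega>\<bar> > \<epsilon>"
          unfolding split_sum[OF iI] by linarith
        then show ?thesis using \<omega> by auto
      qed (use \<omega> in \<open>auto simp: A_def\<close>)
    qed
    then have "prob (space M - {\<omega> \<in> space M. Q i \<omega>}) \<le> prob ((\<Union>j\<in>J. A j) \<union> (?S \<union> {\<omega> \<in> space M. \<bar>Z i \<omega>\<bar> > \<epsilon>}))"
      using finJ A_meas J iI by (intro finite_measure_mono sets.Un sets.finite_UN) auto
    also have "\<dots> \<le> prob (\<Union>j\<in>J. A j) + prob (?S \<union> {\<omega> \<in> space M. \<bar>Z i \<omega>\<bar> > \<epsilon>})"
      using finJ A_meas J iI by (intro measure_Un_le sets.Un sets.finite_UN) auto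
    also have "prob (?S \<union> {\<omega> \<in> space M. \<bar>Z i \<omega>\<bar> > \<epsilon>}) \<le> prob ?S + prob {\<omega> \<in> space M. \<bar>Z i \<omega>\<bar> > \<epsilon>}"
      using iI by (intro measure_Un_le) auto
    also have "prob (\<Union>j\<in>J. A j) \<le> (\<Sum>j\<in>J. prob (A j))"
      using finJ A_meas J by (intro finite_measure_subadditive_finite) auto
    finally have "prob (space M - {\<omega> \<in> space M. Q i \<omega>}) \<le> 1 / 2 + (1 / 16 + 1 / 8)"
      using half p small[OF iI] unfolding A_def by linarith
    then show ?thesis using prob_compl[OF Q_meas, of i] by linarith
  qed
  have "disjoint_family_on B J"
    unfolding disjoint_family_on_def
  proof (intro ballI impI equals0I)
    fix i j \<omega> assume ij: "i \<in> J" "j \<in> J" "i \<noteq> j" and "\<omega> \<in> B i \<inter> B j"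
    then have "\<bar>Z j \<omega>\<bar> > 3 * \<epsilon>" "Q i \<omega>" by (auto simp: B_def)
    then show False using ij by (force simp: Q_def)
  qed
  then have "prob (\<Union>i\<in>J. B i) = (\<Sum>i\<in>J. prob (B i))"
    using finJ B_meas J by (intro finite_measure_finite_Union) auto
  \<comment> \<open>A jump above \<open>3 * \<epsilon>\<close> against a deviation of at most
    \<open>2 * \<epsilon>\<close> of the rest leaves more than \<epsilon>.\<close>
  moreover have "(\<Union>i\<in>J. B i) \<subseteq> ?S"
  proof
    fix \<omega> assume "\<omega> \<in> (\<Union>i\<in>J. B i)"
    then obtain i where i: "i \<in> J" "\<omega> \<in> B i" by auto
    then have "i \<in> I" "\<omega> \<in> space M" "\<bar>Z i \<omega>\<bar> > 3 * \<epsilon>" "\<bar>(\<Sum>j\<in>I - {i}. Z j \<omega>) - c\<bar> \<le> 2 * \<epsilon>"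
      using J by (auto simp: B_def Q_def)
    then show "\<omega> \<in> ?S"
      using split_sum[of i \<omega>] by simp
  qed
  ultimately have "(\<Sum>i\<in>J. prob (B i)) \<le> prob ?S"
    using S_meas finite_measure_mono by metis
  moreover have "(\<Sum>i\<in>J. prob (A i) * (1 / 4)) \<le> (\<Sum>i\<in>J. prob (B i))"
    using Q_prob by (intro sum_mono) (simp add: B_prob mult_left_mono del: times_divide_eq_right)
  ultimately show ?thesis
    unfolding A_def by (simp flip: sum_divide_distrib)
qed

text \<open>The assumed bound 1/2 is removed by adding indices one at a time. If the inequality
  holds for \<open>J\<close>, its left side is at most 4/16; a new index adds at most 1/8, so the
  larger sum is still below 1/2 and the inequality extends to it.\<close>

lemma (in prob_space) sum_prob_large_le:
  fixes Z :: "'i \<Rightarrow> 'a \<Rightarrow> real" and c \<epsilon> :: real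
  assumes fin: "finite I" and indep: "indep_vars (\<lambda>_. borel) Z I" and "\<epsilon> > 0"
    and p: "prob {\<omega> \<in> space M. \<bar>(\<Sum>i\<in>I. Z i \<omega>) - c\<bar> > \<epsilon>} \<le> 1 / 16"
    and small: "\<And>i. i \<in> I \<Longrightarrow> prob {\<omega> \<in> space M. \<bar>Z i \<omega>\<bar> > \<epsilon>} \<le> 1 / 8"
  shows "(\<Sum>i\<in>I. prob {\<omega> \<in> space M. \<bar>Z i \<omega>\<bar> > 3 * \<epsilon>})
    \<le> 4 * prob {\<omega> \<in> space M. \<bar>(\<Sum>i\<in>I. Z i \<omega>) - c\<bar> > \<epsilon>}" (is "sum ?a I \<le> 4 * ?p")
proof -
  have "sum ?a J \<le> 4 * ?p" if "finite J" "J \<subseteq> I" for J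
    using that
  proof (induction J rule: finite_induct)
    case (insert j J)
    have [measurable]: "Z j \<in> borel_measurable M"
      using indep insert.prems by (auto simp: indep_vars_def)
    have "?a j \<le> prob {\<omega> \<in> space M. \<bar>Z j \<omega>\<bar> > \<epsilon>}"
      using \<open>\<epsilon> > 0\<close> by (intro finite_measure_mono) auto
    also have "\<dots> \<le> 1 / 8" using small insert.prems by auto
    finally have "sum ?a (insert j J) \<le> 1 / 8 + 4 * ?p"
      using insert by simp
    then have "sum ?a (insert j J) \<le> 1 / 2" using p by linarith
    then show ?case
      by (intro sum_prob_large_le_aux fin indep p small insert.prems)
  qed simp
  then show ?thesis using fin by simp
qed

section \<open>Growth functions and power sums\<close>

lemma log_plus_ge_1: "1 \<le> log_plus x"
  by (simp add: log_plus_def)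

lemma log_plus_mono: "0 < x \<Longrightarrow> x \<le> y \<Longrightarrow> log_plus x \<le> log_plus y"
  unfolding log_plus_def by (intro max.mono) auto

lemma log_plus_scale:
  assumes "0 < x" "0 < b"
  shows "log_plus (b * x) \<le> (1 + \<bar>ln b\<bar>) * log_plus x"
proof -
  have "\<bar>ln b\<bar> * 1 \<le> \<bar>ln b\<bar> * log_plus x"
    by (intro mult_left_mono log_plus_ge_1) auto
  then have "\<bar>ln b\<bar> + log_plus x \<le> (1 + \<bar>ln b\<bar>) * log_plus x"
    by (simp add: algebra_simps)
  moreover have "log_plus (b * x) \<le> \<bar>ln b\<bar> + log_plus x"
    using assms by (auto simp: log_plus_def ln_mult)
  ultimately show ?thesis by linarith
qed

text \<open>The moment functions of all five cases have this shape. It vanishes at 0, and the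
  cut-off of \<open>log_plus\<close> at 1 makes a rescaled argument cost only a constant factor, so
  constants in the bounds for the weights do not matter.\<close>

definition growth :: "real \<Rightarrow> nat \<Rightarrow> real \<Rightarrow> real" where
  "growth p e x = x powr p * log_plus x ^ e"

lemma growth_nonneg: "0 \<le> growth p e x"
  unfolding growth_def using log_plus_ge_1[of x] by (intro mult_nonneg_nonneg) auto

lemma growth_mono:
  assumes "0 \<le> x" "x \<le> y" "0 < p"
  shows "growth p e x \<le> growth p e y"
proof (cases "x = 0")
  case True
  then show ?thesis using assms growth_nonneg[of p e y] by (simp add: growth_def)
next
  case False
  have "0 \<le> log_plus x" using log_plus_ge_1[of x] by linarith
  then show ?thesis
    unfolding growth_def using assms False
    by (intro mult_mono power_mono powr_mono2 log_plus_mono) auto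
qed

lemma growth_scale:
  assumes "0 < b" "0 < p"
  obtains C where "C > 0" "\<And>x. 0 \<le> x \<Longrightarrow> growth p e (b * x) \<le> C * growth p e x"
proof
  show "b powr p * (1 + \<bar>ln b\<bar>) ^ e > 0"
    using assms by (intro mult_pos_pos zero_less_power) auto
  fix x :: real assume x: "0 \<le> x"
  show "growth p e (b * x) \<le> b powr p * (1 + \<bar>ln b\<bar>) ^ e * growth p e x"
  proof (cases "x = 0")
    case False
    have "0 \<le> log_plus (b * x)" using log_plus_ge_1[of "b * x"] by linarith
    then have "log_plus (b * x) ^ e \<le> ((1 + \<bar>ln b\<bar>) * log_plus x) ^ e"
      using assms x False by (intro power_mono log_plus_scale) auto
    then have "(b * x) powr p * log_plus (b * x) ^ e \<le> (b powr p * x powr p) * ((1 + \<bar>ln b\<bar>) * log_plus x) ^ e"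
      using assms x \<open>0 \<le> log_plus (b * x)\<close> by (intro mult_mono) (auto simp: powr_mult)
    then show ?thesis by (simp add: growth_def power_mult_distrib mult_ac)
  qed (simp add: growth_def)
qed

lemma measurable_log_plus [measurable]: "log_plus \<in> borel_measurable borel"
  unfolding log_plus_def by measurable

lemma measurable_growth [measurable]: "growth p e \<in> borel_measurable borel"
  unfolding growth_def by measurable

section \<open>Sums of powers\<close>

definition power_sum :: "real \<Rightarrow> nat \<Rightarrow> real" where
  "power_sum s K = (\<Sum>k=1..K. real k powr s)"

lemma power_sum_mono: "K \<le> L \<Longrightarrow> power_sum s K \<le> power_sum s L"
  unfolding power_sum_def by (intro sum_mono2) auto

lemma power_sum_nonneg: "0 \<le> power_sum s K"
  unfolding power_sum_def by (intro sum_nonneg) auto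

lemma power_sum_ge_1: "K \<ge> 1 \<Longrightarrow> 1 \<le> power_sum s K"
  using power_sum_mono[of 1 K s] by (simp add: power_sum_def)

lemma power_sum_bounded:
  assumes "s < -1"
  obtains C where "C > 0" "\<And>K. power_sum s K \<le> C"
proof
  have sm: "summable (\<lambda>k. real k powr s)"
    using assms by (simp add: summable_real_powr_iff)
  show "(\<Sum>k. real k powr s) + 1 > 0"
    using suminf_nonneg[OF sm] by simp
  show "power_sum s K \<le> (\<Sum>k. real k powr s) + 1" for K
    unfolding power_sum_def using sum_le_suminf[OF sm, of "{1..K}"] by simp
qed

lemma power_sum_minus_1: "power_sum (-1) K = harm K"
  unfolding power_sum_def harm_def by (intro sum.cong) (auto simp: powr_minus)

lemma power_sum_minus_1_le:
  assumes "K \<ge> 1" shows "power_sum (-1) K \<le> 1 + ln K"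
  using decseqD[OF decseq_harm_diff_ln, of 0 "K - 1"] assms
  by (simp add: power_sum_minus_1 harm_def)

lemma power_sum_minus_1_ge: "ln (real K + 1) \<le> power_sum (-1) K"
  using ln_le_harm[of K] by (simp add: power_sum_minus_1)

text \<open>Integral comparison in discrete form. With \<open>t = s + 1\<close>, the induction step
  is Bernoulli's inequality \<open>(K / (K + 1)) powr t \<le> 1 - t / (K + 1)\<close>, taken here
  from Young's inequality.\<close>

lemma power_sum_le:
  assumes "-1 < s" "s \<le> 0"
  shows "power_sum s K \<le> real K powr (s + 1) / (s + 1)"
proof (induction K)
  case 0
  then show ?case by (simp add: power_sum_def)
next
  case (Suc K)
  define t where "t = s + 1"
  have t: "0 < t" "t \<le> 1" using assms by (auto simp: t_def)
  have "real K powr t \<le> real (Suc K) powr t * (1 - t / real (Suc K))"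
  proof (cases "K = 0")
    case False
    have "(real K / real (Suc K)) powr t * 1 powr (1 - t) \<le> t * (real K / real (Suc K)) + (1 - t) * 1"
      using t False by (intro Youngs_inequality_0) auto
    also have "\<dots> = 1 - t / real (Suc K)" by (simp add: field_simps)
    finally show ?thesis using False by (simp add: powr_divide field_simps)
  qed (use t in auto)
  moreover have "real (Suc K) powr t / real (Suc K) = real (Suc K) powr s"
    by (simp add: t_def powr_add)
  moreover have "real (Suc K) powr t * (1 - t / real (Suc K))
      = real (Suc K) powr t - t * (real (Suc K) powr t / real (Suc K))"
    by (simp add: field_simps)
  ultimately have "real K powr t \<le> real (Suc K) powr t - t * real (Suc K) powr s"
    by metis
  then have "(real K powr t + t * real (Suc K) powr s) / t \<le> real (Suc K) powr t / t"
    using t by (intro divide_right_mono) auto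
  then have "real K powr t / t + real (Suc K) powr s \<le> real (Suc K) powr t / t"
    using t by (simp add: add_divide_distrib)
  moreover have "power_sum s (Suc K) = power_sum s K + real (Suc K) powr s"
    by (simp add: power_sum_def)
  ultimately show ?case using Suc by (simp add: t_def)
qed

lemma power_sum_ge:
  assumes "s \<le> 0"
  shows "real K powr (s + 1) \<le> power_sum s K"
proof (cases "K = 0")
  case False
  have "real K powr (s + 1) = (\<Sum>k=1..K. real K powr s)"
    using False by (simp add: powr_add)
  also have "\<dots> \<le> power_sum s K"
    unfolding power_sum_def using assms by (intro sum_mono powr_mono2') auto
  finally show ?thesis .
qed (simp add: power_sum_def)

text \<open>The discrete counterpart of integrating \<open>ln x / x\<close>: passing from
  \<open>h\<close> to \<open>h + d\<close> raises \<open>h^2 / 2\<close> by at most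
  \<open>(h + d) * d\<close>. It yields the squared logarithm at
  \<open>\<beta> = 1/2\<close>.\<close>

lemma sum_harm_div_ge: "harm R ^ 2 / 2 \<le> (\<Sum>n=1..R. harm n / (real n :: real))"
proof (induction R)
  case (Suc R)
  have "(h + d)\<^sup>2 / 2 \<le> h\<^sup>2 / 2 + (h + d) * d" for h d :: real
    by (simp add: power2_eq_square algebra_simps)
  from this[of "harm R" "inverse (real (Suc R))"]
  have "harm (Suc R) ^ 2 / 2 \<le> harm R ^ 2 / 2 + harm (Suc R) / (real (Suc R) :: real)"
    by (simp only: harm_Suc divide_inverse)
  then show ?case using Suc by simp
qed (simp add: harm_def)

section \<open>Counting lattice points\<close>

definition pairs :: "(nat \<times> nat) set" where
  "pairs = {(m, k). 1 \<le> k \<and> k \<le> m}"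

text \<open>Up to constant factors, \<open>pair_weight \<alpha> (m, k)\<close> is the ratio of \<open>A\<^sub>m\<^sup>\<alpha>\<close> to the number
  of index \<open>k - 1\<close> and order \<open>\<alpha> - 1\<close>, that is, the reciprocal of a normalised weight.\<close>

definition pair_weight :: "real \<Rightarrow> nat \<times> nat \<Rightarrow> real" where
  "pair_weight \<alpha> = (\<lambda>(m, k). real m powr \<alpha> * real k powr (1 - \<alpha>))"

context
  fixes \<alpha> :: real
  assumes \<alpha>: "0 < \<alpha>" "\<alpha> \<le> 1"
begin

lemma fst_le_pair_weight: "(m, k) \<in> pairs \<Longrightarrow> real m powr \<alpha> \<le> pair_weight \<alpha> (m, k)"
  using \<alpha> mult_left_mono[of 1 "real k powr (1 - \<alpha>)" "real m powr \<alpha>"]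
  by (auto simp: pairs_def pair_weight_def ge_one_powr_ge_zero)

lemma pair_weight_ge_1:
  assumes "q \<in> pairs" shows "1 \<le> pair_weight \<alpha> q"
proof -
  obtain m k where q: "q = (m, k)" by (cases q)
  then have "1 \<le> real m powr \<alpha>"
    using assms \<alpha> by (auto simp: pairs_def intro!: ge_one_powr_ge_zero)
  then show ?thesis using fst_le_pair_weight assms q by fastforce
qed

lemma snd_le_pair_weight:
  assumes "(m, k) \<in> pairs" shows "real k \<le> pair_weight \<alpha> (m, k)"
proof -
  have "real k powr \<alpha> * real k powr (1 - \<alpha>) \<le> pair_weight \<alpha> (m, k)"
    using assms \<alpha> by (auto simp: pair_weight_def pairs_def intro!: mult_right_mono powr_mono2)
  then show ?thesis using assms by (simp add: pairs_def flip: powr_add)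
qed

lemma less_powr_if_powr_less:
  assumes "0 \<le> y" "y powr \<alpha> < x" shows "y < x powr (1 / \<alpha>)"
proof -
  have "(y powr \<alpha>) powr (1 / \<alpha>) < x powr (1 / \<alpha>)"
    using assms \<alpha> by (intro powr_less_mono2) auto
  then show ?thesis using assms \<alpha> by (simp add: powr_powr)
qed

text \<open>For fixed \<open>k\<close> the condition is solved for \<open>m\<close>; summing the
  resulting bounds over \<open>k\<close> produces the power sums of exponent
  \<open>1 - 1 / \<alpha>\<close>.\<close>

lemma pair_weight_less_iff:
  assumes "(m, k) \<in> pairs" "0 < x"
  shows "pair_weight \<alpha> (m, k) < x \<longleftrightarrow> real m < x powr (1 / \<alpha>) * real k powr (1 - 1 / \<alpha>)"
proof -
  have k: "real k > 0" "real m > 0" using assms by (auto simp: pairs_def)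
  have "pair_weight \<alpha> (m, k) < x \<longleftrightarrow> real m powr \<alpha> < x * real k powr (\<alpha> - 1)"
    using k by (simp add: pair_weight_def powr_diff field_simps)
  also have "\<dots> \<longleftrightarrow> (real m powr \<alpha>) powr (1 / \<alpha>) < (x * real k powr (\<alpha> - 1)) powr (1 / \<alpha>)"
    using \<alpha> assms k by (intro iffI powr_less_mono2) (auto dest: powr_less_cancel2[rotated -1])
  also have "(real m powr \<alpha>) powr (1 / \<alpha>) = real m" using \<alpha> k by (simp add: powr_powr)
  also have "(x * real k powr (\<alpha> - 1)) powr (1 / \<alpha>) = x powr (1 / \<alpha>) * real k powr (1 - 1 / \<alpha>)"
    using \<alpha> assms k by (simp add: powr_mult powr_powr diff_divide_distrib)
  finally show ?thesis .
qed

lemma pair_weight_less_subset: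
  "{q \<in> pairs. pair_weight \<alpha> q < x} \<subseteq> {1..nat \<lfloor>x powr (1 / \<alpha>)\<rfloor>} \<times> {1..nat \<lfloor>x powr (1 / \<alpha>)\<rfloor>}"
proof
  fix q assume q: "q \<in> {q \<in> pairs. pair_weight \<alpha> q < x}"
  obtain m k where qq: "q = (m, k)" by (cases q)
  have "real m powr \<alpha> < x" using q fst_le_pair_weight[of m k] by (auto simp: qq)
  then have "real m < x powr (1 / \<alpha>)" by (intro less_powr_if_powr_less) auto
  then have "m \<le> nat \<lfloor>x powr (1 / \<alpha>)\<rfloor>" by (simp add: le_nat_floor)
  then show "q \<in> {1..nat \<lfloor>x powr (1 / \<alpha>)\<rfloor>} \<times> {1..nat \<lfloor>x powr (1 / \<alpha>)\<rfloor>}"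
    using q by (auto simp: qq pairs_def)
qed

lemma finite_pair_weight_less: "finite {q \<in> pairs. pair_weight \<alpha> q < x}"
  by (rule finite_subset[OF pair_weight_less_subset]) auto

lemma pair_weight_less_empty: "x \<le> 1 \<Longrightarrow> {q \<in> pairs. pair_weight \<alpha> q < x} = {}"
  using pair_weight_ge_1 by fastforce

text \<open>A pair of weight below \<open>x\<close> has \<open>k \<le> x\<close>, so the sum over
  \<open>k\<close> may stop there; dropping \<open>k \<le> m\<close> only enlarges the
  count.\<close>

lemma card_pair_weight_less_le:
  assumes "1 \<le> x"
  shows "real (card {q \<in> pairs. pair_weight \<alpha> q < x}) \<le> x powr (1 / \<alpha>) * power_sum (1 - 1 / \<alpha>) (nat \<lfloor>x\<rfloor>)"
proof -
  define y where "y = (\<lambda>k. x powr (1 / \<alpha>) * real k powr (1 - 1 / \<alpha>))"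
  have y0: "y k \<ge> 0" for k by (simp add: y_def)
  have "{q \<in> pairs. pair_weight \<alpha> q < x} \<subseteq> (\<lambda>(k, m). (m, k)) ` Sigma {1..nat \<lfloor>x\<rfloor>} (\<lambda>k. {1..nat \<lfloor>y k\<rfloor>})"
  proof
    fix q assume q: "q \<in> {q \<in> pairs. pair_weight \<alpha> q < x}"
    obtain m k where qq: "q = (m, k)" by (cases q)
    have p: "(m, k) \<in> pairs" "pair_weight \<alpha> (m, k) < x" using q qq by auto
    have "k \<le> nat \<lfloor>x\<rfloor>" using p snd_le_pair_weight[of m k] by (simp add: le_nat_floor)
    moreover have "m \<le> nat \<lfloor>y k\<rfloor>"
      using p pair_weight_less_iff[OF p(1), of x] assms by (auto simp: y_def intro!: le_nat_floor)
    ultimately show "q \<in> (\<lambda>(k, m). (m, k)) ` Sigma {1..nat \<lfloor>x\<rfloor>} (\<lambda>k. {1..nat \<lfloor>y k\<rfloor>})"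
      using p by (auto simp: qq pairs_def image_iff)
  qed
  then have "card {q \<in> pairs. pair_weight \<alpha> q < x} \<le> card (Sigma {1..nat \<lfloor>x\<rfloor>} (\<lambda>k. {1..nat \<lfloor>y k\<rfloor>}))"
    by (intro surj_card_le) auto
  also have "\<dots> = (\<Sum>k=1..nat \<lfloor>x\<rfloor>. nat \<lfloor>y k\<rfloor>)"
    by (subst card_SigmaI) auto
  finally have "real (card {q \<in> pairs. pair_weight \<alpha> q < x}) \<le> (\<Sum>k=1..nat \<lfloor>x\<rfloor>. real (nat \<lfloor>y k\<rfloor>))"
    by (metis of_nat_le_iff of_nat_sum)
  also have "\<dots> \<le> (\<Sum>k=1..nat \<lfloor>x\<rfloor>. y k)"
    using y0 by (intro sum_mono) simp
  also have "\<dots> = x powr (1 / \<alpha>) * power_sum (1 - 1 / \<alpha>) (nat \<lfloor>x\<rfloor>)"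
    by (simp add: y_def power_sum_def sum_distrib_left)
  finally show ?thesis .
qed

text \<open>Here \<open>k \<le> m\<close> cannot be dropped. For \<open>k \<le> x / 2\<close> it
  removes at most half of the range of \<open>m\<close>, because
  \<open>(x / 2) powr (1 / \<alpha>)\<close> is at most half of
  \<open>x powr (1 / \<alpha>)\<close>; both halves in the bound come from this.\<close>

lemma card_pair_weight_less_ge:
  assumes "1 \<le> x"
  shows "x powr (1 / \<alpha>) * power_sum (1 - 1 / \<alpha>) (nat \<lfloor>x / 2\<rfloor>) / 2 \<le> real (card {q \<in> pairs. pair_weight \<alpha> q < x})"
proof -
  define y where "y = (\<lambda>k. x powr (1 / \<alpha>) * real k powr (1 - 1 / \<alpha>))"
  let ?S = "Sigma {1..nat \<lfloor>x / 2\<rfloor>} (\<lambda>k. {k..<nat \<lceil>y k\<rceil>})"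
  have sub: "(\<lambda>(k, m). (m, k)) ` ?S \<subseteq> {q \<in> pairs. pair_weight \<alpha> q < x}"
  proof
    fix q assume "q \<in> (\<lambda>(k, m). (m, k)) ` ?S"
    then obtain m k where q: "q = (m, k)" "1 \<le> k" "k \<le> m" "m < nat \<lceil>y k\<rceil>" by auto
    then have "real m < y k" by linarith
    then show "q \<in> {q \<in> pairs. pair_weight \<alpha> q < x}"
      using q assms pair_weight_less_iff[of m k x] by (auto simp: pairs_def y_def)
  qed
  have inj: "inj_on (\<lambda>(k, m). (m, k)) ?S" by (auto simp: inj_on_def)
  have k_le: "real k \<le> y k / 2" if k: "k \<in> {1..nat \<lfloor>x / 2\<rfloor>}" for k
  proof -
    have k2: "real k \<le> x / 2" "real k > 0" using k assms by (auto simp: le_nat_floor) linarith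
    have "real k = real k powr (1 / \<alpha>) * real k powr (1 - 1 / \<alpha>)"
      using k2 by (simp flip: powr_add)
    also have "\<dots> \<le> (x / 2) powr (1 / \<alpha>) * real k powr (1 - 1 / \<alpha>)"
      using k2 \<alpha> by (intro mult_right_mono powr_mono2) auto
    also have "(x / 2) powr (1 / \<alpha>) = x powr (1 / \<alpha>) / 2 powr (1 / \<alpha>)"
      using assms by (simp add: powr_divide)
    also have "\<dots> \<le> x powr (1 / \<alpha>) / 2 powr 1"
      using \<alpha> by (intro divide_left_mono powr_mono) auto
    finally show ?thesis by (simp add: y_def mult_right_mono)
  qed
  have "x powr (1 / \<alpha>) * power_sum (1 - 1 / \<alpha>) (nat \<lfloor>x / 2\<rfloor>) / 2 = (\<Sum>k=1..nat \<lfloor>x / 2\<rfloor>. y k / 2)"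
    by (simp add: y_def power_sum_def sum_distrib_left sum_divide_distrib)
  also have "\<dots> \<le> (\<Sum>k=1..nat \<lfloor>x / 2\<rfloor>. real (nat \<lceil>y k\<rceil> - k))"
  proof (intro sum_mono)
    fix k assume "k \<in> {1..nat \<lfloor>x / 2\<rfloor>}"
    from k_le[OF this] show "y k / 2 \<le> real (nat \<lceil>y k\<rceil> - k)" by linarith
  qed
  also have "\<dots> = real (card ?S)"
    by (subst card_SigmaI) auto
  also have "card ?S = card ((\<lambda>(k, m). (m, k)) ` ?S)"
    using inj by (simp add: card_image)
  also have "real \<dots> \<le> real (card {q \<in> pairs. pair_weight \<alpha> q < x})"
    using card_mono[OF finite_pair_weight_less sub] by simp
  finally show ?thesis .
qed

end

text \<open>The exponent of \<open>x\<close> in the number of pairs of weight below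
  \<open>x\<close>. The sum of \<open>k powr (1 - 1 / \<alpha>)\<close> up to \<open>x\<close> is
  bounded for \<open>\<alpha> < 1/2\<close>, which leaves \<open>x powr (1 / \<alpha>)\<close>. For
  \<open>\<alpha> > 1/2\<close> it has order \<open>x powr (2 - 1 / \<alpha>)\<close>, which gives
  \<open>x powr 2\<close>. At \<open>\<alpha> = 1/2\<close> it is logarithmic, as recorded by
  \<open>log_exp\<close>.\<close>

definition crit_exp :: "real \<Rightarrow> real" where
  "crit_exp \<alpha> = max (1 / \<alpha>) 2"

definition log_exp :: "real \<Rightarrow> nat" where
  "log_exp \<alpha> = (if \<alpha> = 1 / 2 then 1 else 0)"

lemma ln_le_log_plus: "ln x \<le> log_plus x"
  by (simp add: log_plus_def)

lemma card_pair_weight_less_upper: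
  assumes \<alpha>: "0 < \<alpha>" "\<alpha> \<le> 1"
  obtains C where "C > 0"
    "\<And>x. 0 < x \<Longrightarrow> real (card {q \<in> pairs. pair_weight \<alpha> q < x}) \<le> C * growth (crit_exp \<alpha>) (log_exp \<alpha>) x"
proof -
  note result = that
  \<comment> \<open>Below level 1 there are no pairs, so it is enough to estimate the power sum for
    \<open>1 \<le> x\<close>.\<close>
  have red: thesis if C: "C > 0" and
    le: "\<And>x. 1 \<le> x \<Longrightarrow> x powr (1 / \<alpha>) * power_sum (1 - 1 / \<alpha>) (nat \<lfloor>x\<rfloor>)
       \<le> C * growth (crit_exp \<alpha>) (log_exp \<alpha>) x" for C
  proof (rule result[OF C])
    fix x :: real assume "0 < x"
    show "real (card {q \<in> pairs. pair_weight \<alpha> q < x}) \<le> C * growth (crit_exp \<alpha>) (log_exp \<alpha>) x"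
    proof (cases "1 \<le> x")
      case True
      then show ?thesis using card_pair_weight_less_le[OF \<alpha> True] le[OF True] by linarith
    next
      case False
      then have e: "{q \<in> pairs. pair_weight \<alpha> q < x} = {}" by (intro pair_weight_less_empty[OF \<alpha>]) simp
      show ?thesis unfolding e using growth_nonneg C by simp
    qed
  qed
  consider "\<alpha> < 1 / 2" | "\<alpha> = 1 / 2" | "\<alpha> > 1 / 2" by linarith
  then show thesis
  proof cases
    case 1
    have s: "1 - 1 / \<alpha> < -1" using 1 \<alpha> by (simp add: field_simps)
    have p: "crit_exp \<alpha> = 1 / \<alpha>" using 1 \<alpha> by (simp add: crit_exp_def field_simps max_def)
    obtain C where C: "C > 0" "\<And>K. power_sum (1 - 1 / \<alpha>) K \<le> C"
      using power_sum_bounded[OF s] by blast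
    show thesis
    proof (rule red[OF C(1)])
      fix x :: real assume "1 \<le> x"
      have "x powr (1 / \<alpha>) * power_sum (1 - 1 / \<alpha>) (nat \<lfloor>x\<rfloor>) \<le> x powr (1 / \<alpha>) * C"
        by (intro mult_left_mono C) auto
      then show "x powr (1 / \<alpha>) * power_sum (1 - 1 / \<alpha>) (nat \<lfloor>x\<rfloor>) \<le> C * growth (crit_exp \<alpha>) (log_exp \<alpha>) x"
        using 1 by (simp add: growth_def p log_exp_def mult.commute)
    qed
  next
    case 2
    have s: "1 - 1 / \<alpha> = -1" unfolding 2 by simp
    have p: "crit_exp \<alpha> = 1 / \<alpha>" unfolding crit_exp_def 2 by simp
    have e: "log_exp \<alpha> = 1" unfolding log_exp_def 2 by simp
    show thesis
    proof (rule red[of 2])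
      fix x :: real assume x: "1 \<le> x"
      then have n: "nat \<lfloor>x\<rfloor> \<ge> 1" by (simp add: le_nat_floor)
      then have "power_sum (-1) (nat \<lfloor>x\<rfloor>) \<le> 1 + ln (real (nat \<lfloor>x\<rfloor>))"
        by (rule power_sum_minus_1_le)
      also have "ln (real (nat \<lfloor>x\<rfloor>)) \<le> ln x"
        using n x by (subst ln_le_cancel_iff) auto
      also have "1 + ln x \<le> 2 * log_plus x"
        using log_plus_ge_1[of x] ln_le_log_plus[of x] by linarith
      finally have "x powr (1 / \<alpha>) * power_sum (-1) (nat \<lfloor>x\<rfloor>) \<le> x powr (1 / \<alpha>) * (2 * log_plus x)"
        by (intro mult_left_mono) auto
      then show "x powr (1 / \<alpha>) * power_sum (1 - 1 / \<alpha>) (nat \<lfloor>x\<rfloor>) \<le> 2 * growth (crit_exp \<alpha>) (log_exp \<alpha>) x"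
        unfolding s p e by (simp add: growth_def mult_ac)
    qed simp
  next
    case 3
    define s where "s = 1 - 1 / \<alpha>"
    have s: "-1 < s" "s \<le> 0" using 3 \<alpha> by (auto simp: s_def field_simps)
    have p: "crit_exp \<alpha> = 2" using 3 \<alpha> by (simp add: crit_exp_def field_simps max_def)
    show thesis
    proof (rule red[of "1 / (s + 1)"])
      fix x :: real assume x: "1 \<le> x"
      have "power_sum s (nat \<lfloor>x\<rfloor>) \<le> real (nat \<lfloor>x\<rfloor>) powr (s + 1) / (s + 1)"
        by (rule power_sum_le[OF s])
      also have "\<dots> \<le> x powr (s + 1) / (s + 1)"
        using s x by (intro divide_right_mono powr_mono2) auto
      finally have "x powr (1 / \<alpha>) * power_sum s (nat \<lfloor>x\<rfloor>) \<le> x powr (1 / \<alpha>) * (x powr (s + 1) / (s + 1))"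
        by (intro mult_left_mono) auto
      also have "\<dots> = 1 / (s + 1) * x powr 2"
        by (simp add: s_def flip: powr_add)
      finally show "x powr (1 / \<alpha>) * power_sum (1 - 1 / \<alpha>) (nat \<lfloor>x\<rfloor>) \<le> 1 / (s + 1) * growth (crit_exp \<alpha>) (log_exp \<alpha>) x"
        using 3 unfolding p by (simp add: growth_def log_exp_def s_def)
    qed (use s in simp)
  qed
qed

lemma card_pair_weight_less_lower:
  assumes \<alpha>: "0 < \<alpha>" "\<alpha> \<le> 1"
  obtains c where "c > 0"
    "\<And>x. 4 \<le> x \<Longrightarrow> c * growth (crit_exp \<alpha>) (log_exp \<alpha>) x \<le> real (card {q \<in> pairs. pair_weight \<alpha> q < x})"
proof -
  note result = that
  \<comment> \<open>From 4 on, \<open>x / 2\<close> rounded down is at least \<open>x / 4\<close>,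
    and \<open>ln x\<close> is at least \<open>2 * ln 2\<close>; the halved argument then costs only
    constants.\<close>
  have red: thesis if c: "c > 0" and
    le: "\<And>x. 4 \<le> x \<Longrightarrow> c * growth (crit_exp \<alpha>) (log_exp \<alpha>) x
      \<le> x powr (1 / \<alpha>) * power_sum (1 - 1 / \<alpha>) (nat \<lfloor>x / 2\<rfloor>) / 2" for c
  proof (rule result[OF c])
    fix x :: real assume "4 \<le> x"
    then show "c * growth (crit_exp \<alpha>) (log_exp \<alpha>) x \<le> real (card {q \<in> pairs. pair_weight \<alpha> q < x})"
      using card_pair_weight_less_ge[OF \<alpha>, of x] le[of x] by linarith
  qed
  consider "\<alpha> < 1 / 2" | "\<alpha> = 1 / 2" | "\<alpha> > 1 / 2" by linarith
  then show thesis
  proof cases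
    case 1
    have p: "crit_exp \<alpha> = 1 / \<alpha>" using 1 \<alpha> by (simp add: crit_exp_def field_simps max_def)
    show thesis
    proof (rule red[of "1 / 2"])
      fix x :: real assume "4 \<le> x"
      then have "power_sum (1 - 1 / \<alpha>) (nat \<lfloor>x / 2\<rfloor>) \<ge> 1"
        by (intro power_sum_ge_1) (simp add: le_nat_floor)
      then have "x powr (1 / \<alpha>) * 1 \<le> x powr (1 / \<alpha>) * power_sum (1 - 1 / \<alpha>) (nat \<lfloor>x / 2\<rfloor>)"
        by (intro mult_left_mono) auto
      then show "1 / 2 * growth (crit_exp \<alpha>) (log_exp \<alpha>) x
          \<le> x powr (1 / \<alpha>) * power_sum (1 - 1 / \<alpha>) (nat \<lfloor>x / 2\<rfloor>) / 2"
        using 1 by (simp add: growth_def p log_exp_def)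
    qed simp
  next
    case 2
    have s: "1 - 1 / \<alpha> = -1" unfolding 2 by simp
    have p: "crit_exp \<alpha> = 1 / \<alpha>" unfolding crit_exp_def 2 by simp
    have e: "log_exp \<alpha> = 1" unfolding log_exp_def 2 by simp
    show thesis
    proof (rule red[of "1 / 8"])
      fix x :: real assume x: "4 \<le> x"
      have "ln x \<ge> ln (2 * 2)" using x by (subst ln_le_cancel_iff) auto
      then have l4: "ln x \<ge> 2 * ln 2" by (subst (asm) ln_mult) auto
      have "ln (x / 2) \<le> ln (real (nat \<lfloor>x / 2\<rfloor>) + 1)"
        using x by (subst ln_le_cancel_iff) (auto, linarith)
      also have "\<dots> \<le> power_sum (-1) (nat \<lfloor>x / 2\<rfloor>)" by (rule power_sum_minus_1_ge)
      finally have "ln x - ln 2 \<le> power_sum (-1) (nat \<lfloor>x / 2\<rfloor>)" using x by (simp add: ln_div)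
      moreover have "log_plus x = ln x"
        using l4 ln2_ge_two_thirds by (simp add: log_plus_def)
      ultimately have "log_plus x / 4 \<le> power_sum (-1) (nat \<lfloor>x / 2\<rfloor>)"
        using l4 ln2_ge_two_thirds by linarith
      then have "x powr (1 / \<alpha>) * (log_plus x / 4) \<le> x powr (1 / \<alpha>) * power_sum (-1) (nat \<lfloor>x / 2\<rfloor>)"
        by (intro mult_left_mono) auto
      then show "1 / 8 * growth (crit_exp \<alpha>) (log_exp \<alpha>) x
          \<le> x powr (1 / \<alpha>) * power_sum (1 - 1 / \<alpha>) (nat \<lfloor>x / 2\<rfloor>) / 2"
        unfolding s p e by (simp add: growth_def mult_ac)
    qed simp
  next
    case 3
    define s where "s = 1 - 1 / \<alpha>"
    have s: "-1 < s" "s \<le> 0" using 3 \<alpha> by (auto simp: s_def field_simps)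
    have p: "crit_exp \<alpha> = 2" using 3 \<alpha> by (simp add: crit_exp_def field_simps max_def)
    show thesis
    proof (rule red[of "(1 / 4) powr (s + 1) / 2"])
      fix x :: real assume x: "4 \<le> x"
      have "(1 / 4) powr (s + 1) * x powr (s + 1) = (x / 4) powr (s + 1)"
        using x by (simp flip: powr_mult)
      also have "\<dots> \<le> real (nat \<lfloor>x / 2\<rfloor>) powr (s + 1)"
        using s x by (intro powr_mono2) (auto, linarith)
      also have "\<dots> \<le> power_sum s (nat \<lfloor>x / 2\<rfloor>)"
        by (rule power_sum_ge[OF s(2)])
      finally have "x powr (1 / \<alpha>) * ((1 / 4) powr (s + 1) * x powr (s + 1)) \<le> x powr (1 / \<alpha>) * power_sum s (nat \<lfloor>x / 2\<rfloor>)"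
        by (intro mult_left_mono) auto
      moreover have "x powr (1 / \<alpha>) * ((1 / 4) powr (s + 1) * x powr (s + 1)) = (1 / 4) powr (s + 1) * x powr 2"
        by (simp add: s_def flip: powr_add)
      ultimately show "(1 / 4) powr (s + 1) / 2 * growth (crit_exp \<alpha>) (log_exp \<alpha>) x
          \<le> x powr (1 / \<alpha>) * power_sum (1 - 1 / \<alpha>) (nat \<lfloor>x / 2\<rfloor>) / 2"
        using 3 unfolding p s_def[symmetric] by (simp add: growth_def log_exp_def)
    qed simp
  qed
qed

text \<open>\<open>log_exp\<close> is the power of the logarithm that the pairs \<open>(m, k)\<close> produce on their own;
  \<open>extra_log_exp\<close> is the further power produced by summing over the pairs \<open>(n, l)\<close>.\<close>

definition extra_log_exp :: "real \<Rightarrow> real \<Rightarrow> nat" where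
  "extra_log_exp \<alpha> \<beta> = (if \<alpha> < 1 / 2 then (if \<alpha> < \<beta> then 0 else 1) else if \<beta> = 1 / 2 then 2 else 1)"

lemma crit_exp_ge_2: "2 \<le> crit_exp \<alpha>"
  by (simp add: crit_exp_def)

lemma crit_exp_less_half: "0 < \<alpha> \<Longrightarrow> \<alpha> < 1 / 2 \<Longrightarrow> crit_exp \<alpha> = 1 / \<alpha>"
  by (simp add: crit_exp_def field_simps max_def)

lemma crit_exp_ge_half: "1 / 2 \<le> \<alpha> \<Longrightarrow> crit_exp \<alpha> = 2"
  by (simp add: crit_exp_def field_simps max_def)

section \<open>Sums of inverse powers of the weights\<close>

lemma pair_weight_powr:
  assumes "(n, l) \<in> pairs"
  shows "pair_weight \<beta> (n, l) powr (- p) = real n powr (- (\<beta> * p)) * real l powr (- ((1 - \<beta>) * p))"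
  using assms by (auto simp: pair_weight_def pairs_def powr_mult powr_powr)

text \<open>As \<open>l \<le> n\<close>, the surplus of the exponent of \<open>n\<close> over
  \<open>r\<close> may be moved to \<open>l\<close>. The sum then splits into a product with
  exponents \<open>r\<close> and \<open>p - r\<close>, where \<open>r\<close> is still free.\<close>

lemma sum_pair_weight_powr_le_product:
  assumes \<beta>: "0 < \<beta>" "\<beta> \<le> 1" and r: "r \<le> \<beta> * p"
  shows "(\<Sum>q | q \<in> pairs \<and> pair_weight \<beta> q < x. pair_weight \<beta> q powr (- p))
    \<le> power_sum (- r) (nat \<lfloor>x powr (1 / \<beta>)\<rfloor>) * power_sum (- (p - r)) (nat \<lfloor>x powr (1 / \<beta>)\<rfloor>)"
proof -
  let ?R = "nat \<lfloor>x powr (1 / \<beta>)\<rfloor>"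
  let ?f = "\<lambda>(n, l). real n powr (- r) * real l powr (- (p - r))"
  have "(\<Sum>q | q \<in> pairs \<and> pair_weight \<beta> q < x. pair_weight \<beta> q powr (- p)) \<le> (\<Sum>q | q \<in> pairs \<and> pair_weight \<beta> q < x. ?f q)"
  proof (intro sum_mono)
    fix q assume "q \<in> {q \<in> pairs. pair_weight \<beta> q < x}"
    then obtain n l where q: "q = (n, l)" "(n, l) \<in> pairs" "1 \<le> l" "l \<le> n"
      by (cases q) (auto simp: pairs_def)
    have "real n powr (- (\<beta> * p)) = real n powr (- r) * real n powr (- (\<beta> * p - r))"
      by (simp flip: powr_add)
    also have "\<dots> \<le> real n powr (- r) * real l powr (- (\<beta> * p - r))"
      using q r by (intro mult_left_mono powr_mono2') auto
    finally have "real n powr (- (\<beta> * p)) * real l powr (- ((1 - \<beta>) * p))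
        \<le> real n powr (- r) * real l powr (- (\<beta> * p - r)) * real l powr (- ((1 - \<beta>) * p))"
      by (rule mult_right_mono) auto
    also have "\<dots> = real n powr (- r) * real l powr (- (p - r))"
      by (simp add: algebra_simps flip: powr_add)
    finally show "pair_weight \<beta> q powr (- p) \<le> ?f q"
      using q by (simp add: pair_weight_powr)
  qed
  also have "\<dots> \<le> (\<Sum>q\<in>{1..?R} \<times> {1..?R}. ?f q)"
    using pair_weight_less_subset[OF \<beta>] by (intro sum_mono2) (auto simp: case_prod_beta)
  also have "\<dots> = power_sum (- r) ?R * power_sum (- (p - r)) ?R"
    unfolding power_sum_def sum_product sum.cartesian_product by simp
  finally show ?thesis .
qed

text \<open>The product bound cannot give a single logarithm for \<open>p = 2\<close>: its exponents
  \<open>r\<close> and \<open>2 - r\<close> give two logarithms for \<open>r = 1\<close> and a power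
  otherwise. So \<open>l\<close> is summed first, up to \<open>n\<close>; the inner sum has order
  \<open>n powr (2 * \<beta> - 1)\<close>, which leaves \<open>1 / n\<close>.\<close>

lemma sum_pair_weight_powr_le_log:
  assumes \<beta>: "1 / 2 < \<beta>" "\<beta> \<le> 1"
  shows "(\<Sum>q | q \<in> pairs \<and> pair_weight \<beta> q < x. pair_weight \<beta> q powr (- 2))
    \<le> power_sum (- 1) (nat \<lfloor>x powr (1 / \<beta>)\<rfloor>) / (2 * \<beta> - 1)"
proof -
  let ?R = "nat \<lfloor>x powr (1 / \<beta>)\<rfloor>"
  let ?f = "\<lambda>n l. real n powr (- (\<beta> * 2)) * real l powr (- ((1 - \<beta>) * 2))"
  have "{q \<in> pairs. pair_weight \<beta> q < x} \<subseteq> Sigma {1..?R} (\<lambda>n. {1..n})"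
    using pair_weight_less_subset[of \<beta> x] \<beta> by (auto simp: pairs_def)
  then have "(\<Sum>q | q \<in> pairs \<and> pair_weight \<beta> q < x. pair_weight \<beta> q powr (- 2)) \<le> (\<Sum>q\<in>Sigma {1..?R} (\<lambda>n. {1..n}). pair_weight \<beta> q powr (- 2))"
    by (intro sum_mono2) auto
  also have "\<dots> = (\<Sum>(n, l)\<in>Sigma {1..?R} (\<lambda>n. {1..n}). ?f n l)"
    by (intro sum.cong refl) (auto simp: pair_weight_powr pairs_def)
  also have "\<dots> = (\<Sum>n=1..?R. real n powr (- (\<beta> * 2)) * power_sum (- ((1 - \<beta>) * 2)) n)"
    by (simp add: sum.Sigma[symmetric] power_sum_def sum_distrib_left)
  also have "\<dots> \<le> (\<Sum>n=1..?R. real n powr (- 1) / (2 * \<beta> - 1))"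
  proof (intro sum_mono)
    fix n assume n: "n \<in> {1..?R}"
    have "real n powr (- (\<beta> * 2)) * power_sum (- ((1 - \<beta>) * 2)) n
        \<le> real n powr (- (\<beta> * 2)) * (real n powr (- ((1 - \<beta>) * 2) + 1) / (- ((1 - \<beta>) * 2) + 1))"
      using \<beta> by (intro mult_left_mono power_sum_le) auto
    also have "\<dots> = real n powr (- 1) / (2 * \<beta> - 1)"
      by (simp add: algebra_simps flip: powr_add)
    finally show "real n powr (- (\<beta> * 2)) * power_sum (- ((1 - \<beta>) * 2)) n \<le> real n powr (- 1) / (2 * \<beta> - 1)" .
  qed
  also have "\<dots> = power_sum (- 1) ?R / (2 * \<beta> - 1)"
    by (simp add: power_sum_def sum_divide_distrib)
  finally show ?thesis .
qed

lemma power_sum_minus_1_le_log_plus: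
  assumes "0 < \<beta>" "1 \<le> x"
  shows "power_sum (- 1) (nat \<lfloor>x powr (1 / \<beta>)\<rfloor>) \<le> (1 + 1 / \<beta>) * log_plus x"
proof -
  have one: "1 \<le> x powr (1 / \<beta>)" using assms by (intro ge_one_powr_ge_zero) auto
  from one have R: "1 \<le> nat \<lfloor>x powr (1 / \<beta>)\<rfloor>" by (simp add: le_nat_floor)
  then have "power_sum (- 1) (nat \<lfloor>x powr (1 / \<beta>)\<rfloor>) \<le> 1 + ln (real (nat \<lfloor>x powr (1 / \<beta>)\<rfloor>))"
    by (rule power_sum_minus_1_le)
  also have "ln (real (nat \<lfloor>x powr (1 / \<beta>)\<rfloor>)) \<le> ln (x powr (1 / \<beta>))"
    using R one assms by (subst ln_le_cancel_iff) auto
  also have "ln (x powr (1 / \<beta>)) = 1 / \<beta> * ln x" by (simp add: ln_powr)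
  also have "\<dots> \<le> 1 / \<beta> * log_plus x"
    using assms by (intro mult_left_mono ln_le_log_plus) auto
  also have "1 + 1 / \<beta> * log_plus x \<le> (1 + 1 / \<beta>) * log_plus x"
    using log_plus_ge_1[of x] by (simp add: algebra_simps)
  finally show ?thesis by simp
qed

lemma sum_pair_weight_powr_upper:
  assumes \<alpha>: "0 < \<alpha>" "\<alpha> \<le> \<beta>" "\<beta> \<le> 1"
  obtains C where "C > 0"
    "\<And>x. 1 \<le> x \<Longrightarrow> (\<Sum>q | q \<in> pairs \<and> pair_weight \<beta> q < x. pair_weight \<beta> q powr (- crit_exp \<alpha>)) \<le> C * log_plus x ^ extra_log_exp \<alpha> \<beta>"
proof -
  have \<beta>: "0 < \<beta>" "\<beta> \<le> 1" using \<alpha> by auto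
  let ?R = "\<lambda>x. nat \<lfloor>x powr (1 / \<beta>)\<rfloor>"
  have L: "0 \<le> log_plus x" for x using log_plus_ge_1[of x] by linarith
  consider "\<alpha> < 1 / 2" "\<alpha> < \<beta>" | "\<alpha> < 1 / 2" "\<beta> = \<alpha>" | "1 / 2 \<le> \<alpha>" "\<beta> = 1 / 2" | "1 / 2 \<le> \<alpha>" "1 / 2 < \<beta>"
    using \<alpha> by linarith
  then show thesis
  proof cases
    case 1
    define p where "p = crit_exp \<alpha>"
    have p: "p = 1 / \<alpha>" using 1 \<alpha> by (simp add: p_def crit_exp_less_half)
    have "2 < p" "1 < \<beta> * p" using 1 \<alpha> by (auto simp: p field_simps)
    \<comment> \<open>Since \<open>\<beta> * p\<close> and \<open>p - 1\<close> both exceed 1, the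
      midpoint \<open>r\<close> of 1 and their minimum satisfies \<open>r > 1\<close> and
      \<open>p - r > 1\<close>. Both factors converge and no logarithm appears.\<close>
    define d where "d = min (\<beta> * p) (p - 1)"
    have d: "1 < d" "d \<le> \<beta> * p" "d \<le> p - 1"
      using \<open>2 < p\<close> \<open>1 < \<beta> * p\<close> by (auto simp: d_def)
    define r where "r = (1 + d) / 2"
    have "1 < r" "r < d" using d by (auto simp: r_def)
    then have r: "1 < r" "r \<le> \<beta> * p" "r < p - 1" using d by linarith+
    obtain C1 where C1: "C1 > 0" "\<And>K. power_sum (- r) K \<le> C1"
      using power_sum_bounded[of "- r"] r by auto
    obtain C2 where C2: "C2 > 0" "\<And>K. power_sum (- (p - r)) K \<le> C2"
      using power_sum_bounded[of "- (p - r)"] r by auto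
    show thesis
    proof (rule that[of "C1 * C2"])
      fix x :: real
      have "(\<Sum>q | q \<in> pairs \<and> pair_weight \<beta> q < x. pair_weight \<beta> q powr (- p)) \<le> power_sum (- r) (?R x) * power_sum (- (p - r)) (?R x)"
        by (rule sum_pair_weight_powr_le_product[OF \<beta> r(2)])
      also have "\<dots> \<le> C1 * C2"
        using C1 C2 by (intro mult_mono power_sum_nonneg) (auto intro: less_imp_le)
      finally show "(\<Sum>q | q \<in> pairs \<and> pair_weight \<beta> q < x. pair_weight \<beta> q powr (- crit_exp \<alpha>)) \<le> C1 * C2 * log_plus x ^ extra_log_exp \<alpha> \<beta>"
        using 1 by (simp add: extra_log_exp_def p_def)
    qed (use C1 C2 in simp)
  next
    case 2
    define p where "p = crit_exp \<alpha>"
    have p: "p = 1 / \<alpha>" using 2 \<alpha> by (simp add: p_def crit_exp_less_half)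
    \<comment> \<open>Here \<open>\<beta> * p = 1\<close>, so \<open>r\<close> can be at most 1. The
      choice \<open>r = 1\<close> gives one logarithmic factor and, as \<open>p > 2\<close>, one
      convergent factor.\<close>
    have p': "2 < p" "1 \<le> \<beta> * p" using 2 \<alpha> by (auto simp: p field_simps)
    obtain C2 where C2: "C2 > 0" "\<And>K. power_sum (- (p - 1)) K \<le> C2"
      using power_sum_bounded[of "- (p - 1)"] p' by auto
    show thesis
    proof (rule that[of "(1 + 1 / \<beta>) * C2"])
      fix x :: real assume x: "1 \<le> x"
      have "(\<Sum>q | q \<in> pairs \<and> pair_weight \<beta> q < x. pair_weight \<beta> q powr (- p)) \<le> power_sum (- 1) (?R x) * power_sum (- (p - 1)) (?R x)"
        by (rule sum_pair_weight_powr_le_product[OF \<beta> p'(2)])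
      also have "\<dots> \<le> ((1 + 1 / \<beta>) * log_plus x) * C2"
        using C2 \<beta> x L by (intro mult_mono power_sum_nonneg power_sum_minus_1_le_log_plus) auto
      finally show "(\<Sum>q | q \<in> pairs \<and> pair_weight \<beta> q < x. pair_weight \<beta> q powr (- crit_exp \<alpha>)) \<le> (1 + 1 / \<beta>) * C2 * log_plus x ^ extra_log_exp \<alpha> \<beta>"
        using 2 by (simp add: extra_log_exp_def p_def mult_ac)
    qed (use C2 \<beta> in \<open>auto intro!: mult_pos_pos add_pos_pos\<close>)
  next
    case 3
    have p: "crit_exp \<alpha> = 2" using 3 \<alpha> by (simp add: crit_exp_ge_half)
    have e: "extra_log_exp \<alpha> \<beta> = 2" using 3 by (simp add: extra_log_exp_def)
    show thesis
    proof (rule that[of "(1 + 1 / \<beta>)\<^sup>2"])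
      fix x :: real assume x: "1 \<le> x"
      have "(\<Sum>q | q \<in> pairs \<and> pair_weight \<beta> q < x. pair_weight \<beta> q powr (- 2)) \<le> power_sum (- 1) (?R x) * power_sum (- (2 - 1)) (?R x)"
        using 3 by (intro sum_pair_weight_powr_le_product[OF \<beta>]) auto
      also have "\<dots> \<le> ((1 + 1 / \<beta>) * log_plus x) * ((1 + 1 / \<beta>) * log_plus x)"
        using power_sum_minus_1_le_log_plus[OF \<beta>(1) x] power_sum_nonneg[of "-1" "?R x"]
        by (intro mult_mono) auto
      finally show "(\<Sum>q | q \<in> pairs \<and> pair_weight \<beta> q < x. pair_weight \<beta> q powr (- crit_exp \<alpha>)) \<le> (1 + 1 / \<beta>)\<^sup>2 * log_plus x ^ extra_log_exp \<alpha> \<beta>"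
        unfolding p e by (simp add: power2_eq_square mult_ac)
    qed (intro zero_less_power add_pos_pos; use \<beta> in simp)
  next
    case 4
    have p: "crit_exp \<alpha> = 2" using 4 \<alpha> by (simp add: crit_exp_ge_half)
    show thesis
    proof (rule that[of "(1 + 1 / \<beta>) / (2 * \<beta> - 1)"])
      fix x :: real assume x: "1 \<le> x"
      have "(\<Sum>q | q \<in> pairs \<and> pair_weight \<beta> q < x. pair_weight \<beta> q powr (- 2)) \<le> power_sum (- 1) (?R x) / (2 * \<beta> - 1)"
        using 4 \<beta> by (intro sum_pair_weight_powr_le_log) auto
      also have "\<dots> \<le> (1 + 1 / \<beta>) * log_plus x / (2 * \<beta> - 1)"
        using 4 \<beta> x by (intro divide_right_mono power_sum_minus_1_le_log_plus) auto
      finally show "(\<Sum>q | q \<in> pairs \<and> pair_weight \<beta> q < x. pair_weight \<beta> q powr (- crit_exp \<alpha>)) \<le> (1 + 1 / \<beta>) / (2 * \<beta> - 1) * log_plus x ^ extra_log_exp \<alpha> \<beta>"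
        using 4 by (simp add: extra_log_exp_def p)
    qed (use 4 \<beta> in \<open>auto intro!: divide_pos_pos add_pos_pos\<close>)
  qed
qed

lemma pair_weight_le_fst:
  assumes "(m, k) \<in> pairs" "\<beta> \<le> 1" shows "pair_weight \<beta> (m, k) \<le> real m"
proof -
  have "pair_weight \<beta> (m, k) \<le> real m powr \<beta> * real m powr (1 - \<beta>)"
    using assms by (auto simp: pair_weight_def pairs_def intro!: mult_left_mono powr_mono2)
  then show ?thesis using assms by (simp add: pairs_def flip: powr_add)
qed

lemma finite_pair_weight_le: "0 < \<beta> \<Longrightarrow> \<beta> \<le> 1 \<Longrightarrow> finite {q \<in> pairs. pair_weight \<beta> q \<le> x}"
  by (rule finite_subset[OF _ finite_pair_weight_less[of \<beta> "x + 1"]]) auto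

lemma ln_ge_16: "16 \<le> x \<Longrightarrow> 4 * ln 2 \<le> ln (x :: real)"
proof -
  assume "16 \<le> x"
  then have "ln ((2 :: real) ^ 4) \<le> ln x" by (subst ln_le_cancel_iff) auto
  then show ?thesis by (subst (asm) ln_realpow) auto
qed

lemma log_plus_eq_ln: "16 \<le> x \<Longrightarrow> log_plus x = ln x"
  using ln_ge_16[of x] ln2_ge_two_thirds by (simp add: log_plus_def)

lemma power_sum_minus_1_ge_ln:
  assumes "0 < y" shows "ln y \<le> power_sum (- 1) (nat \<lfloor>y\<rfloor>)"
proof -
  have "ln y \<le> ln (real (nat \<lfloor>y\<rfloor>) + 1)"
    using assms by (subst ln_le_cancel_iff) (auto, linarith)
  then show ?thesis using power_sum_minus_1_ge[of "nat \<lfloor>y\<rfloor>"] by linarith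
qed

text \<open>In each case a simple subfamily already has the full order: the pair
  \<open>(1, 1)\<close>, the pairs \<open>(n, 1)\<close>, all pairs with
  \<open>n \<le> sqrt x\<close>, or pairs near the diagonal. With \<open>sqrt x\<close> in place of
  \<open>x\<close> as the bound for a weight \<open>w\<close>, the rescaled level
  \<open>x / w\<close> stays at least \<open>sqrt x\<close>.\<close>

lemma sum_pair_weight_powr_lower:
  assumes \<alpha>: "0 < \<alpha>" "\<alpha> \<le> \<beta>" "\<beta> \<le> 1"
  obtains c where "c > 0"
    "\<And>x. 16 \<le> x \<Longrightarrow> c * log_plus x ^ extra_log_exp \<alpha> \<beta> \<le> (\<Sum>q | q \<in> pairs \<and> pair_weight \<beta> q \<le> sqrt x. pair_weight \<beta> q powr (- crit_exp \<alpha>))"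
proof -
  have \<beta>: "0 < \<beta>" "\<beta> \<le> 1" using \<alpha> by auto
  have sub: "(\<Sum>q\<in>S. pair_weight \<beta> q powr (- p)) \<le> (\<Sum>q | q \<in> pairs \<and> pair_weight \<beta> q \<le> sqrt x. pair_weight \<beta> q powr (- p))"
    if "S \<subseteq> {q \<in> pairs. pair_weight \<beta> q \<le> sqrt x}" for S x p
    using that finite_pair_weight_le[OF \<beta>] by (intro sum_mono2) auto
  consider "\<alpha> < 1 / 2" "\<alpha> < \<beta>" | "\<alpha> < 1 / 2" "\<beta> = \<alpha>" | "1 / 2 \<le> \<alpha>" "\<beta> = 1 / 2" | "1 / 2 \<le> \<alpha>" "1 / 2 < \<beta>"
    using \<alpha> by linarith
  then show thesis
  proof cases
    case 1
    show thesis
    proof (rule that[of 1])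
      fix x :: real assume "16 \<le> x"
      then have "(\<Sum>q\<in>{(1, 1)}. pair_weight \<beta> q powr (- crit_exp \<alpha>)) \<le> (\<Sum>q | q \<in> pairs \<and> pair_weight \<beta> q \<le> sqrt x. pair_weight \<beta> q powr (- crit_exp \<alpha>))"
        by (intro sub) (auto simp: pairs_def pair_weight_def)
      then show "1 * log_plus x ^ extra_log_exp \<alpha> \<beta> \<le> (\<Sum>q | q \<in> pairs \<and> pair_weight \<beta> q \<le> sqrt x. pair_weight \<beta> q powr (- crit_exp \<alpha>))"
        using 1 by (simp add: extra_log_exp_def pair_weight_def)
    qed simp
  next
    case 2
    have p: "\<beta> * crit_exp \<alpha> = 1" using 2 \<alpha> by (simp add: crit_exp_less_half)
    show thesis
    proof (rule that[of "1 / (2 * \<beta>)"])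
      fix x :: real assume x: "16 \<le> x"
      let ?R = "nat \<lfloor>sqrt x powr (1 / \<beta>)\<rfloor>"
      \<comment> \<open>For \<open>l = 1\<close> the weight is \<open>n powr \<beta>\<close>, and
        \<open>\<beta> * p = 1\<close> turns its inverse power into \<open>1 / n\<close>.\<close>
      have "(\<lambda>n. (n, 1 :: nat)) ` {1..?R} \<subseteq> {q \<in> pairs. pair_weight \<beta> q \<le> sqrt x}"
      proof
        fix q assume "q \<in> (\<lambda>n. (n, 1 :: nat)) ` {1..?R}"
        then obtain n where n: "q = (n, 1)" "1 \<le> n" "n \<le> ?R" by auto
        then have "real n \<le> sqrt x powr (1 / \<beta>)" by (simp add: le_nat_floor) linarith
        then have "real n powr \<beta> \<le> (sqrt x powr (1 / \<beta>)) powr \<beta>"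
          using \<beta> by (intro powr_mono2) auto
        then show "q \<in> {q \<in> pairs. pair_weight \<beta> q \<le> sqrt x}"
          using n x \<beta> by (simp add: pairs_def pair_weight_def powr_powr)
      qed
      then have "(\<Sum>q\<in>(\<lambda>n. (n, 1 :: nat)) ` {1..?R}. pair_weight \<beta> q powr (- crit_exp \<alpha>)) \<le> (\<Sum>q | q \<in> pairs \<and> pair_weight \<beta> q \<le> sqrt x. pair_weight \<beta> q powr (- crit_exp \<alpha>))"
        by (rule sub)
      moreover have "(\<Sum>q\<in>(\<lambda>n. (n, 1 :: nat)) ` {1..?R}. pair_weight \<beta> q powr (- crit_exp \<alpha>)) = power_sum (- 1) ?R"
        using p by (subst sum.reindex) (auto simp: inj_on_def pair_weight_def power_sum_def powr_powr)
      moreover have "ln (sqrt x powr (1 / \<beta>)) \<le> power_sum (- 1) ?R"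
        using x by (intro power_sum_minus_1_ge_ln) simp
      moreover have "ln (sqrt x powr (1 / \<beta>)) = 1 / (2 * \<beta>) * ln x"
        using x by (simp add: ln_powr ln_sqrt)
      ultimately show "1 / (2 * \<beta>) * log_plus x ^ extra_log_exp \<alpha> \<beta> \<le> (\<Sum>q | q \<in> pairs \<and> pair_weight \<beta> q \<le> sqrt x. pair_weight \<beta> q powr (- crit_exp \<alpha>))"
        using 2 x by (simp add: extra_log_exp_def log_plus_eq_ln)
    qed (use \<beta> in simp)
  next
    case 3
    have p: "crit_exp \<alpha> = 2" using 3 \<alpha> by (simp add: crit_exp_ge_half)
    have e: "extra_log_exp \<alpha> \<beta> = 2" using 3 by (simp add: extra_log_exp_def)
    show thesis
    proof (rule that[of "1 / 8"])
      fix x :: real assume x: "16 \<le> x"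
      let ?R = "nat \<lfloor>sqrt x\<rfloor>"
      \<comment> \<open>At \<open>\<beta> = 1/2\<close> the weight is the geometric mean of
        \<open>n\<close> and \<open>l\<close>, so its inverse square is \<open>1 / (n * l)\<close>
        and the inner sum is a harmonic number.\<close>
      have "Sigma {1..?R} (\<lambda>n. {1..n}) \<subseteq> {q \<in> pairs. pair_weight \<beta> q \<le> sqrt x}"
      proof
        fix q assume "q \<in> Sigma {1..?R} (\<lambda>n. {1..n})"
        then obtain n l where q: "q = (n, l)" "(n, l) \<in> pairs" "n \<le> ?R" by (auto simp: pairs_def)
        have "pair_weight \<beta> (n, l) \<le> real n" by (intro pair_weight_le_fst q \<beta>)
        also have "real n \<le> sqrt x" using q(3) x by (simp add: le_nat_iff le_floor_iff)
        finally show "q \<in> {q \<in> pairs. pair_weight \<beta> q \<le> sqrt x}" using q by simp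
      qed
      then have "(\<Sum>q\<in>Sigma {1..?R} (\<lambda>n. {1..n}). pair_weight \<beta> q powr (- 2)) \<le> (\<Sum>q | q \<in> pairs \<and> pair_weight \<beta> q \<le> sqrt x. pair_weight \<beta> q powr (- 2))"
        by (rule sub)
      moreover have "(\<Sum>q\<in>Sigma {1..?R} (\<lambda>n. {1..n}). pair_weight \<beta> q powr (- 2)) = (\<Sum>(n, l)\<in>Sigma {1..?R} (\<lambda>n. {1..n}). 1 / (real n * real l))"
      proof (intro sum.cong refl, clarify)
        fix n l assume "n \<in> {1..?R}" "l \<in> {1..n}"
        then have nl: "(n, l) \<in> pairs" by (auto simp: pairs_def)
        have h: "\<beta> * 2 = 1" "(1 - \<beta>) * 2 = 1" using 3 by auto
        show "pair_weight \<beta> (n, l) powr - 2 = 1 / (real n * real l)"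
          unfolding pair_weight_powr[OF nl] h using nl by (simp add: pairs_def powr_minus field_simps)
      qed
      moreover have "(\<Sum>(n, l)\<in>Sigma {1..?R} (\<lambda>n. {1..n}). 1 / (real n * real l)) = (\<Sum>n=1..?R. harm n / real n)"
        by (simp add: sum.Sigma[symmetric] harm_def sum_divide_distrib inverse_eq_divide mult_ac)
      moreover have "harm ?R ^ 2 / 2 \<le> (\<Sum>n=1..?R. harm n / real n :: real)"
        by (rule sum_harm_div_ge)
      moreover have "(ln x / 2)\<^sup>2 \<le> harm ?R ^ 2"
        using power_sum_minus_1_ge_ln[of "sqrt x"] x
        by (intro power_mono) (auto simp: ln_sqrt power_sum_minus_1)
      ultimately have "(ln x / 2)\<^sup>2 / 2 \<le> (\<Sum>q | q \<in> pairs \<and> pair_weight \<beta> q \<le> sqrt x. pair_weight \<beta> q powr (- 2))"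
        by linarith
      then show "1 / 8 * log_plus x ^ extra_log_exp \<alpha> \<beta> \<le> (\<Sum>q | q \<in> pairs \<and> pair_weight \<beta> q \<le> sqrt x. pair_weight \<beta> q powr (- crit_exp \<alpha>))"
        unfolding p e using x by (simp add: log_plus_eq_ln power_divide)
    qed simp
  next
    case 4
    have p: "crit_exp \<alpha> = 2" using 4 \<alpha> by (simp add: crit_exp_ge_half)
    show thesis
    proof (rule that[of "1 / 16"])
      fix x :: real assume x: "16 \<le> x"
      \<comment> \<open>For \<open>l \<le> n < 2 * l\<close> the weight is at most
        \<open>2 * l\<close>, whatever \<beta> is. There are \<open>l\<close> such \<open>n\<close>
        for each \<open>l\<close>, together contributing at least
        \<open>1 / (4 * l)\<close>.\<close>
      let ?K = "nat \<lfloor>sqrt x / 2\<rfloor>"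
      let ?S = "Sigma {1..?K} (\<lambda>l. {l..<2 * l})"
      have bd: "(n, l) \<in> pairs \<and> pair_weight \<beta> (n, l) \<le> 2 * real l \<and> 2 * real l \<le> sqrt x" if "(l, n) \<in> ?S" for l n
      proof -
        have p: "(n, l) \<in> pairs" using that by (auto simp: pairs_def)
        have "real n \<le> 2 * real l" using that by auto
        moreover have "2 * real l \<le> sqrt x" using that x by auto linarith
        ultimately show ?thesis using p pair_weight_le_fst[OF p \<beta>(2)] by linarith
      qed
      have "(\<lambda>(l, n). (n, l)) ` ?S \<subseteq> {q \<in> pairs. pair_weight \<beta> q \<le> sqrt x}"
        using bd by fastforce
      then have "(\<Sum>q\<in>(\<lambda>(l, n). (n, l)) ` ?S. pair_weight \<beta> q powr (- 2)) \<le> (\<Sum>q | q \<in> pairs \<and> pair_weight \<beta> q \<le> sqrt x. pair_weight \<beta> q powr (- 2))"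
        by (rule sub)
      moreover have "(\<Sum>q\<in>(\<lambda>(l, n). (n, l)) ` ?S. pair_weight \<beta> q powr (- 2)) = (\<Sum>(l, n)\<in>?S. pair_weight \<beta> (n, l) powr (- 2))"
        by (subst sum.reindex) (auto simp: inj_on_def case_prod_beta)
      moreover have "(\<Sum>(l, n)\<in>?S. (2 * real l) powr (- 2)) \<le> (\<Sum>(l, n)\<in>?S. pair_weight \<beta> (n, l) powr (- 2))"
      proof (intro sum_mono, clarify)
        fix l n assume "l \<in> {1..?K}" "n \<in> {l..<2 * l}"
        then have "(l, n) \<in> ?S" by auto
        from bd[OF this] show "(2 * real l) powr (- 2) \<le> pair_weight \<beta> (n, l) powr (- 2)"
          using pair_weight_ge_1[OF \<beta>, of "(n, l)"] by (intro powr_mono2') auto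
      qed
      moreover have "(\<Sum>(l, n)\<in>?S. (2 * real l) powr (- 2)) = (\<Sum>l=1..?K. real l * (2 * real l) powr (- 2))"
        by (simp add: sum.Sigma[symmetric])
      moreover have "\<dots> = power_sum (- 1) ?K / 4"
        unfolding power_sum_def sum_divide_distrib
        by (intro sum.cong) (auto simp: powr_minus powr_mult field_simps power2_eq_square)
      moreover have "ln (sqrt x / 2) \<le> power_sum (- 1) ?K"
        using x by (intro power_sum_minus_1_ge_ln) simp
      moreover have "ln (sqrt x / 2) = ln x / 2 - ln 2"
        using x by (simp add: ln_div ln_sqrt)
      \<comment> \<open>The threshold 16 enters here: \<open>ln x \<ge> 4 * ln 2\<close> makes
        \<open>ln x / 2 - ln 2\<close> at least \<open>ln x / 4\<close>.\<close>
      ultimately have "ln x / 16 \<le> (\<Sum>q | q \<in> pairs \<and> pair_weight \<beta> q \<le> sqrt x. pair_weight \<beta> q powr (- 2))"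
        using ln_ge_16[OF x] by linarith
      then show "1 / 16 * log_plus x ^ extra_log_exp \<alpha> \<beta> \<le> (\<Sum>q | q \<in> pairs \<and> pair_weight \<beta> q \<le> sqrt x. pair_weight \<beta> q powr (- crit_exp \<alpha>))"
        using 4 x by (simp add: extra_log_exp_def p log_plus_eq_ln)
    qed simp
  qed
qed

section \<open>Quadruples below a level\<close>

definition level :: "real \<Rightarrow> real \<Rightarrow> real \<Rightarrow> ((nat \<times> nat) \<times> (nat \<times> nat)) set" where
  "level \<alpha> \<beta> x = {(q, q'). q \<in> pairs \<and> q' \<in> pairs \<and> pair_weight \<alpha> q * pair_weight \<beta> q' < x}"

definition total_log_exp :: "real \<Rightarrow> real \<Rightarrow> nat" where
  "total_log_exp \<alpha> \<beta> = log_exp \<alpha> + extra_log_exp \<alpha> \<beta>"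

context
  fixes \<alpha> \<beta> :: real
  assumes \<alpha>: "0 < \<alpha>" "\<alpha> \<le> \<beta>" "\<beta> \<le> 1"
begin

text \<open>The set is fibred over the pairs of order \<beta>. As the other weight is at least 1,
  only \<open>q'\<close> of weight below \<open>x\<close> occur, and each leaves a count for the
  single order \<alpha> at a rescaled level.\<close>

lemma level_eq:
  "level \<alpha> \<beta> x = (\<lambda>(q', q). (q, q')) `
    Sigma {q' \<in> pairs. pair_weight \<beta> q' < x} (\<lambda>q'. {q \<in> pairs. pair_weight \<alpha> q < x / pair_weight \<beta> q'})"
proof -
  have "pair_weight \<alpha> q * pair_weight \<beta> q' < x \<longleftrightarrow> pair_weight \<beta> q' < x \<and> pair_weight \<alpha> q < x / pair_weight \<beta> q'"
    if "q \<in> pairs" "q' \<in> pairs" for q q'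
  proof -
    have ge: "1 \<le> pair_weight \<alpha> q" "1 \<le> pair_weight \<beta> q'" using that \<alpha> by (auto intro!: pair_weight_ge_1)
    then have "1 * pair_weight \<beta> q' \<le> pair_weight \<alpha> q * pair_weight \<beta> q'" by (intro mult_right_mono) auto
    moreover have "pair_weight \<alpha> q * pair_weight \<beta> q' < x \<longleftrightarrow> pair_weight \<alpha> q < x / pair_weight \<beta> q'"
      using ge by (subst pos_less_divide_eq) auto
    ultimately show ?thesis by (metis le_less_trans mult_1)
  qed
  then show ?thesis by (force simp: level_def image_iff)
qed

lemma finite_level: "finite (level \<alpha> \<beta> x)"
  unfolding level_eq using \<alpha> by (intro finite_imageI finite_SigmaI finite_pair_weight_less) auto

lemma card_level:
  "card (level \<alpha> \<beta> x) = (\<Sum>q' | q' \<in> pairs \<and> pair_weight \<beta> q' < x. card {q \<in> pairs. pair_weight \<alpha> q < x / pair_weight \<beta> q'})"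
  unfolding level_eq using \<alpha>
  by (subst card_image) (auto simp: inj_on_def intro!: card_SigmaI finite_pair_weight_less)

lemma card_level_upper:
  obtains C where "C > 0"
    "\<And>x. 0 \<le> x \<Longrightarrow> real (card (level \<alpha> \<beta> x)) \<le> C * growth (crit_exp \<alpha>) (total_log_exp \<alpha> \<beta>) x"
proof -
  let ?p = "crit_exp \<alpha>"
  obtain C1 where C1: "C1 > 0"
    "\<And>x. 0 < x \<Longrightarrow> real (card {q \<in> pairs. pair_weight \<alpha> q < x}) \<le> C1 * growth ?p (log_exp \<alpha>) x"
    using card_pair_weight_less_upper[of \<alpha>] \<alpha> by auto
  obtain C2 where C2: "C2 > 0"
    "\<And>x. 1 \<le> x \<Longrightarrow> (\<Sum>q | q \<in> pairs \<and> pair_weight \<beta> q < x. pair_weight \<beta> q powr (- ?p)) \<le> C2 * log_plus x ^ extra_log_exp \<alpha> \<beta>"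
    by (rule sum_pair_weight_powr_upper[OF \<alpha>]) blast
  show thesis
  proof (rule that[of "C1 * C2"])
    fix x :: real assume x: "0 \<le> x"
    show "real (card (level \<alpha> \<beta> x)) \<le> C1 * C2 * growth ?p (total_log_exp \<alpha> \<beta>) x"
    proof (cases "1 \<le> x")
      case False
      then have e: "{q' \<in> pairs. pair_weight \<beta> q' < x} = {}" using \<alpha> by (intro pair_weight_less_empty) auto
      show ?thesis unfolding card_level e using growth_nonneg[of ?p] C1 C2 by simp
    next
      case True
      have L: "0 \<le> log_plus x" using log_plus_ge_1[of x] by linarith
      have "real (card (level \<alpha> \<beta> x)) \<le> (\<Sum>q' | q' \<in> pairs \<and> pair_weight \<beta> q' < x.
          C1 * x powr ?p * log_plus x ^ log_exp \<alpha> * pair_weight \<beta> q' powr (- ?p))"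
        unfolding card_level of_nat_sum
      proof (intro sum_mono)
        fix q' assume "q' \<in> {q' \<in> pairs. pair_weight \<beta> q' < x}"
        then have h: "1 \<le> pair_weight \<beta> q'" using \<alpha> by (auto intro!: pair_weight_ge_1)
        have L0: "0 \<le> log_plus (x / pair_weight \<beta> q')" using log_plus_ge_1[of "x / pair_weight \<beta> q'"] by linarith
        have "real (card {q \<in> pairs. pair_weight \<alpha> q < x / pair_weight \<beta> q'}) \<le> C1 * growth ?p (log_exp \<alpha>) (x / pair_weight \<beta> q')"
          using h True by (intro C1) auto
        also have "growth ?p (log_exp \<alpha>) (x / pair_weight \<beta> q') \<le> x powr ?p * pair_weight \<beta> q' powr (- ?p) * log_plus x ^ log_exp \<alpha>"
          unfolding growth_def using h True L0
          by (intro mult_mono power_mono log_plus_mono) (auto simp: powr_divide powr_minus field_simps)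
        finally show "real (card {q \<in> pairs. pair_weight \<alpha> q < x / pair_weight \<beta> q'})
            \<le> C1 * x powr ?p * log_plus x ^ log_exp \<alpha> * pair_weight \<beta> q' powr (- ?p)"
          using C1(1) by (simp add: mult_ac)
      qed
      also have "\<dots> = C1 * x powr ?p * log_plus x ^ log_exp \<alpha> * (\<Sum>q' | q' \<in> pairs \<and> pair_weight \<beta> q' < x. pair_weight \<beta> q' powr (- ?p))"
        by (rule sum_distrib_left[symmetric])
      also have "\<dots> \<le> C1 * x powr ?p * log_plus x ^ log_exp \<alpha> * (C2 * log_plus x ^ extra_log_exp \<alpha> \<beta>)"
        using C1 L True by (intro mult_left_mono C2) auto
      also have "\<dots> = C1 * C2 * growth ?p (total_log_exp \<alpha> \<beta>) x"
        by (simp add: growth_def total_log_exp_def power_add)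
      finally show ?thesis .
    qed
  qed (use C1 C2 in simp)
qed

lemma card_level_lower:
  obtains c where "c > 0"
    "\<And>x. 16 \<le> x \<Longrightarrow> c * growth (crit_exp \<alpha>) (total_log_exp \<alpha> \<beta>) x \<le> real (card (level \<alpha> \<beta> x))"
proof -
  let ?p = "crit_exp \<alpha>"
  obtain c1 where c1: "c1 > 0"
    "\<And>x. 4 \<le> x \<Longrightarrow> c1 * growth ?p (log_exp \<alpha>) x \<le> real (card {q \<in> pairs. pair_weight \<alpha> q < x})"
    using card_pair_weight_less_lower[of \<alpha>] \<alpha> by auto
  obtain c2 where c2: "c2 > 0"
    "\<And>x. 16 \<le> x \<Longrightarrow> c2 * log_plus x ^ extra_log_exp \<alpha> \<beta> \<le> (\<Sum>q | q \<in> pairs \<and> pair_weight \<beta> q \<le> sqrt x. pair_weight \<beta> q powr (- ?p))"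
    by (rule sum_pair_weight_powr_lower[OF \<alpha>]) blast
  show thesis
  proof (rule that[of "c1 * (1 / 2) ^ log_exp \<alpha> * c2"])
    fix x :: real assume x: "16 \<le> x"
    have L: "0 \<le> log_plus x" using log_plus_ge_1[of x] by linarith
    have sq: "sqrt x * sqrt x = x" "4 \<le> sqrt x" "sqrt x < x"
      using x by (auto simp: real_le_rsqrt real_less_lsqrt power2_eq_square)
    \<comment> \<open>The halved logarithm comes from the rescaled level: it is at least
      \<open>sqrt x\<close> for the pairs kept, and \<open>log_plus (sqrt x)\<close> is at least
      \<open>log_plus x / 2\<close>.\<close>
    let ?k = "c1 * x powr ?p * (log_plus x / 2) ^ log_exp \<alpha>"
    have "?k * (c2 * log_plus x ^ extra_log_exp \<alpha> \<beta>) \<le> ?k * (\<Sum>q' | q' \<in> pairs \<and> pair_weight \<beta> q' \<le> sqrt x. pair_weight \<beta> q' powr (- ?p))"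
      using c1 L x by (intro mult_left_mono c2) auto
    also have "\<dots> = (\<Sum>q' | q' \<in> pairs \<and> pair_weight \<beta> q' \<le> sqrt x. ?k * pair_weight \<beta> q' powr (- ?p))"
      by (rule sum_distrib_left)
    also have "\<dots> \<le> (\<Sum>q' | q' \<in> pairs \<and> pair_weight \<beta> q' \<le> sqrt x. real (card {q \<in> pairs. pair_weight \<alpha> q < x / pair_weight \<beta> q'}))"
    proof (intro sum_mono)
      fix q' assume "q' \<in> {q' \<in> pairs. pair_weight \<beta> q' \<le> sqrt x}"
      then have h: "1 \<le> pair_weight \<beta> q'" "pair_weight \<beta> q' \<le> sqrt x" using \<alpha> by (auto intro!: pair_weight_ge_1)
      have "sqrt x * pair_weight \<beta> q' \<le> sqrt x * sqrt x" using h x by (intro mult_left_mono) auto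
      then have xh: "sqrt x \<le> x / pair_weight \<beta> q'" using h unfolding sq(1) by (subst pos_le_divide_eq) auto
      have "log_plus x / 2 \<le> log_plus (sqrt x)"
        using x by (auto simp: log_plus_def ln_sqrt)
      also have "\<dots> \<le> log_plus (x / pair_weight \<beta> q')"
        using xh x by (intro log_plus_mono) auto
      finally have "(log_plus x / 2) ^ log_exp \<alpha> \<le> log_plus (x / pair_weight \<beta> q') ^ log_exp \<alpha>"
        using L by (intro power_mono) auto
      then have "x powr ?p * pair_weight \<beta> q' powr (- ?p) * (log_plus x / 2) ^ log_exp \<alpha> \<le> growth ?p (log_exp \<alpha>) (x / pair_weight \<beta> q')"
        unfolding growth_def using h x L
        by (intro mult_mono) (auto simp: powr_divide powr_minus field_simps)
      then have "c1 * (x powr ?p * pair_weight \<beta> q' powr (- ?p) * (log_plus x / 2) ^ log_exp \<alpha>) \<le> c1 * growth ?p (log_exp \<alpha>) (x / pair_weight \<beta> q')"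
        using c1 by (intro mult_left_mono) auto
      also have "\<dots> \<le> real (card {q \<in> pairs. pair_weight \<alpha> q < x / pair_weight \<beta> q'})"
        using xh sq by (intro c1) auto
      finally show "?k * pair_weight \<beta> q' powr (- ?p) \<le> real (card {q \<in> pairs. pair_weight \<alpha> q < x / pair_weight \<beta> q'})"
        by (simp add: mult_ac)
    qed
    also have "\<dots> \<le> real (card (level \<alpha> \<beta> x))"
      unfolding card_level of_nat_sum using sq \<alpha> by (intro sum_mono2 finite_pair_weight_less) auto
    finally show "c1 * (1 / 2) ^ log_exp \<alpha> * c2 * growth ?p (total_log_exp \<alpha> \<beta>) x \<le> real (card (level \<alpha> \<beta> x))"
      by (simp add: growth_def total_log_exp_def power_add power_divide mult_ac)
  qed (use c1 c2 in simp)
qed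

end

section \<open>The series of single-jump probabilities\<close>

definition nweight :: "real \<Rightarrow> nat \<Rightarrow> nat \<Rightarrow> real" where
  "nweight \<alpha> m k = cesaro (\<alpha> - 1) (m - k) / cesaro \<alpha> m"

context
  fixes \<alpha> :: real
  assumes \<alpha>: "0 < \<alpha>" "\<alpha> \<le> 1"
begin

lemma nweight_pos: "0 < nweight \<alpha> m k"
  using \<alpha> by (auto simp: nweight_def intro!: divide_pos_pos cesaro_pos)

lemma nweight_le: "nweight \<alpha> m k \<le> 1 / cesaro \<alpha> m"
  using \<alpha> cesaro_pos[of \<alpha> m] by (auto simp: nweight_def intro!: divide_right_mono cesaro_le_1)

lemma sum_nweight: "(\<Sum>k\<le>m. nweight \<alpha> m k) = 1"
proof -
  have "(\<Sum>k\<le>m. cesaro (\<alpha> - 1) (m - k)) = (\<Sum>k\<le>m. cesaro (\<alpha> - 1) k)"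
    by (rule sum.reindex_bij_witness[of _ "\<lambda>k. m - k" "\<lambda>k. m - k"]) auto
  then show ?thesis
    using cesaro_pos[of \<alpha> m] \<alpha> by (simp add: nweight_def sum_cesaro flip: sum_divide_distrib)
qed

text \<open>The weight at \<open>k\<close> depends on \<open>m - k\<close>, so the index is
  reversed. Both entries are shifted by 1, to match the bounds in powers of \<open>n + 1\<close> and
  to keep the pair inside \<open>pairs\<close>.\<close>

lemma nweight_upper:
  obtains K where "K > 0" "\<And>m k. k \<le> m \<Longrightarrow> nweight \<alpha> m k \<le> K / pair_weight \<alpha> (m + 1, m - k + 1)"
proof -
  obtain c C where cC: "c > 0" "C > 0" "\<And>n. c * (real n + 1) powr \<alpha> \<le> cesaro \<alpha> n" "\<And>n. cesaro \<alpha> n \<le> C * (real n + 1) powr \<alpha>"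
    using cesaro_bounds[of \<alpha>] \<alpha> by (metis less_minus_one_simps(1) less_trans)
  obtain c' C' where cC': "c' > 0" "C' > 0" "\<And>n. c' * (real n + 1) powr (\<alpha> - 1) \<le> cesaro (\<alpha> - 1) n"
    "\<And>n. cesaro (\<alpha> - 1) n \<le> C' * (real n + 1) powr (\<alpha> - 1)"
    by (rule cesaro_bounds[of "\<alpha> - 1"]) (use \<alpha> in auto)
  show thesis
  proof (rule that[of "C' / c"])
    fix m k :: nat assume "k \<le> m"
    have "nweight \<alpha> m k \<le> C' * (real (m - k) + 1) powr (\<alpha> - 1) / (c * (real m + 1) powr \<alpha>)"
      unfolding nweight_def using cC cC' cesaro_pos[of "\<alpha> - 1" "m - k"] \<alpha>
      by (intro frac_le) auto
    also have "(real (m - k) + 1) powr (\<alpha> - 1) = 1 / (real (m - k) + 1) powr (1 - \<alpha>)"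
      by (simp add: powr_diff)
    finally show "nweight \<alpha> m k \<le> C' / c / pair_weight \<alpha> (m + 1, m - k + 1)"
      by (simp add: pair_weight_def add_ac mult_ac)
  qed (use cC cC' in simp)
qed

text \<open>The same reversal read backwards, without the shift of \<open>m\<close>. Replacing
  \<open>m + 1\<close> by \<open>m\<close> costs at most \<open>2 powr \<alpha> \<le> 2\<close>,
  whence the 2 in the constant.\<close>

lemma nweight_lower:
  obtains K where "K > 0" "\<And>m k. (m, k) \<in> pairs \<Longrightarrow> K / pair_weight \<alpha> (m, k) \<le> nweight \<alpha> m (m - (k - 1))"
proof -
  obtain c C where cC: "c > 0" "C > 0" "\<And>n. c * (real n + 1) powr \<alpha> \<le> cesaro \<alpha> n" "\<And>n. cesaro \<alpha> n \<le> C * (real n + 1) powr \<alpha>"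
    by (rule cesaro_bounds[of "\<alpha>"]) (use \<alpha> in auto)
  obtain c' C' where cC': "c' > 0" "C' > 0" "\<And>n. c' * (real n + 1) powr (\<alpha> - 1) \<le> cesaro (\<alpha> - 1) n"
    "\<And>n. cesaro (\<alpha> - 1) n \<le> C' * (real n + 1) powr (\<alpha> - 1)"
    by (rule cesaro_bounds[of "\<alpha> - 1"]) (use \<alpha> in auto)
  show thesis
  proof (rule that[of "c' / (2 * C)"])
    fix m k :: nat assume mk: "(m, k) \<in> pairs"
    then have m: "1 \<le> k" "k \<le> m" by (auto simp: pairs_def)
    have "(real m + 1) powr \<alpha> \<le> (2 * real m) powr \<alpha>"
      using m \<alpha> by (intro powr_mono2) auto
    also have "\<dots> = 2 powr \<alpha> * real m powr \<alpha>"
      by (simp add: powr_mult)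
    also have "\<dots> \<le> 2 powr 1 * real m powr \<alpha>"
      using \<alpha> by (intro mult_right_mono powr_mono) auto
    finally have "C * (real m + 1) powr \<alpha> \<le> C * (2 powr 1 * real m powr \<alpha>)"
      using cC by (intro mult_left_mono) auto
    then have "cesaro \<alpha> m \<le> 2 * C * real m powr \<alpha>"
      using cC(4)[of m] by simp
    moreover have "c' * real k powr (\<alpha> - 1) \<le> cesaro (\<alpha> - 1) (k - 1)"
      using cC'(3)[of "k - 1"] m by (simp add: of_nat_diff)
    ultimately have "c' * real k powr (\<alpha> - 1) / (2 * C * real m powr \<alpha>) \<le> cesaro (\<alpha> - 1) (k - 1) / cesaro \<alpha> m"
      using cC cC' cesaro_pos[of \<alpha> m] cesaro_pos[of "\<alpha> - 1" "k - 1"] \<alpha> by (intro frac_le) auto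
    also have "cesaro (\<alpha> - 1) (k - 1) / cesaro \<alpha> m = nweight \<alpha> m (m - (k - 1))"
      using m by (simp add: nweight_def)
    also have "real k powr (\<alpha> - 1) = 1 / real k powr (1 - \<alpha>)"
      using m by (simp add: powr_diff)
    finally show "c' / (2 * C) / pair_weight \<alpha> (m, k) \<le> nweight \<alpha> m (m - (k - 1))"
      by (simp add: pair_weight_def mult_ac)
  qed (use cC cC' in simp)
qed

end

text \<open>Quadruples are grouped as indices of the series followed by the position of a summand,
  to suit the iterated sums, whereas \<open>level\<close> groups them by order. The
  \<open>Suc\<close> reflects that the series starts at 1 while the array starts at 0.\<close>

definition jump_set :: "real \<Rightarrow> real \<Rightarrow> real \<Rightarrow> real \<Rightarrow> ((nat \<times> nat) \<times> (nat \<times> nat)) set" where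
  "jump_set \<alpha> \<beta> t x = {((m, n), (k, l)). k \<le> Suc m \<and> l \<le> Suc n \<and>
     t < nweight \<alpha> (Suc m) k * nweight \<beta> (Suc n) l * x}"

lemma pair_weight_pos: "(m, k) \<in> pairs \<Longrightarrow> 0 < pair_weight \<alpha> (m, k)"
  by (auto simp: pair_weight_def pairs_def)

context
  fixes \<alpha> \<beta> t :: real
  assumes \<alpha>: "0 < \<alpha>" "\<alpha> \<le> \<beta>" "\<beta> \<le> 1" and t: "0 < t"
begin

lemma jump_set_upper:
  obtains C where "C > 0" "\<And>x. 0 \<le> x \<Longrightarrow> finite (jump_set \<alpha> \<beta> t x)"
    "\<And>x. 0 \<le> x \<Longrightarrow> real (card (jump_set \<alpha> \<beta> t x)) \<le> C * growth (crit_exp \<alpha>) (total_log_exp \<alpha> \<beta>) x"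
proof -
  let ?g = "growth (crit_exp \<alpha>) (total_log_exp \<alpha> \<beta>)"
  obtain K1 where K1: "K1 > 0" "\<And>m k. k \<le> m \<Longrightarrow> nweight \<alpha> m k \<le> K1 / pair_weight \<alpha> (m + 1, m - k + 1)"
    by (rule nweight_upper[of \<alpha>]) (use \<alpha> in auto)
  obtain K2 where K2: "K2 > 0" "\<And>m k. k \<le> m \<Longrightarrow> nweight \<beta> m k \<le> K2 / pair_weight \<beta> (m + 1, m - k + 1)"
    by (rule nweight_upper[of \<beta>]) (use \<alpha> in auto)
  define b where "b = K1 * K2 / t"
  have b: "b > 0" using K1 K2 t by (simp add: b_def)
  obtain C1 where C1: "C1 > 0" "\<And>x. 0 \<le> x \<Longrightarrow> real (card (level \<alpha> \<beta> x)) \<le> C1 * ?g x"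
    by (rule card_level_upper[OF \<alpha>]) blast
  have "0 < crit_exp \<alpha>" using crit_exp_ge_2[of \<alpha>] by linarith
  then obtain C2 where C2: "C2 > 0" "\<And>x. 0 \<le> x \<Longrightarrow> ?g (b * x) \<le> C2 * ?g x"
    using growth_scale[OF b] by metis
  \<comment> \<open>The first entries are \<open>m + 2\<close> and \<open>n + 2\<close> because the
    row index \<open>Suc m\<close> is shifted once more. On this set \<open>k \<le> Suc m\<close>,
    so the truncated subtraction loses nothing and \<open>f\<close> is injective.\<close>
  define f where "f = (\<lambda>((m, n), (k, l)). ((m + 2, Suc m - k + 1), (n + 2, Suc n - l + 1 :: nat)))"
  have inj: "inj_on f (jump_set \<alpha> \<beta> t x)" for x
    by (auto simp: inj_on_def f_def jump_set_def)
  have sub: "f ` jump_set \<alpha> \<beta> t x \<subseteq> level \<alpha> \<beta> (b * x)" if x: "0 \<le> x" for x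
  proof (rule image_subsetI)
    fix q assume "q \<in> jump_set \<alpha> \<beta> t x"
    moreover obtain m n k l where q: "q = ((m, n), (k, l))" by (metis prod.exhaust)
    ultimately have "((m, n), (k, l)) \<in> jump_set \<alpha> \<beta> t x" by simp
    then have h: "k \<le> Suc m" "l \<le> Suc n" "t < nweight \<alpha> (Suc m) k * nweight \<beta> (Suc n) l * x"
      by (auto simp: jump_set_def)
    have p: "(m + 2, Suc m - k + 1) \<in> pairs" "(n + 2, Suc n - l + 1) \<in> pairs"
      using h by (auto simp: pairs_def)
    let ?p = "pair_weight \<alpha> (m + 2, Suc m - k + 1)" and ?q = "pair_weight \<beta> (n + 2, Suc n - l + 1)"
    have "nweight \<alpha> (Suc m) k \<le> K1 / ?p" "nweight \<beta> (Suc n) l \<le> K2 / ?q"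
      using K1(2)[OF h(1)] K2(2)[OF h(2)] by auto
    then have "nweight \<alpha> (Suc m) k * nweight \<beta> (Suc n) l * x \<le> (K1 / ?p) * (K2 / ?q) * x"
      using x nweight_pos[of \<alpha> "Suc m" k] nweight_pos[of \<beta> "Suc n" l] \<alpha> pair_weight_pos[OF p(1), of \<alpha>] K1
      by (intro mult_right_mono mult_mono) auto
    then have "t < K1 * K2 * x / (?p * ?q)" using h(3) by simp
    then have "?p * ?q < b * x"
      using pair_weight_pos[OF p(1), of \<alpha>] pair_weight_pos[OF p(2), of \<beta>] t by (simp add: b_def field_simps)
    then show "f q \<in> level \<alpha> \<beta> (b * x)"
      using p by (simp add: f_def level_def q)
  qed
  show thesis
  proof (rule that[of "C1 * C2"])
    fix x :: real assume x: "0 \<le> x"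
    show "finite (jump_set \<alpha> \<beta> t x)"
      using inj_on_finite[OF inj sub[OF x] finite_level[OF \<alpha>]] .
    have "real (card (jump_set \<alpha> \<beta> t x)) \<le> real (card (level \<alpha> \<beta> (b * x)))"
      using card_inj_on_le[OF inj sub[OF x] finite_level[OF \<alpha>]] by simp
    also have "\<dots> \<le> C1 * ?g (b * x)" using b x by (intro C1) auto
    also have "\<dots> \<le> C1 * (C2 * ?g x)" using C1 C2 x by (intro mult_left_mono) auto
    finally show "real (card (jump_set \<alpha> \<beta> t x)) \<le> C1 * C2 * ?g x" by simp
  qed (use C1 C2 in simp)
qed

lemma finite_jump_set: "0 \<le> x \<Longrightarrow> finite (jump_set \<alpha> \<beta> t x)"
  using jump_set_upper by metis

text \<open>The constant \<open>D\<close> covers small \<open>x\<close>, below the threshold of the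
  lower count, where monotonicity bounds the growth function.\<close>

lemma jump_set_lower:
  obtains C D where "C > 0" "D \<ge> 0"
    "\<And>x. 0 \<le> x \<Longrightarrow> growth (crit_exp \<alpha>) (total_log_exp \<alpha> \<beta>) x \<le> C * real (card (jump_set \<alpha> \<beta> t x)) + D"
proof -
  let ?g = "growth (crit_exp \<alpha>) (total_log_exp \<alpha> \<beta>)"
  have p0: "0 < crit_exp \<alpha>" using crit_exp_ge_2[of \<alpha>] by linarith
  obtain K1 where K1: "K1 > 0" "\<And>m k. (m, k) \<in> pairs \<Longrightarrow> K1 / pair_weight \<alpha> (m, k) \<le> nweight \<alpha> m (m - (k - 1))"
    by (rule nweight_lower[of \<alpha>]) (use \<alpha> in auto)
  obtain K2 where K2: "K2 > 0" "\<And>m k. (m, k) \<in> pairs \<Longrightarrow> K2 / pair_weight \<beta> (m, k) \<le> nweight \<beta> m (m - (k - 1))"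
    by (rule nweight_lower[of \<beta>]) (use \<alpha> in auto)
  define b where "b = K1 * K2 / t"
  have b: "b > 0" using K1 K2 t by (simp add: b_def)
  obtain c1 where c1: "c1 > 0" "\<And>x. 16 \<le> x \<Longrightarrow> c1 * ?g x \<le> real (card (level \<alpha> \<beta> x))"
    by (rule card_level_lower[OF \<alpha>]) blast
  have "0 < 1 / b" using b by simp
  then obtain C2 where C2: "C2 > 0" "\<And>x. 0 \<le> x \<Longrightarrow> ?g (1 / b * x) \<le> C2 * ?g x"
    using growth_scale p0 by metis
  define f :: "(nat \<times> nat) \<times> (nat \<times> nat) \<Rightarrow> _"
    where "f = (\<lambda>((m, k), (n, l)). ((m - 1, n - 1), (m - (k - 1), n - (l - 1))))"
  have inj: "inj_on f (level \<alpha> \<beta> x)" for x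
    by (rule inj_on_inverseI[where g = "\<lambda>((m, n), (k, l)). ((m + 1, m + 2 - k), (n + 1, n + 2 - l))"])
       (auto simp: f_def level_def pairs_def)
  have sub: "f ` level \<alpha> \<beta> (b * x) \<subseteq> jump_set \<alpha> \<beta> t x" if x: "0 \<le> x" for x
  proof (rule image_subsetI)
    fix q assume "q \<in> level \<alpha> \<beta> (b * x)"
    moreover obtain m k n l where q: "q = ((m, k), (n, l))" by (metis prod.exhaust)
    ultimately have "((m, k), (n, l)) \<in> level \<alpha> \<beta> (b * x)" by simp
    then have p: "(m, k) \<in> pairs" "(n, l) \<in> pairs" and lt: "pair_weight \<alpha> (m, k) * pair_weight \<beta> (n, l) < b * x"
      by (auto simp: level_def)
    have "t < (K1 / pair_weight \<alpha> (m, k)) * (K2 / pair_weight \<beta> (n, l)) * x"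
      using lt pair_weight_pos[OF p(1), of \<alpha>] pair_weight_pos[OF p(2), of \<beta>] t by (simp add: b_def field_simps)
    also have "\<dots> \<le> nweight \<alpha> m (m - (k - 1)) * nweight \<beta> n (n - (l - 1)) * x"
      using x K1 K2 p pair_weight_pos[OF p(2), of \<beta>] nweight_pos[of \<alpha> m] \<alpha>
      by (intro mult_right_mono mult_mono) (auto intro: less_imp_le)
    finally show "f q \<in> jump_set \<alpha> \<beta> t x"
      using p by (auto simp: q f_def jump_set_def pairs_def)
  qed
  show thesis
  proof (rule that[of "C2 / c1" "?g (16 / b)"])
    show "?g (16 / b) \<ge> 0" by (rule growth_nonneg)
    fix x :: real assume x: "0 \<le> x"
    show "?g x \<le> C2 / c1 * real (card (jump_set \<alpha> \<beta> t x)) + ?g (16 / b)"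
    proof (cases "16 \<le> b * x")
      case True
      have "?g x = ?g (1 / b * (b * x))" using b by simp
      also have "\<dots> \<le> C2 * ?g (b * x)" using b x by (intro C2) auto
      also have "\<dots> = C2 / c1 * (c1 * ?g (b * x))" using c1 by simp
      also have "\<dots> \<le> C2 / c1 * real (card (level \<alpha> \<beta> (b * x)))"
        using c1 C2 True by (intro mult_left_mono) auto
      also have "\<dots> \<le> C2 / c1 * real (card (jump_set \<alpha> \<beta> t x))"
        using c1 C2 card_inj_on_le[OF inj sub[OF x] finite_jump_set[OF x]]
        by (intro mult_left_mono) auto
      finally show ?thesis using growth_nonneg[of "crit_exp \<alpha>" "total_log_exp \<alpha> \<beta>" "16 / b"] by linarith
    next
      case False
      then have "x \<le> 16 / b" using b by (simp add: field_simps)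
      then have "?g x \<le> ?g (16 / b)" using x p0 by (intro growth_mono) auto
      moreover have "0 \<le> C2 / c1 * real (card (jump_set \<alpha> \<beta> t x))" using c1 C2 by simp
      ultimately show ?thesis by linarith
    qed
  qed (use c1 C2 in simp)
qed

end

section \<open>Fubini for the tail series\<close>

lemma suminf_suminf_eq_nn_integral:
  fixes f :: "nat \<Rightarrow> nat \<Rightarrow> ennreal"
  shows "(\<Sum>m. \<Sum>n. f m n) = (\<integral>\<^sup>+(m, n). f m n \<partial>count_space UNIV)"
  by (simp add: nn_integral_fst_count_space[symmetric] nn_integral_count_space_nat)

lemma nn_integral_count_space_nat4:
  fixes f :: "(nat \<times> nat) \<times> (nat \<times> nat) \<Rightarrow> ennreal"
  shows "(\<integral>\<^sup>+q. f q \<partial>count_space UNIV) = (\<Sum>m. \<Sum>n. \<Sum>k. \<Sum>l. f ((m, n), (k, l)))"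
  unfolding suminf_suminf_eq_nn_integral
  by (subst nn_integral_fst_count_space[symmetric]) (simp add: case_prod_unfold)

text \<open>The series is the expectation of the cardinality of
  \<open>jump_set \<alpha> \<beta> t \<bar>X\<bar>\<close>. This lies between multiples of the
  growth function up to an additive constant, which is harmless on a probability space.\<close>

lemma (in prob_space) tail_series_finite_iff:
  fixes X :: "'a \<Rightarrow> real" and \<alpha> \<beta> t :: real
  assumes \<alpha>: "0 < \<alpha>" "\<alpha> \<le> \<beta>" "\<beta> \<le> 1" and t: "0 < t" and [measurable]: "X \<in> borel_measurable M"
  shows "(\<Sum>m. \<Sum>n. \<Sum>(k, l)\<in>{..Suc m} \<times> {..Suc n}.
      emeasure M {\<omega> \<in> space M. t < nweight \<alpha> (Suc m) k * nweight \<beta> (Suc n) l * \<bar>X \<omega>\<bar>}) < \<infinity>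
    \<longleftrightarrow> integrable M (\<lambda>\<omega>. growth (crit_exp \<alpha>) (total_log_exp \<alpha> \<beta>) \<bar>X \<omega>\<bar>)"
    (is "?S < \<infinity> \<longleftrightarrow> integrable M (\<lambda>\<omega>. ?g \<bar>X \<omega>\<bar>)")
proof -
  let ?J = "jump_set \<alpha> \<beta> t"
  have [measurable]: "(\<lambda>\<omega>. indicator (?J \<bar>X \<omega>\<bar>) q :: ennreal) \<in> borel_measurable M" for q
  proof -
    obtain m n k l where q: "q = ((m, n), (k, l))" by (metis prod.exhaust)
    have "(\<lambda>\<omega>. indicator (?J \<bar>X \<omega>\<bar>) q :: ennreal) = (\<lambda>\<omega>. if k \<le> Suc m \<and> l \<le> Suc n \<and>
        t < nweight \<alpha> (Suc m) k * nweight \<beta> (Suc n) l * \<bar>X \<omega>\<bar> then 1 else 0)"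
      by (auto simp: q jump_set_def indicator_def)
    then show ?thesis by simp
  qed
  have fin: "finite (?J \<bar>x\<bar>)" for x by (rule finite_jump_set[OF \<alpha> t]) simp
  have "?S = (\<integral>\<^sup>+mn. (\<integral>\<^sup>+kl. (\<integral>\<^sup>+\<omega>. indicator (?J \<bar>X \<omega>\<bar>) (mn, kl) \<partial>M) \<partial>count_space UNIV) \<partial>count_space UNIV)"
    unfolding suminf_suminf_eq_nn_integral
  proof (intro nn_integral_cong, clarify)
    fix m n :: nat
    let ?w = "\<lambda>k l. nweight \<alpha> (Suc m) k * nweight \<beta> (Suc n) l"
    have ind: "(\<integral>\<^sup>+\<omega>. indicator (?J \<bar>X \<omega>\<bar>) ((m, n), (k, l)) \<partial>M)
        = (if k \<le> Suc m \<and> l \<le> Suc n then emeasure M {\<omega> \<in> space M. t < ?w k l * \<bar>X \<omega>\<bar>} else 0)" for k l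
    proof (cases "k \<le> Suc m \<and> l \<le> Suc n")
      case True
      have "(\<integral>\<^sup>+\<omega>. indicator (?J \<bar>X \<omega>\<bar>) ((m, n), (k, l)) \<partial>M)
          = (\<integral>\<^sup>+\<omega>. indicator {\<omega> \<in> space M. t < ?w k l * \<bar>X \<omega>\<bar>} \<omega> \<partial>M)"
        using True by (intro nn_integral_cong) (auto simp: jump_set_def indicator_def)
      then show ?thesis using True by simp
    qed (auto simp: jump_set_def)
    have "(\<integral>\<^sup>+kl. (\<integral>\<^sup>+\<omega>. indicator (?J \<bar>X \<omega>\<bar>) ((m, n), kl) \<partial>M) \<partial>count_space UNIV)
        = (\<Sum>kl\<in>{..Suc m} \<times> {..Suc n}. \<integral>\<^sup>+\<omega>. indicator (?J \<bar>X \<omega>\<bar>) ((m, n), kl) \<partial>M)"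
      by (rule nn_integral_count_space') (auto simp: ind split: if_splits)
    then show "(\<Sum>(k, l)\<in>{..Suc m} \<times> {..Suc n}. emeasure M {\<omega> \<in> space M. t < ?w k l * \<bar>X \<omega>\<bar>})
        = (\<integral>\<^sup>+kl. (\<integral>\<^sup>+\<omega>. indicator (?J \<bar>X \<omega>\<bar>) ((m, n), kl) \<partial>M) \<partial>count_space UNIV)"
      by (auto simp: ind intro!: sum.cong)
  qed
  also have "\<dots> = (\<integral>\<^sup>+q. (\<integral>\<^sup>+\<omega>. indicator (?J \<bar>X \<omega>\<bar>) q \<partial>M) \<partial>count_space UNIV)"
    by (rule nn_integral_fst_count_space)
  also have "\<dots> = (\<integral>\<^sup>+\<omega>. (\<integral>\<^sup>+q. indicator (?J \<bar>X \<omega>\<bar>) q \<partial>count_space UNIV) \<partial>M)"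
    by (rule nn_integral_count_space_nn_integral[symmetric]) auto
  also have "\<dots> = (\<integral>\<^sup>+\<omega>. ennreal (card (?J \<bar>X \<omega>\<bar>)) \<partial>M)"
    using fin by (intro nn_integral_cong) (simp add: ennreal_of_nat_eq_real_of_nat)
  finally have S: "?S = (\<integral>\<^sup>+\<omega>. ennreal (card (?J \<bar>X \<omega>\<bar>)) \<partial>M)" .
  have I: "integrable M (\<lambda>\<omega>. ?g \<bar>X \<omega>\<bar>) \<longleftrightarrow> (\<integral>\<^sup>+\<omega>. ennreal (?g \<bar>X \<omega>\<bar>) \<partial>M) < \<infinity>"
    unfolding integrable_iff_bounded using growth_nonneg[of "crit_exp \<alpha>"] by simp
  obtain C where C: "C > 0" "\<And>x. 0 \<le> x \<Longrightarrow> real (card (?J x)) \<le> C * ?g x"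
    by (rule jump_set_upper[OF \<alpha> t]) blast
  obtain C' D where C': "C' > 0" "D \<ge> 0" "\<And>x. 0 \<le> x \<Longrightarrow> ?g x \<le> C' * real (card (?J x)) + D"
    by (rule jump_set_lower[OF \<alpha> t]) blast
  \<comment> \<open>Measurability of the cardinality of a random set is not immediate; it follows by
    writing it as a countable sum of indicators.\<close>
  have card_meas: "(\<lambda>\<omega>. ennreal (card (?J \<bar>X \<omega>\<bar>))) \<in> borel_measurable M"
  proof -
    have "(\<lambda>\<omega>. ennreal (card (?J \<bar>X \<omega>\<bar>))) = (\<lambda>\<omega>. \<integral>\<^sup>+q. indicator (?J \<bar>X \<omega>\<bar>) q \<partial>count_space UNIV)"
      using fin by (simp add: ennreal_of_nat_eq_real_of_nat)
    also have "\<dots> = (\<lambda>\<omega>. \<Sum>m. \<Sum>n. \<Sum>k. \<Sum>l. indicator (?J \<bar>X \<omega>\<bar>) ((m, n), (k, l)))"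
      unfolding nn_integral_count_space_nat4 ..
    finally show ?thesis by simp
  qed
  show ?thesis
    unfolding S I
  proof
    assume "(\<integral>\<^sup>+\<omega>. ennreal (?g \<bar>X \<omega>\<bar>) \<partial>M) < \<infinity>"
    then have "ennreal C * (\<integral>\<^sup>+\<omega>. ennreal (?g \<bar>X \<omega>\<bar>) \<partial>M) < \<infinity>"
      by (simp add: ennreal_mult_less_top)
    moreover have "(\<integral>\<^sup>+\<omega>. ennreal (card (?J \<bar>X \<omega>\<bar>)) \<partial>M) \<le> (\<integral>\<^sup>+\<omega>. ennreal C * ennreal (?g \<bar>X \<omega>\<bar>) \<partial>M)"
      using C growth_nonneg[of "crit_exp \<alpha>"]
      by (intro nn_integral_mono) (auto simp flip: ennreal_mult intro!: ennreal_leI)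
    ultimately show "(\<integral>\<^sup>+\<omega>. ennreal (card (?J \<bar>X \<omega>\<bar>)) \<partial>M) < \<infinity>"
      by (simp add: nn_integral_cmult le_less_trans)
  next
    assume "(\<integral>\<^sup>+\<omega>. ennreal (card (?J \<bar>X \<omega>\<bar>)) \<partial>M) < \<infinity>"
    then have fin_int: "ennreal C' * (\<integral>\<^sup>+\<omega>. ennreal (card (?J \<bar>X \<omega>\<bar>)) \<partial>M) + ennreal D < \<infinity>"
      by (simp add: ennreal_mult_less_top)
    have "(\<integral>\<^sup>+\<omega>. ennreal (?g \<bar>X \<omega>\<bar>) \<partial>M)
        \<le> (\<integral>\<^sup>+\<omega>. ennreal C' * ennreal (card (?J \<bar>X \<omega>\<bar>)) + ennreal D \<partial>M)"
      using C' by (intro nn_integral_mono) (auto simp flip: ennreal_mult ennreal_plus intro!: ennreal_leI)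
    also have "\<dots> = ennreal C' * (\<integral>\<^sup>+\<omega>. ennreal (card (?J \<bar>X \<omega>\<bar>)) \<partial>M) + ennreal D"
      using card_meas
      by (subst nn_integral_add) (auto simp: nn_integral_cmult[OF card_meas] emeasure_space_1)
    also note fin_int
    finally show "(\<integral>\<^sup>+\<omega>. ennreal (?g \<bar>X \<omega>\<bar>) \<partial>M) < \<infinity>" .
  qed
qed

section \<open>Weighted sums of an i.i.d. array\<close>

lemma inverse_cesaro_le:
  assumes "\<gamma> > 0"
  obtains K where "K > 0" "\<And>m. 1 / cesaro \<gamma> m \<le> K * (real m + 1) powr (- \<gamma>)"
proof -
  obtain c C where cC: "c > 0" "C > 0" "\<And>n. c * (real n + 1) powr \<gamma> \<le> cesaro \<gamma> n" "\<And>n. cesaro \<gamma> n \<le> C * (real n + 1) powr \<gamma>"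
    by (rule cesaro_bounds[of \<gamma>]) (use assms in auto)
  show thesis
  proof (rule that[of "1 / c"])
    fix m
    have "1 / cesaro \<gamma> m \<le> 1 / (c * (real m + 1) powr \<gamma>)"
      using cC cesaro_pos[of \<gamma> m] assms by (intro divide_left_mono) auto
    then show "1 / cesaro \<gamma> m \<le> 1 / c * (real m + 1) powr (- \<gamma>)"
      by (simp add: powr_minus_divide)
  qed (use cC in simp)
qed

text \<open>Since the critical exponent is at least 2, a finite variance comes with every moment
  condition; the constant 1 covers \<open>\<bar>x\<bar> \<le> 1\<close>.\<close>

lemma square_le_growth:
  assumes "2 \<le> p" shows "x\<^sup>2 \<le> 1 + growth p e \<bar>x\<bar>"
proof (cases "\<bar>x\<bar> \<le> 1")
  case True
  then have "x\<^sup>2 \<le> 1" by (simp add: abs_square_le_1)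
  then show ?thesis using growth_nonneg[of p e "\<bar>x\<bar>"] by linarith
next
  case False
  have "x\<^sup>2 = \<bar>x\<bar> powr 2" using False by simp
  also have "\<dots> \<le> \<bar>x\<bar> powr p" using False assms by (intro powr_mono) auto
  also have "\<dots> = \<bar>x\<bar> powr p * 1" by simp
  also have "\<dots> \<le> growth p e \<bar>x\<bar>"
    unfolding growth_def using log_plus_ge_1 by (intro mult_left_mono one_le_power) auto
  finally show ?thesis by simp
qed

context prob_space
begin

lemma integrable_square_if_growth:
  assumes "2 \<le> p" "X \<in> borel_measurable M" "integrable M (\<lambda>\<omega>. growth p e \<bar>X \<omega>\<bar>)"
  shows "integrable M (\<lambda>\<omega>. (X \<omega>)\<^sup>2)"
proof (rule Bochner_Integration.integrable_bound[where f = "\<lambda>\<omega>. 1 + growth p e \<bar>X \<omega>\<bar>"])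
  have "(X \<omega>)\<^sup>2 \<le> \<bar>1 + growth p e \<bar>X \<omega>\<bar>\<bar>" for \<omega>
    using square_le_growth[OF assms(1), of "X \<omega>" e] growth_nonneg[of p e "\<bar>X \<omega>\<bar>"] by linarith
  then show "AE \<omega> in M. norm ((X \<omega>)\<^sup>2) \<le> norm (1 + growth p e \<bar>X \<omega>\<bar>)" by simp
qed (use assms in auto)

lemma integrable_growth_shift:
  fixes X :: "'a \<Rightarrow> real"
  assumes p: "0 < p" and X[measurable]: "X \<in> borel_measurable M" and int: "integrable M (\<lambda>\<omega>. growth p e \<bar>X \<omega>\<bar>)"
  shows "integrable M (\<lambda>\<omega>. growth p e \<bar>X \<omega> - c\<bar>)"
proof -
  obtain C where C: "C > 0" "\<And>x. 0 \<le> x \<Longrightarrow> growth p e (2 * x) \<le> C * growth p e x"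
    by (rule growth_scale[of 2 p e]) (use p in auto)
  show ?thesis
  proof (rule Bochner_Integration.integrable_bound[where f = "\<lambda>\<omega>. C * growth p e \<bar>X \<omega>\<bar> + C * growth p e \<bar>c\<bar>"])
    have "growth p e \<bar>X \<omega> - c\<bar> \<le> C * growth p e \<bar>X \<omega>\<bar> + C * growth p e \<bar>c\<bar>" for \<omega>
    proof -
      have "growth p e \<bar>X \<omega> - c\<bar> \<le> growth p e (2 * max \<bar>X \<omega>\<bar> \<bar>c\<bar>)"
        using p by (intro growth_mono) auto
      also have "\<dots> \<le> growth p e (2 * \<bar>X \<omega>\<bar>) + growth p e (2 * \<bar>c\<bar>)"
        using growth_nonneg[of p e "2 * \<bar>X \<omega>\<bar>"] growth_nonneg[of p e "2 * \<bar>c\<bar>"] by (simp add: max_def)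
      also have "\<dots> \<le> C * growth p e \<bar>X \<omega>\<bar> + C * growth p e \<bar>c\<bar>"
        by (intro add_mono C) auto
      finally show ?thesis .
    qed
    moreover have "0 \<le> C * growth p e \<bar>X \<omega>\<bar> + C * growth p e \<bar>c\<bar>" for \<omega>
      using C growth_nonneg[of p e] by simp
    ultimately show "AE \<omega> in M. norm (growth p e \<bar>X \<omega> - c\<bar>) \<le> norm (C * growth p e \<bar>X \<omega>\<bar> + C * growth p e \<bar>c\<bar>)"
      using growth_nonneg[of p e] by simp
  qed (use int in auto)
qed

lemma exists_tail_prob_le:
  fixes X :: "'a \<Rightarrow> real"
  assumes [measurable]: "X \<in> borel_measurable M" and "0 < d"
  obtains K where "K > 0" "prob {\<omega> \<in> space M. \<bar>X \<omega>\<bar> > K} \<le> d"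
proof -
  let ?A = "\<lambda>n::nat. {\<omega> \<in> space M. \<bar>X \<omega>\<bar> > real n}"
  have "(\<lambda>n. prob (?A n)) \<longlonglongrightarrow> prob (\<Inter>n. ?A n)"
    by (intro finite_Lim_measure_decseq) (auto simp: decseq_def)
  moreover have "(\<Inter>n. ?A n) = {}"
    by (auto, metis reals_Archimedean2 less_asym)
  ultimately have "(\<lambda>n. prob (?A n)) \<longlonglongrightarrow> 0" by simp
  then have "eventually (\<lambda>n. prob (?A n) < d) sequentially"
    using \<open>0 < d\<close> by (rule order_tendstoD)
  then have "eventually (\<lambda>n. prob (?A n) < d \<and> n > 0) sequentially"
    using eventually_gt_at_top[of 0] by eventually_elim simp
  then obtain n where "prob (?A n) < d" "n > 0"
    by (auto simp: eventually_sequentially)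
  then show thesis using that[of "real n"] by simp
qed

end

section \<open>The array and its normalised sums\<close>

locale iid_array = prob_space M for M :: "'a measure" +
  fixes X :: "'a \<Rightarrow> real" and Y :: "nat \<times> nat \<Rightarrow> 'a \<Rightarrow> real" and \<alpha> \<beta> :: real
  assumes \<alpha>: "0 < \<alpha>" "\<alpha> \<le> \<beta>" "\<beta> \<le> 1"
    and X_meas [measurable]: "X \<in> borel_measurable M"
    and indep: "indep_vars (\<lambda>_. borel) Y UNIV"
    and distr_eq: "distr M borel (Y i) = distr M borel X"
begin

abbreviation moment :: "real \<Rightarrow> real" where
  "moment \<equiv> growth (crit_exp \<alpha>) (total_log_exp \<alpha> \<beta>)"

definition W :: "nat \<Rightarrow> nat \<Rightarrow> nat \<times> nat \<Rightarrow> real" where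
  "W m n = (\<lambda>(k, l). nweight \<alpha> m k * nweight \<beta> n l)"

definition S :: "nat \<Rightarrow> nat \<Rightarrow> 'a \<Rightarrow> real" where
  "S m n \<omega> = (\<Sum>i\<in>{..m} \<times> {..n}. W m n i * Y i \<omega>)"

lemma Y_meas [measurable]: "Y i \<in> borel_measurable M"
  using indep by (simp add: indep_vars_def del: split_paired_All)

lemma S_meas [measurable]: "S m n \<in> borel_measurable M"
  unfolding S_def by measurable

lemma \<beta>: "0 < \<beta>" "\<alpha> \<le> 1"
  using \<alpha> by auto

lemma W_pos: "0 < W m n i"
  using nweight_pos \<alpha> \<beta> by (auto simp: W_def case_prod_beta)

lemma W_le: "W m n i \<le> 1 / (cesaro \<alpha> m * cesaro \<beta> n)"
proof -
  have "nweight \<alpha> m (fst i) * nweight \<beta> n (snd i) \<le> (1 / cesaro \<alpha> m) * (1 / cesaro \<beta> n)"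
    using nweight_pos[of \<alpha> m] nweight_pos[of \<beta> n] \<alpha> \<beta> cesaro_pos[of \<alpha> m]
    by (intro mult_mono nweight_le) (auto intro: less_imp_le)
  then show ?thesis by (simp add: W_def case_prod_beta)
qed

lemma sum_W: "(\<Sum>i\<in>{..m} \<times> {..n}. W m n i) = 1"
proof -
  have "(\<Sum>i\<in>{..m} \<times> {..n}. W m n i) = (\<Sum>k\<le>m. nweight \<alpha> m k) * (\<Sum>l\<le>n. nweight \<beta> n l)"
    by (simp add: sum_product sum.cartesian_product W_def)
  then show ?thesis using sum_nweight \<alpha> \<beta> by simp
qed

lemma prob_Y: "B \<in> sets borel \<Longrightarrow> prob {\<omega> \<in> space M. Y i \<omega> \<in> B} = prob {\<omega> \<in> space M. X \<omega> \<in> B}"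
  using measure_distr[of "Y i" M borel B] measure_distr[of X M borel B] distr_eq[of i]
  by (simp add: vimage_def Int_def conj_commute)

lemma integrable_Y: "f \<in> borel_measurable borel \<Longrightarrow> integrable M (\<lambda>\<omega>. f (Y i \<omega>) :: real) \<longleftrightarrow> integrable M (\<lambda>\<omega>. f (X \<omega>))"
  using integrable_distr_eq[of "Y i" M borel f] integrable_distr_eq[of X M borel f] distr_eq[of i] by simp

lemma expectation_Y: "f \<in> borel_measurable borel \<Longrightarrow> expectation (\<lambda>\<omega>. f (Y i \<omega>) :: real) = expectation (\<lambda>\<omega>. f (X \<omega>))"
  using integral_distr[of "Y i" M borel f] integral_distr[of X M borel f] distr_eq[of i] by simp

lemma indep_affine: "indep_vars (\<lambda>_. borel) (\<lambda>i \<omega>. W m n i * (Y i \<omega> - c)) ({..m} \<times> {..n})"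
  by (rule indep_vars_compose2[OF indep_vars_subset[OF indep]]) auto

lemma prob_W_Y:
  "prob {\<omega> \<in> space M. \<bar>W m n i * (Y i \<omega> - c)\<bar> > t} = prob {\<omega> \<in> space M. t < W m n i * \<bar>X \<omega> - c\<bar>}"
proof -
  have "prob {\<omega> \<in> space M. Y i \<omega> \<in> {y. t < W m n i * \<bar>y - c\<bar>}} = prob {\<omega> \<in> space M. X \<omega> \<in> {y. t < W m n i * \<bar>y - c\<bar>}}"
    by (rule prob_Y) measurable
  then show ?thesis using W_pos[of m n i] by (simp add: abs_mult)
qed

lemma moments_imp_series:
  assumes mom: "integrable M (\<lambda>\<omega>. moment \<bar>X \<omega>\<bar>)" and \<epsilon>: "\<epsilon> > 0"
  shows "(\<Sum>m. \<Sum>n. emeasure M {\<omega> \<in> space M. \<bar>S (Suc m) (Suc n) \<omega> - expectation X\<bar> > \<epsilon>}) < \<infinity>"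
proof -
  define c where "c = expectation X"
  define X0 where "X0 = (\<lambda>\<omega>. X \<omega> - c)"
  have X0_meas[measurable]: "X0 \<in> borel_measurable M" unfolding X0_def by measurable
  have mom0: "integrable M (\<lambda>\<omega>. moment \<bar>X0 \<omega>\<bar>)"
    unfolding X0_def using crit_exp_ge_2[of \<alpha>] mom by (intro integrable_growth_shift) auto
  have sq0: "integrable M (\<lambda>\<omega>. (X0 \<omega>)\<^sup>2)"
    by (rule integrable_square_if_growth[OF crit_exp_ge_2 X0_meas mom0])
  have int0: "integrable M X0"
    using square_integrable_imp_integrable[OF X0_meas sq0] .
  have "integrable M (\<lambda>\<omega>. X0 \<omega> + c)" using int0 by simp
  then have intX: "integrable M X" by (simp add: X0_def)
  have mean0: "expectation X0 = 0"
    unfolding X0_def using intX by (simp add: c_def prob_space)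
  \<comment> \<open>With this \<open>r\<close> the power \<open>r\<close> of the variance bound
    decays at least like \<open>m powr (-2) * n powr (-2)\<close>, which is summable.\<close>
  obtain r :: nat where r: "2 / \<alpha> \<le> real r" using real_arch_simple by blast
  have r_pos: "0 < real r" using r \<alpha> by (smt (verit) divide_pos_pos)
  have r2: "2 \<le> \<alpha> * real r" "2 \<le> \<beta> * real r"
  proof -
    show "2 \<le> \<alpha> * real r" using r \<alpha> by (simp add: field_simps)
    also have "\<dots> \<le> \<beta> * real r" using \<alpha> by (intro mult_right_mono) auto
    finally show "2 \<le> \<beta> * real r" .
  qed
  define \<delta> where "\<delta> = \<epsilon> / (2 * real r)"
  have \<delta>: "\<delta> > 0" "2 * real r * \<delta> = \<epsilon>" using \<epsilon> r_pos by (auto simp: \<delta>_def)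
  \<comment> \<open>The added 1 keeps the variance bound positive when \<open>X\<close> is almost
    surely constant.\<close>
  define \<sigma> where "\<sigma> = expectation (\<lambda>\<omega>. (X0 \<omega>)\<^sup>2) + 1"
  have \<sigma>: "\<sigma> > 0" unfolding \<sigma>_def by (intro add_nonneg_pos integral_nonneg_AE) auto
  define V where "V = (\<lambda>m n. \<sigma> / (cesaro \<alpha> m * cesaro \<beta> n))"
  have V: "V m n > 0" for m n
    using \<sigma> cesaro_pos[of \<alpha> m] cesaro_pos[of \<beta> n] \<alpha> \<beta> by (simp add: V_def)
  have bound: "prob {\<omega> \<in> space M. \<bar>S m n \<omega> - c\<bar> > \<epsilon>}
      \<le> 2 * (\<Sum>i\<in>{..m} \<times> {..n}. prob {\<omega> \<in> space M. \<delta> < W m n i * \<bar>X0 \<omega>\<bar>}) + 2 * exp 2 * (V m n / \<delta>\<^sup>2) ^ r" for m n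
  proof -
    let ?I = "{..m} \<times> {..n}" and ?Z = "\<lambda>i \<omega>. W m n i * (Y i \<omega> - c)"
    have "S m n \<omega> - c = (\<Sum>i\<in>?I. ?Z i \<omega>)" for \<omega>
      by (simp add: S_def right_diff_distrib sum_subtractf sum_W flip: sum_distrib_right)
    moreover have "prob {\<omega> \<in> space M. \<bar>\<Sum>i\<in>?I. ?Z i \<omega>\<bar> > 2 * real r * \<delta>}
        \<le> 2 * (\<Sum>i\<in>?I. prob {\<omega> \<in> space M. \<bar>?Z i \<omega>\<bar> > \<delta>}) + 2 * exp 2 * (V m n / \<delta>\<^sup>2) ^ r"
    proof (rule prob_abs_sum_gt_le[OF _ indep_affine])
      fix i
      have 1: "integrable M (\<lambda>\<omega>. Y i \<omega> - c)"
        using integrable_Y[of "\<lambda>x. x - c" i] int0 by (simp add: X0_def)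
      then show "integrable M (?Z i)" by simp
      have 2: "integrable M (\<lambda>\<omega>. (Y i \<omega> - c)\<^sup>2)"
        using integrable_Y[of "\<lambda>x. (x - c)\<^sup>2" i] sq0 by (simp add: X0_def)
      then show "integrable M (\<lambda>\<omega>. (?Z i \<omega>)\<^sup>2)" by (simp add: power_mult_distrib)
      have "expectation (\<lambda>\<omega>. Y i \<omega> - c) = 0"
        using expectation_Y[of "\<lambda>x. x - c" i] mean0 by (simp add: X0_def)
      then show "expectation (?Z i) = 0" by simp
    next
      have "expectation (\<lambda>\<omega>. (?Z i \<omega>)\<^sup>2) = (W m n i)\<^sup>2 * (\<sigma> - 1)" for i
        using expectation_Y[of "\<lambda>x. (x - c)\<^sup>2" i] by (simp add: power_mult_distrib \<sigma>_def X0_def)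
      \<comment> \<open>One factor \<open>W\<close> is bounded by its maximum and the other is left
        to be summed to 1, so the variance of the whole sum is at most \<open>V m n\<close>.\<close>
      moreover have "(W m n i)\<^sup>2 * (\<sigma> - 1) \<le> W m n i * V m n" for i
      proof -
        have "(W m n i)\<^sup>2 * (\<sigma> - 1) \<le> (W m n i)\<^sup>2 * \<sigma>" by (intro mult_left_mono) auto
        also have "\<dots> = W m n i * (\<sigma> * W m n i)" by (simp add: power2_eq_square mult_ac)
        also have "\<dots> \<le> W m n i * (\<sigma> * (1 / (cesaro \<alpha> m * cesaro \<beta> n)))"
          using W_pos[of m n i] \<sigma> by (intro mult_left_mono W_le) auto
        finally show ?thesis by (simp add: V_def)
      qed
      ultimately have "(\<Sum>i\<in>?I. expectation (\<lambda>\<omega>. (?Z i \<omega>)\<^sup>2)) \<le> (\<Sum>i\<in>?I. W m n i * V m n)"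
        by (intro sum_mono) simp
      also have "\<dots> = V m n" by (simp add: sum_W flip: sum_distrib_right)
      finally show "(\<Sum>i\<in>?I. expectation (\<lambda>\<omega>. (?Z i \<omega>)\<^sup>2)) \<le> V m n" .
    qed (use V \<delta> in auto)
    ultimately show ?thesis by (simp add: \<delta> prob_W_Y X0_def)
  qed
  obtain K1 where K1: "K1 > 0" "\<And>m. 1 / cesaro \<alpha> m \<le> K1 * (real m + 1) powr (- \<alpha>)"
    by (rule inverse_cesaro_le[OF \<alpha>(1)]) blast
  obtain K2 where K2: "K2 > 0" "\<And>m. 1 / cesaro \<beta> m \<le> K2 * (real m + 1) powr (- \<beta>)"
    by (rule inverse_cesaro_le[OF \<beta>(1)]) blast
  have pow: "(1 / cesaro \<gamma> (Suc m)) ^ r \<le> K ^ r * (real m + 1) powr (- 2)"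
    if "\<gamma> > 0" "K > 0" "\<And>m. 1 / cesaro \<gamma> m \<le> K * (real m + 1) powr (- \<gamma>)" "2 \<le> \<gamma> * real r" for \<gamma> K m
  proof -
    have "(1 / cesaro \<gamma> (Suc m)) ^ r \<le> (K * (real (Suc m) + 1) powr (- \<gamma>)) ^ r"
      using that(3)[of "Suc m"] that(1) cesaro_pos[of \<gamma> "Suc m"] by (intro power_mono) auto
    also have "\<dots> = K ^ r * (real (Suc m) + 1) powr (- (\<gamma> * real r))"
      by (simp add: power_mult_distrib powr_power mult.commute)
    also have "(real (Suc m) + 1) powr (- (\<gamma> * real r)) \<le> (real (Suc m) + 1) powr (- 2)"
      using that by (intro powr_mono) auto
    also have "\<dots> \<le> (real m + 1) powr (- 2)"
      by (intro powr_mono2') auto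
    finally show ?thesis using that by simp
  qed
  define D where "D = 2 * exp 2 * (\<sigma> / \<delta>\<^sup>2) ^ r * (K1 ^ r * K2 ^ r)"
  have D0: "D \<ge> 0" using \<sigma> K1 K2 by (simp add: D_def)
  have second: "2 * exp 2 * (V (Suc m) (Suc n) / \<delta>\<^sup>2) ^ r \<le> D * real (Suc m) powr (- 2) * real (Suc n) powr (- 2)" for m n
  proof -
    have "(1 / cesaro \<alpha> (Suc m)) ^ r * (1 / cesaro \<beta> (Suc n)) ^ r
        \<le> (K1 ^ r * (real m + 1) powr (- 2)) * (K2 ^ r * (real n + 1) powr (- 2))"
      using \<alpha> \<beta> K1 K2 r2 cesaro_pos[of \<beta> "Suc n"] by (intro mult_mono pow) auto
    then have "2 * exp 2 * (\<sigma> / \<delta>\<^sup>2) ^ r * ((1 / cesaro \<alpha> (Suc m)) ^ r * (1 / cesaro \<beta> (Suc n)) ^ r)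
        \<le> 2 * exp 2 * (\<sigma> / \<delta>\<^sup>2) ^ r * ((K1 ^ r * (real m + 1) powr (- 2)) * (K2 ^ r * (real n + 1) powr (- 2)))"
      using \<sigma> by (intro mult_left_mono) auto
    moreover have "V (Suc m) (Suc n) / \<delta>\<^sup>2 = \<sigma> / \<delta>\<^sup>2 * (1 / cesaro \<alpha> (Suc m) * (1 / cesaro \<beta> (Suc n)))"
      by (simp add: V_def)
    ultimately show ?thesis by (simp only: power_mult_distrib D_def) (simp add: mult_ac add_ac)
  qed
  let ?a = "\<lambda>m n. \<Sum>(k, l)\<in>{..Suc m} \<times> {..Suc n}.
      emeasure M {\<omega> \<in> space M. \<delta> < nweight \<alpha> (Suc m) k * nweight \<beta> (Suc n) l * \<bar>X0 \<omega>\<bar>}"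
  let ?b = "\<lambda>m n. ennreal (D * real (Suc m) powr (- 2)) * ennreal (real (Suc n) powr (- 2))"
  have le: "emeasure M {\<omega> \<in> space M. \<bar>S (Suc m) (Suc n) \<omega> - c\<bar> > \<epsilon>} \<le> 2 * ?a m n + ?b m n" for m n
  proof -
    let ?I = "{..Suc m} \<times> {..Suc n}"
    have a: "?a m n = ennreal (\<Sum>i\<in>?I. prob {\<omega> \<in> space M. \<delta> < W (Suc m) (Suc n) i * \<bar>X0 \<omega>\<bar>})"
      by (simp add: W_def emeasure_eq_measure case_prod_unfold flip: sum_ennreal)
    have "emeasure M {\<omega> \<in> space M. \<bar>S (Suc m) (Suc n) \<omega> - c\<bar> > \<epsilon>}
        \<le> ennreal (2 * (\<Sum>i\<in>?I. prob {\<omega> \<in> space M. \<delta> < W (Suc m) (Suc n) i * \<bar>X0 \<omega>\<bar>})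
           + D * real (Suc m) powr (- 2) * real (Suc n) powr (- 2))"
      unfolding emeasure_eq_measure using bound[of "Suc m" "Suc n"] second[of m n] by (intro ennreal_leI) linarith
    also have "\<dots> = 2 * ?a m n + ?b m n"
    proof -
      have s: "0 \<le> (\<Sum>i\<in>?I. prob {\<omega> \<in> space M. \<delta> < W (Suc m) (Suc n) i * \<bar>X0 \<omega>\<bar>})" (is "0 \<le> ?s")
        by (intro sum_nonneg) simp
      have "ennreal (2 * ?s + D * real (Suc m) powr (- 2) * real (Suc n) powr (- 2))
          = ennreal (2 * ?s) + ennreal (D * real (Suc m) powr (- 2) * real (Suc n) powr (- 2))"
        using D0 s by (intro ennreal_plus) auto
      also have "ennreal (2 * ?s) = ennreal 2 * ennreal ?s"
        using s by (intro ennreal_mult) auto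
      also have "ennreal (D * real (Suc m) powr (- 2) * real (Suc n) powr (- 2)) = ?b m n"
        using D0 by (intro ennreal_mult) auto
      finally show ?thesis unfolding a by simp
    qed
    finally show ?thesis .
  qed
  have "(\<Sum>m. \<Sum>n. ?a m n) < \<infinity>"
    using tail_series_finite_iff[OF \<alpha> \<delta>(1) X0_meas] mom0 by simp
  moreover have "(\<Sum>m. \<Sum>n. ?b m n) < \<infinity>"
  proof -
    have "summable (\<lambda>n. real (Suc n) powr (- 2))"
      by (subst summable_Suc_iff) (simp add: summable_real_powr_iff)
    then have s: "(\<Sum>n. ennreal (real (Suc n) powr (- 2))) < \<infinity>"
      by (simp add: suminf_ennreal2)
    have "(\<Sum>m. \<Sum>n. ?b m n) = (\<Sum>m. ennreal D * ennreal (real (Suc m) powr (- 2))) * (\<Sum>n. ennreal (real (Suc n) powr (- 2)))"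
      using D0 by (simp add: ennreal_mult)
    also have "\<dots> = ennreal D * (\<Sum>n. ennreal (real (Suc n) powr (- 2))) * (\<Sum>n. ennreal (real (Suc n) powr (- 2)))"
      by simp
    also have "\<dots> < \<infinity>" using s by (simp add: ennreal_mult_less_top)
    finally show ?thesis .
  qed
  moreover have "(\<Sum>m. \<Sum>n. emeasure M {\<omega> \<in> space M. \<bar>S (Suc m) (Suc n) \<omega> - c\<bar> > \<epsilon>})
      \<le> 2 * (\<Sum>m. \<Sum>n. ?a m n) + (\<Sum>m. \<Sum>n. ?b m n)"
  proof -
    have "(\<Sum>m. \<Sum>n. emeasure M {\<omega> \<in> space M. \<bar>S (Suc m) (Suc n) \<omega> - c\<bar> > \<epsilon>}) \<le> (\<Sum>m. \<Sum>n. 2 * ?a m n + ?b m n)"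
      by (intro suminf_le le) auto
    also have "\<dots> = 2 * (\<Sum>m. \<Sum>n. ?a m n) + (\<Sum>m. \<Sum>n. ?b m n)"
      by (simp only: suminf_add[symmetric] summableI ennreal_suminf_cmult)
    finally show ?thesis .
  qed
  ultimately show ?thesis
    unfolding c_def by (simp add: ennreal_mult_less_top le_less_trans)
qed

text \<open>Outside a finite set of indices the jump inequality gives \<open>g \<le> 4 * f\<close>;
  on the finite set \<open>g\<close> is finite anyway. Hence the tail series at the threshold
  \<open>3 = 3 * 1\<close> converges, and any positive threshold yields the same moment
  condition.\<close>

lemma series_imp_moments:
  assumes ser: "(\<Sum>m. \<Sum>n. emeasure M {\<omega> \<in> space M. \<bar>S (Suc m) (Suc n) \<omega> - \<mu>\<bar> > 1}) < \<infinity>"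
  shows "integrable M (\<lambda>\<omega>. moment \<bar>X \<omega>\<bar>)"
proof -
  define f where "f = (\<lambda>(m, n). emeasure M {\<omega> \<in> space M. \<bar>S (Suc m) (Suc n) \<omega> - \<mu>\<bar> > 1})"
  define g where "g = (\<lambda>(m, n). \<Sum>(k, l)\<in>{..Suc m} \<times> {..Suc n}.
      emeasure M {\<omega> \<in> space M. 3 < nweight \<alpha> (Suc m) k * nweight \<beta> (Suc n) l * \<bar>X \<omega>\<bar>})"
  have f_int: "(\<integral>\<^sup>+q. f q \<partial>count_space UNIV) < \<infinity>"
    using ser unfolding suminf_suminf_eq_nn_integral f_def .
  \<comment> \<open>The indices whose probability is at least 1/16; Markov's inequality for the
    counting measure makes them finitely many.\<close>
  define F1 where "F1 = {q. 1 \<le> ennreal 16 * f q}"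
  have F1: "finite F1"
  proof -
    have "emeasure (count_space UNIV) {q \<in> UNIV. 1 \<le> ennreal 16 * f q} \<le> ennreal 16 * (\<integral>\<^sup>+q. f q * indicator UNIV q \<partial>count_space UNIV)"
      by (rule nn_integral_Markov_inequality) auto
    also have "\<dots> < \<infinity>" using f_int by (simp add: ennreal_mult_less_top)
    finally have "emeasure (count_space UNIV) F1 < \<infinity>" by (simp add: F1_def)
    then show ?thesis by (auto simp: emeasure_count_space split: if_splits)
  qed
  \<comment> \<open>By \<open>W_le\<close> a summand can exceed 1 only if
    \<open>\<bar>X\<bar>\<close> exceeds the product of the two Cesaro numbers. Once that product
    reaches \<open>K\<close>, each summand does so with probability at most 1/8; the product is
    smaller only on the finite set \<open>F2\<close>.\<close>
  obtain K where K: "K > 0" "prob {\<omega> \<in> space M. \<bar>X \<omega>\<bar> > K} \<le> 1 / 8"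
    by (rule exists_tail_prob_le[OF X_meas, of "1 / 8"]) auto
  define F2 where "F2 = {(m, n). cesaro \<alpha> (Suc m) * cesaro \<beta> (Suc n) < K}"
  have F2: "finite F2"
  proof -
    obtain c1 C1 where c1: "c1 > 0" "C1 > 0" "\<And>n. c1 * (real n + 1) powr \<alpha> \<le> cesaro \<alpha> n" "\<And>n. cesaro \<alpha> n \<le> C1 * (real n + 1) powr \<alpha>"
      by (rule cesaro_bounds[of \<alpha>]) (use \<alpha> in auto)
    obtain c2 C2 where c2: "c2 > 0" "C2 > 0" "\<And>n. c2 * (real n + 1) powr \<beta> \<le> cesaro \<beta> n" "\<And>n. cesaro \<beta> n \<le> C2 * (real n + 1) powr \<beta>"
      by (rule cesaro_bounds[of \<beta>]) (use \<beta> in auto)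
    define L where "L = K / (c1 * c2)"
    have L: "c1 * c2 * L = K" using c1 c2 by (simp add: L_def)
    have "F2 \<subseteq> {..nat \<lfloor>L powr (1 / \<alpha>)\<rfloor>} \<times> {..nat \<lfloor>L powr (1 / \<beta>)\<rfloor>}"
    proof (rule subsetI)
      fix q assume "q \<in> F2"
      then obtain m n where q: "q = (m, n)" "cesaro \<alpha> (Suc m) * cesaro \<beta> (Suc n) < K" by (auto simp: F2_def)
      let ?x = "(real (Suc m) + 1) powr \<alpha>" and ?y = "(real (Suc n) + 1) powr \<beta>"
      have xy: "1 \<le> ?x" "1 \<le> ?y" using \<alpha> \<beta> by (auto intro!: ge_one_powr_ge_zero)
      have "(c1 * ?x) * (c2 * ?y) \<le> cesaro \<alpha> (Suc m) * cesaro \<beta> (Suc n)"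
        using c1(1) c2(1) cesaro_pos[of \<alpha> "Suc m"] \<alpha> by (intro mult_mono c1(3) c2(3)) auto
      then have "c1 * c2 * (?x * ?y) < c1 * c2 * L" using q L by (simp add: mult_ac)
      then have xyL: "?x * ?y < L" using c1 c2 by (simp add: mult_less_cancel_left_pos)
      have "?x * 1 \<le> ?x * ?y" "1 * ?y \<le> ?x * ?y" using xy by (intro mult_mono; simp)+
      then have "?x < L" "?y < L" using xyL by linarith+
      then have "real (Suc m) + 1 < L powr (1 / \<alpha>)" "real (Suc n) + 1 < L powr (1 / \<beta>)"
        using \<alpha> \<beta> by (auto intro!: less_powr_if_powr_less)
      then show "q \<in> {..nat \<lfloor>L powr (1 / \<alpha>)\<rfloor>} \<times> {..nat \<lfloor>L powr (1 / \<beta>)\<rfloor>}"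
        by (auto simp: q intro!: le_nat_floor)
    qed
    then show ?thesis by (rule finite_subset) auto
  qed
  have g_fin: "g q < \<infinity>" for q
    by (auto simp: g_def case_prod_unfold emeasure_eq_measure)
  have le: "g q \<le> 4 * f q + g q * indicator (F1 \<union> F2) q" for q
  proof (cases "q \<in> F1 \<union> F2")
    case False
    obtain m n where q: "q = (m, n)" by (cases q)
    let ?I = "{..Suc m} \<times> {..Suc n}" and ?W = "W (Suc m) (Suc n)"
    let ?p = "prob {\<omega> \<in> space M. \<bar>S (Suc m) (Suc n) \<omega> - \<mu>\<bar> > 1}"
    have f: "f q = ennreal ?p" by (simp add: f_def q emeasure_eq_measure)
    have "\<not> 1 \<le> ennreal 16 * f q" using False by (simp add: F1_def)
    then have "ennreal (16 * ?p) < ennreal 1" unfolding f by (simp add: ennreal_mult not_le)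
    then have p: "?p \<le> 1 / 16" by (subst (asm) ennreal_less_iff) auto
    have N: "K \<le> cesaro \<alpha> (Suc m) * cesaro \<beta> (Suc n)" using False by (simp add: F2_def q not_less)
    \<comment> \<open>Subtracting 0 brings the summands into the form of \<open>indep_affine\<close>
      and \<open>prob_W_Y\<close> with \<open>c = 0\<close>.\<close>
    have SZ: "S (Suc m) (Suc n) \<omega> = (\<Sum>i\<in>?I. ?W i * (Y i \<omega> - 0))" for \<omega>
      by (simp add: S_def)
    have small: "prob {\<omega> \<in> space M. \<bar>?W i * (Y i \<omega> - 0)\<bar> > 1} \<le> 1 / 8" for i
    proof -
      have "prob {\<omega> \<in> space M. 1 < ?W i * \<bar>X \<omega> - 0\<bar>} \<le> prob {\<omega> \<in> space M. \<bar>X \<omega>\<bar> > K}"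
      proof (intro finite_measure_mono subsetI)
        fix \<omega> assume \<omega>: "\<omega> \<in> {\<omega> \<in> space M. 1 < ?W i * \<bar>X \<omega> - 0\<bar>}"
        have "?W i * \<bar>X \<omega>\<bar> \<le> 1 / (cesaro \<alpha> (Suc m) * cesaro \<beta> (Suc n)) * \<bar>X \<omega>\<bar>"
          by (intro mult_right_mono W_le) auto
        also have "\<dots> \<le> 1 / K * \<bar>X \<omega>\<bar>"
          using N K by (intro mult_right_mono divide_left_mono) auto
        finally have "1 < \<bar>X \<omega>\<bar> / K" using \<omega> by simp
        then show "\<omega> \<in> {\<omega> \<in> space M. \<bar>X \<omega>\<bar> > K}" using \<omega> K by (simp add: field_simps)
      qed measurable
      then show ?thesis using K unfolding prob_W_Y by linarith
    qed
    have "(\<Sum>i\<in>?I. prob {\<omega> \<in> space M. \<bar>?W i * (Y i \<omega> - 0)\<bar> > 3 * 1}) \<le> 4 * ?p"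
      unfolding SZ using p small
      by (intro sum_prob_large_le indep_affine) (auto simp: SZ)
    then have "(\<Sum>i\<in>?I. prob {\<omega> \<in> space M. 3 < ?W i * \<bar>X \<omega>\<bar>}) \<le> 4 * ?p"
      unfolding prob_W_Y by simp
    moreover have "g q = ennreal (\<Sum>i\<in>?I. prob {\<omega> \<in> space M. 3 < ?W i * \<bar>X \<omega>\<bar>})"
      by (simp add: q g_def W_def emeasure_eq_measure case_prod_unfold flip: sum_ennreal)
    ultimately have "g q \<le> ennreal (4 * ?p)" by (simp only: ennreal_leI)
    also have "\<dots> = 4 * f q" by (simp add: f ennreal_mult)
    finally show ?thesis using False by simp
  qed (simp add: add_increasing)
  have "(\<integral>\<^sup>+q. g q \<partial>count_space UNIV) \<le> (\<integral>\<^sup>+q. 4 * f q + g q * indicator (F1 \<union> F2) q \<partial>count_space UNIV)"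
    by (intro nn_integral_mono le)
  also have "\<dots> = 4 * (\<integral>\<^sup>+q. f q \<partial>count_space UNIV) + (\<integral>\<^sup>+q. g q * indicator (F1 \<union> F2) q \<partial>count_space UNIV)"
    by (simp add: nn_integral_add nn_integral_cmult)
  also have "(\<integral>\<^sup>+q. g q * indicator (F1 \<union> F2) q \<partial>count_space UNIV) = (\<Sum>q\<in>F1 \<union> F2. g q * indicator (F1 \<union> F2) q)"
    using F1 F2 by (intro nn_integral_count_space') auto
  also have "\<dots> = (\<Sum>q\<in>F1 \<union> F2. g q)"
    by (intro sum.cong) auto
  also have "4 * (\<integral>\<^sup>+q. f q \<partial>count_space UNIV) + (\<Sum>q\<in>F1 \<union> F2. g q) < \<infinity>"
    using f_int g_fin F1 F2 by (simp add: ennreal_mult_less_top)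
  finally have "(\<integral>\<^sup>+q. g q \<partial>count_space UNIV) < \<infinity>" .
  then show ?thesis
    using tail_series_finite_iff[OF \<alpha> _ X_meas, of 3]
    unfolding suminf_suminf_eq_nn_integral g_def by simp
qed

text \<open>Otherwise the sums would concentrate both at \<mu> and at the true mean. The two
  deviation events for a third of the distance cover the space, so every index contributes at least
  1 to the sum of two convergent series.\<close>

lemma series_imp_mean:
  assumes ser: "\<And>\<epsilon>. \<epsilon> > 0 \<Longrightarrow> (\<Sum>m. \<Sum>n. emeasure M {\<omega> \<in> space M. \<bar>S (Suc m) (Suc n) \<omega> - \<mu>\<bar> > \<epsilon>}) < \<infinity>"
  shows "expectation X = \<mu>"
proof (rule ccontr)
  assume ne: "expectation X \<noteq> \<mu>"
  define \<epsilon> where "\<epsilon> = \<bar>expectation X - \<mu>\<bar> / 3"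
  have \<epsilon>: "\<epsilon> > 0" using ne by (simp add: \<epsilon>_def)
  let ?A = "\<lambda>c m n. {\<omega> \<in> space M. \<bar>S (Suc m) (Suc n) \<omega> - c\<bar> > \<epsilon>}"
  have "1 \<le> emeasure M (?A (expectation X) m n) + emeasure M (?A \<mu> m n)" for m n
  proof -
    have "space M \<subseteq> ?A (expectation X) m n \<union> ?A \<mu> m n"
    proof
      fix \<omega> assume "\<omega> \<in> space M"
      moreover have "\<bar>S (Suc m) (Suc n) \<omega> - expectation X\<bar> > \<epsilon> \<or> \<bar>S (Suc m) (Suc n) \<omega> - \<mu>\<bar> > \<epsilon>"
      proof -
        have "\<bar>expectation X - \<mu>\<bar> \<le> \<bar>S (Suc m) (Suc n) \<omega> - expectation X\<bar> + \<bar>S (Suc m) (Suc n) \<omega> - \<mu>\<bar>"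
          by linarith
        moreover have "\<bar>expectation X - \<mu>\<bar> = 3 * \<epsilon>" by (simp add: \<epsilon>_def)
        ultimately show ?thesis using \<epsilon> by (simp only: not_less[symmetric] de_Morgan_disj) argo
      qed
      ultimately show "\<omega> \<in> ?A (expectation X) m n \<union> ?A \<mu> m n" by auto
    qed
    then have "emeasure M (space M) \<le> emeasure M (?A (expectation X) m n \<union> ?A \<mu> m n)"
      by (intro emeasure_mono) auto
    also have "\<dots> \<le> emeasure M (?A (expectation X) m n) + emeasure M (?A \<mu> m n)"
      by (intro emeasure_subadditive) auto
    finally show ?thesis by (simp add: emeasure_space_1)
  qed
  then have "(\<integral>\<^sup>+(q :: nat \<times> nat). 1 \<partial>count_space UNIV)
      \<le> (\<integral>\<^sup>+(m, n). emeasure M (?A (expectation X) m n) + emeasure M (?A \<mu> m n) \<partial>count_space UNIV)"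
    by (intro nn_integral_mono) auto
  also have "\<dots> = (\<Sum>m. \<Sum>n. emeasure M (?A (expectation X) m n)) + (\<Sum>m. \<Sum>n. emeasure M (?A \<mu> m n))"
    unfolding suminf_suminf_eq_nn_integral case_prod_unfold by (rule nn_integral_add) auto
  also have "\<dots> < \<infinity>"
    using moments_imp_series[OF series_imp_moments \<epsilon>] ser[OF \<epsilon>] ser[of 1] by simp
  finally show False by (simp add: emeasure_count_space finite_prod)
qed

text \<open>Integrability of \<open>X\<close> is listed separately because the integral of a
  non-integrable function is 0 by convention. From the series it follows through the finite second
  moment.\<close>

lemma series_iff:
  "(\<forall>\<epsilon>>0. (\<Sum>m. \<Sum>n. emeasure M {\<omega> \<in> space M. \<bar>S (Suc m) (Suc n) \<omega> - \<mu>\<bar> > \<epsilon>}) < \<infinity>)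
    \<longleftrightarrow> integrable M X \<and> expectation X = \<mu> \<and> integrable M (\<lambda>\<omega>. moment \<bar>X \<omega>\<bar>)"
proof (intro iffI conjI)
  assume ser: "\<forall>\<epsilon>>0. (\<Sum>m. \<Sum>n. emeasure M {\<omega> \<in> space M. \<bar>S (Suc m) (Suc n) \<omega> - \<mu>\<bar> > \<epsilon>}) < \<infinity>"
  show mom: "integrable M (\<lambda>\<omega>. moment \<bar>X \<omega>\<bar>)" using ser by (intro series_imp_moments[of \<mu>]) auto
  show "expectation X = \<mu>" using ser by (intro series_imp_mean) auto
  show "integrable M X"
    by (rule square_integrable_imp_integrable[OF X_meas integrable_square_if_growth[OF crit_exp_ge_2 X_meas mom]])
next
  assume "integrable M X \<and> expectation X = \<mu> \<and> integrable M (\<lambda>\<omega>. moment \<bar>X \<omega>\<bar>)"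
  then have \<mu>: "\<mu> = expectation X" and mom: "integrable M (\<lambda>\<omega>. moment \<bar>X \<omega>\<bar>)" by auto
  show "\<forall>\<epsilon>>0. (\<Sum>m. \<Sum>n. emeasure M {\<omega> \<in> space M. \<bar>S (Suc m) (Suc n) \<omega> - \<mu>\<bar> > \<epsilon>}) < \<infinity>"
    unfolding \<mu> using moments_imp_series[OF mom] by blast
qed

text \<open>The five ranges exclude one another and exhaust the admissible orders, so exactly one
  premise is true. In the order listed, \<open>total_log_exp \<alpha> \<beta>\<close> takes the
  values 0, 1, 3, 2 and 1.\<close>

lemma moment_conditions_iff:
  "((\<alpha> < 1 / 2 \<and> \<alpha> < \<beta> \<longrightarrow> integrable M (\<lambda>\<omega>. \<bar>X \<omega>\<bar> powr (1 / \<alpha>))) \<and>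
    (\<alpha> = \<beta> \<and> \<beta> < 1 / 2 \<longrightarrow> integrable M (\<lambda>\<omega>. \<bar>X \<omega>\<bar> powr (1 / \<alpha>) * log_plus \<bar>X \<omega>\<bar>)) \<and>
    (\<alpha> = 1 / 2 \<and> \<beta> = 1 / 2 \<longrightarrow> integrable M (\<lambda>\<omega>. \<bar>X \<omega>\<bar> ^ 2 * (log_plus \<bar>X \<omega>\<bar>) ^ 3)) \<and>
    (\<alpha> = 1 / 2 \<and> 1 / 2 < \<beta> \<longrightarrow> integrable M (\<lambda>\<omega>. \<bar>X \<omega>\<bar> ^ 2 * (log_plus \<bar>X \<omega>\<bar>) ^ 2)) \<and>
    (1 / 2 < \<alpha> \<longrightarrow> integrable M (\<lambda>\<omega>. \<bar>X \<omega>\<bar> ^ 2 * log_plus \<bar>X \<omega>\<bar>)))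
   \<longleftrightarrow> integrable M (\<lambda>\<omega>. moment \<bar>X \<omega>\<bar>)" (is "?L \<longleftrightarrow> _")
proof -
  have sq: "growth 2 e \<bar>x\<bar> = \<bar>x\<bar> ^ 2 * log_plus \<bar>x\<bar> ^ e" for e x
    by (cases "x = 0") (auto simp: growth_def)
  consider "\<alpha> < 1 / 2" "\<alpha> < \<beta>" | "\<alpha> < 1 / 2" "\<beta> = \<alpha>" | "\<alpha> = 1 / 2" "\<beta> = 1 / 2"
    | "\<alpha> = 1 / 2" "1 / 2 < \<beta>" | "1 / 2 < \<alpha>"
    using \<alpha> by linarith
  then show ?thesis
  proof cases
    case 1
    then have "moment = (\<lambda>x. x powr (1 / \<alpha>))"
      using \<alpha> by (simp add: growth_def fun_eq_iff total_log_exp_def log_exp_def extra_log_exp_def crit_exp_less_half)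
    then show ?thesis using 1 by auto
  next
    case 2
    then have "moment = (\<lambda>x. x powr (1 / \<alpha>) * log_plus x)"
      using \<alpha> by (simp add: growth_def fun_eq_iff total_log_exp_def log_exp_def extra_log_exp_def crit_exp_less_half)
    then show ?thesis using 2 by auto
  next
    case 3
    have "total_log_exp \<alpha> \<beta> = 3" "crit_exp \<alpha> = 2"
      unfolding 3 by (simp_all add: total_log_exp_def log_exp_def extra_log_exp_def crit_exp_ge_half)
    then have m: "moment \<bar>x\<bar> = \<bar>x\<bar> ^ 2 * log_plus \<bar>x\<bar> ^ 3" for x
      by (simp only: sq)
    show ?thesis unfolding m using 3 by simp
  next
    case 4
    have "total_log_exp \<alpha> \<beta> = 2" "crit_exp \<alpha> = 2"
      using 4(2) unfolding 4(1) by (simp_all add: total_log_exp_def log_exp_def extra_log_exp_def crit_exp_ge_half)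
    then have m: "moment \<bar>x\<bar> = \<bar>x\<bar> ^ 2 * log_plus \<bar>x\<bar> ^ 2" for x
      by (simp only: sq)
    show ?thesis unfolding m using 4 by simp
  next
    case 5
    then have "total_log_exp \<alpha> \<beta> = 1" "crit_exp \<alpha> = 2"
      using \<alpha> by (auto simp: total_log_exp_def log_exp_def extra_log_exp_def crit_exp_ge_half)
    then have m: "moment \<bar>x\<bar> = \<bar>x\<bar> ^ 2 * log_plus \<bar>x\<bar> ^ 1" for x
      by (simp only: sq)
    show ?thesis unfolding m using 5 by auto
  qed
qed

end

theorem theorem4p1:
  fixes M :: "'a measure"
    and X :: "'a \<Rightarrow> real"
    and Y :: "nat \<Rightarrow> nat \<Rightarrow> 'a \<Rightarrow> real"
    and \<alpha> \<beta> \<mu> :: real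
  assumes "prob_space M"
    and "0 < \<alpha>" and "\<alpha> \<le> \<beta>" and "\<beta> \<le> 1"
    and "X \<in> borel_measurable M"
    and "prob_space.indep_vars M (\<lambda>_. borel) (\<lambda>(k, l). Y k l) UNIV"
    and "\<And>k l. distr M borel (Y k l) = distr M borel X"
  shows
    "(\<forall>\<epsilon>>0. (\<Sum>m. \<Sum>n. emeasure M {\<omega> \<in> space M.
          \<bar>cesaro_sum \<alpha> \<beta> Y (Suc m) (Suc n) \<omega> - \<mu> * cesaro \<alpha> (Suc m) * cesaro \<beta> (Suc n)\<bar>
            > cesaro \<alpha> (Suc m) * cesaro \<beta> (Suc n) * \<epsilon>}) < \<infinity>)
     \<longleftrightarrow>
     (integrable M X \<and> integral\<^sup>L M X = \<mu> \<and>
      (\<alpha> < 1/2 \<and> \<alpha> < \<beta> \<longrightarrow> integrable M (\<lambda>\<omega>. \<bar>X \<omega>\<bar> powr (1/\<alpha>))) \<and>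
      (\<alpha> = \<beta> \<and> \<beta> < 1/2 \<longrightarrow> integrable M (\<lambda>\<omega>. \<bar>X \<omega>\<bar> powr (1/\<alpha>) * log_plus \<bar>X \<omega>\<bar>)) \<and>
      (\<alpha> = 1/2 \<and> \<beta> = 1/2 \<longrightarrow> integrable M (\<lambda>\<omega>. \<bar>X \<omega>\<bar>^2 * (log_plus \<bar>X \<omega>\<bar>)^3)) \<and>
      (\<alpha> = 1/2 \<and> 1/2 < \<beta> \<longrightarrow> integrable M (\<lambda>\<omega>. \<bar>X \<omega>\<bar>^2 * (log_plus \<bar>X \<omega>\<bar>)^2)) \<and>
      (1/2 < \<alpha> \<longrightarrow> integrable M (\<lambda>\<omega>. \<bar>X \<omega>\<bar>^2 * log_plus \<bar>X \<omega>\<bar>)))"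
proof -
  interpret prob_space M by fact
  interpret A: iid_array M X "\<lambda>(k, l). Y k l" \<alpha> \<beta>
  proof unfold_locales
    show "distr M borel (case i of (k, l) \<Rightarrow> Y k l) = distr M borel X" for i
      by (cases i) (simp add: assms)
  qed (fact assms)+
  \<comment> \<open>Division by the positive product of the two Cesaro numbers turns the event into
    one about the normalised sum.\<close>
  have ev: "{\<omega> \<in> space M. \<bar>cesaro_sum \<alpha> \<beta> Y m n \<omega> - \<mu> * cesaro \<alpha> m * cesaro \<beta> n\<bar> > cesaro \<alpha> m * cesaro \<beta> n * \<epsilon>}
      = {\<omega> \<in> space M. \<bar>A.S m n \<omega> - \<mu>\<bar> > \<epsilon>}" for m n \<epsilon>
  proof -
    let ?N = "cesaro \<alpha> m * cesaro \<beta> n"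
    have N: "?N > 0" using cesaro_pos[of \<alpha> m] cesaro_pos[of \<beta> n] assms by simp
    have "cesaro_sum \<alpha> \<beta> Y m n \<omega> = ?N * A.S m n \<omega>" for \<omega>
    proof -
      have "?N * A.S m n \<omega> = (\<Sum>(k, l)\<in>{..m} \<times> {..n}. cesaro (\<alpha> - 1) (m - k) * cesaro (\<beta> - 1) (n - l) * Y k l \<omega>)"
        unfolding A.S_def sum_distrib_left using N
        by (intro sum.cong) (auto simp: A.W_def nweight_def)
      then show ?thesis
        by (simp add: cesaro_sum_def sum.cartesian_product atMost_atLeast0)
    qed
    then have "cesaro_sum \<alpha> \<beta> Y m n \<omega> - \<mu> * cesaro \<alpha> m * cesaro \<beta> n = ?N * (A.S m n \<omega> - \<mu>)" for \<omega>
      by (simp add: algebra_simps)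
    then have "\<bar>cesaro_sum \<alpha> \<beta> Y m n \<omega> - \<mu> * cesaro \<alpha> m * cesaro \<beta> n\<bar> = ?N * \<bar>A.S m n \<omega> - \<mu>\<bar>" for \<omega>
      using N by (simp only: abs_mult[of ?N] abs_of_pos)
    then show ?thesis using N by (simp only: mult_less_cancel_left_pos)
  qed
  show ?thesis
    unfolding ev A.moment_conditions_iff by (rule A.series_iff)
qed

end
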